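(* Let the control model $\mathfrak{M}(\eta,\Delta)$ be absorbing. (i) A measure $\mu\in\mathcal{M}^+(\mathbf{X}\times\mathbf{A})$ belongs to $\mathcal{C}_\eta$ if and only if there exist $\sigma\in\mathbf{M}$ and $\nu\in\mathcal{M}^+(\mathbf{X})$ such that $\nu\otimes\sigma$ is $Q\mathbb{I}_{\Delta^c}$-invariant and $\mu=\mu_{\eta,\sigma}+\nu\otimes\sigma$ (where $\mu_{\eta,\sigma}\in\mathcal{O}^s_\eta$ is the occupation measure of the stationary randomized policy $\sigma$). (ii) The following statements are equivalent: (a) The unique $Q\mathbb{I}_{\Delta^c}$-invariant measure is the null measure on $\mathbf{X}\times\mathbf{A}$. (b) $\mathcal{C}_\eta=\mathcal{O}_\eta$ (that is, there are no phantom measures). (c) The set $\mathcal{C}_\eta$ is bounded (that is, $\sup_{\mu\in\mathcal{C}_\eta}\mu(\mathbf{X}\times\mathbf{A})<\infty$).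
   Context: For a measurable space $\mathbf{\Omega}$, $\mathcal{M}^+(\mathbf{\Omega})$ is the set of finite nonnegative measures and $\mathcal{P}(\mathbf{\Omega})$ the set of probability measures on it. For $\mu\in\mathcal{M}^+(\mathbf{X}\times\mathbf{A})$, $\mu^{\mathbf{X}}=\mu(\cdot\times\mathbf{A})$ is its $\mathbf{X}$-marginal. For a measure $\nu$ on $\mathbf{X}$ and a stochastic kernel $\sigma$ on $\mathbf{A}$ given $\mathbf{X}$, $\nu\otimes\sigma$ is the measure on $\mathbf{X}\times\mathbf{A}$ with $(\nu\otimes\sigma)(\Gamma\times\Lambda)=\int_\Gamma\sigma(\Lambda|x)\nu(dx)$. Control model. $(\mathbf{X},\mathfrak{X})$ is a measurable space (state space); $\mathbf{A}$ is a Borel space (action space) with Borel $\sigma$-algebra $\mathfrak{B}(\mathbf{A})$; for each $x\in\mathbf{X}$, $\mathbf{A}(x)\subseteq\mathbf{A}$ is a nonempty measurable set of available actions; $\mathbf{K}=\{(x,a):a\in\mathbf{A}(x)\}$ is assumed to be in $\mathfrak{X}\otimes\mathfrak{B}(\mathbf{A})$ and to contain the graph of a measurable function $f:\mathbf{X}\to\mathbf{A}$ with $f(x)\in\mathbf{A}(x)$ for all $x$; $Q$ is a stochastic kernel on $\mathbf{X}$ given $\mathbf{X}\times\mathbf{A}$; $\eta\in\mathcal{P}(\mathbf{X})$ is an initial distribution; $\Delta\in\mathfrak{X}$ is a given set. This model is denoted $\mathfrak{M}(\eta,\Delta)$. Policies. Let $\mathbf{H}_0=\mathbf{X}$, $\mathbf{H}_n=\mathbf{H}_{n-1}\times\mathbf{A}\times\mathbf{X}$.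 A policy $\pi=\{\pi_n\}_{n\ge0}\in\mathbf{\Pi}$ is a sequence of stochastic kernels $\pi_n$ on $\mathbf{A}$ given $\mathbf{H}_n$ with $\pi_n(\mathbf{A}(x_n)|h_n)=1$ for all $h_n=(x_0,a_0,\ldots,x_n)\in\mathbf{H}_n$. $\mathbf{M}$ is the set of stochastic kernels $\sigma$ on $\mathbf{A}$ given $\mathbf{X}$ with $\sigma(\mathbf{A}(x)|x)=1$ for all $x$; each $\sigma\in\mathbf{M}$ is identified with the stationary randomized policy $\pi_n(\cdot|h_n)=\sigma(\cdot|x_n)$. For an initial distribution $\lambda\in\mathcal{P}(\mathbf{X})$ and $\pi\in\mathbf{\Pi}$, $\mathbb{P}_{\lambda,\pi}$ (expectation $\mathbb{E}_{\lambda,\pi}$) is the unique probability measure on $(\mathbf{X}\times\mathbf{A})^\infty$ under which the coordinate processes satisfy $X_0\sim\lambda$, $\mathbb{P}_{\lambda,\pi}(A_n\in\cdot\mid X_0,A_0,\ldots,X_n)=\pi_n(\cdot\mid X_0,A_0,\ldots,X_n)$ and $\mathbb{P}_{\lambda,\pi}(X_{n+1}\in\cdot\mid X_0,A_0,\ldots,X_n,A_n)=Q(\cdot\mid X_n,A_n)$ almost surely. Let $T_\Delta=\min\{n\ge0:X_n\in\Delta\}$ ($=\infty$ if there is no such $n$). The model $\mathfrak{M}(\lambda,\Delta)$ is absorbing if (a) $Q(\Delta|x,a)=1$ for all $(x,a)\in\Delta\times\mathbf{A}$, and (b) $\mathbb{E}_{\lambda,\pi}[T_\Delta]<\infty$ for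 every $\pi\in\mathbf{\Pi}$. Occupation measures. $\mu_{\lambda,\pi}(\Gamma)=\mathbb{E}_{\lambda,\pi}\big[\sum_{t=0}^\infty \mathbf{1}_{\{T_\Delta>t\}}\mathbf{1}_{\{(X_t,A_t)\in\Gamma\}}\big]$ for $\Gamma\in\mathfrak{X}\otimes\mathfrak{B}(\mathbf{A})$; $\mathcal{O}_\lambda=\{\mu_{\lambda,\pi}:\pi\in\mathbf{\Pi}\}$ and $\mathcal{O}^s_\lambda=\{\mu_{\lambda,\sigma}:\sigma\in\mathbf{M}\}$. Characteristic equations. $\mathcal{C}_\eta$ is the set of $\mu\in\mathcal{M}^+(\mathbf{X}\times\mathbf{A})$ such that $\mu(\mathbf{K}^c)=0$ and $\mu^{\mathbf{X}}(B)=\eta(B\cap\Delta^c)+\int_{\mathbf{X}\times\mathbf{A}}Q(B\cap\Delta^c|x,a)\mu(dx,da)$ for all $B\in\mathfrak{X}$. A phantom measure is an element of $\mathcal{C}_\eta\setminus\mathcal{O}_\eta$. Invariant measures. $\vartheta\in\mathcal{M}^+(\mathbf{X}\times\mathbf{A})$ is $Q\mathbb{I}_{\Delta^c}$-invariant if $\vartheta(\mathbf{K}^c)=0$ and $\vartheta^{\mathbf{X}}(B)=\int_{\mathbf{X}\times\mathbf{A}}Q(B\cap\Delta^c|x,a)\vartheta(dx,da)$ for all $B\in\mathfrak{X}$ (the null measure is allowed). *)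

theory Defs
  imports "HOL-Probability.Probability"
begin

subsection \<open>Measures\<close>

definition finite_measures :: "'a measure \<Rightarrow> 'a measure set" where
  "finite_measures \<Omega> = {\<mu>. sets \<mu> = sets \<Omega> \<and> finite_measure \<mu>}"

definition measure_add :: "'a measure \<Rightarrow> 'a measure \<Rightarrow> 'a measure" where
  "measure_add \<mu> \<nu> = measure_of (space \<mu>) (sets \<mu>) (\<lambda>\<Gamma>. emeasure \<mu> \<Gamma> + emeasure \<nu> \<Gamma>)"

lemma sets_measure_add [simp]: "sets (measure_add \<mu> \<nu>) = sets \<mu>"
  by (simp add: measure_add_def)

lemma emeasure_measure_add:
  assumes "sets \<mu> = sets \<nu>" "\<Gamma> \<in> sets \<mu>"
  shows "emeasure (measure_add \<mu> \<nu>) \<Gamma> = emeasure \<mu> \<Gamma> + emeasure \<nu> \<Gamma>"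
  unfolding measure_add_def
proof (rule emeasure_measure_of_sigma)
  show "sigma_algebra (space \<mu>) (sets \<mu>)"
    by (rule sets.sigma_algebra_axioms)
  show "positive (sets \<mu>) (\<lambda>\<Gamma>. emeasure \<mu> \<Gamma> + emeasure \<nu> \<Gamma>)"
    by (simp add: positive_def)
  show "countably_additive (sets \<mu>) (\<lambda>\<Gamma>. emeasure \<mu> \<Gamma> + emeasure \<nu> \<Gamma>)"
  proof (rule countably_additiveI)
    fix B :: "nat \<Rightarrow> 'a set"
    assume B: "range B \<subseteq> sets \<mu>" "disjoint_family B"
    then have "range B \<subseteq> sets \<nu>"
      using assms(1) by simp
    with B show "(\<Sum>i. emeasure \<mu> (B i) + emeasure \<nu> (B i))
        = emeasure \<mu> (\<Union>i. B i) + emeasure \<nu> (\<Union>i. B i)"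
      by (simp add: suminf_add[symmetric] suminf_emeasure)
  qed
qed fact


text \<open>\<open>kernel_product N L \<nu> \<sigma>\<close> is \<open>\<nu> \<otimes> \<sigma>\<close>, for a kernel \<open>\<sigma>\<close> on \<open>L\<close> given \<open>N\<close>;
  see \<open>emeasure_kernel_product\<close>.\<close>

definition kernel_product ::
    "'a measure \<Rightarrow> 'b measure \<Rightarrow> 'a measure \<Rightarrow> ('a \<Rightarrow> 'b measure) \<Rightarrow> ('a \<times> 'b) measure" where
  "kernel_product N L \<nu> \<sigma> = \<nu> \<bind> (\<lambda>y. distr (\<sigma> y) (N \<Otimes>\<^sub>M L) (Pair y))"

lemma kernel_product_kernel:
  assumes \<kappa>[measurable]: "\<kappa> \<in> N \<rightarrow>\<^sub>M prob_algebra L"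
  shows "(\<lambda>y. distr (\<kappa> y) (N \<Otimes>\<^sub>M L) (Pair y)) \<in> N \<rightarrow>\<^sub>M prob_algebra (N \<Otimes>\<^sub>M L)"
  by (rule measurable_distr_prob_space2[where M = L]) measurable

lemma emeasure_kernel_product:
  assumes \<mu>: "sets \<mu> = sets N" "space \<mu> \<noteq> {}" and \<kappa>: "\<kappa> \<in> N \<rightarrow>\<^sub>M prob_algebra L"
    and [measurable]: "B \<in> sets N" "\<Lambda> \<in> sets L"
  shows "emeasure (kernel_product N L \<mu> \<kappa>) (B \<times> \<Lambda>) = (\<integral>\<^sup>+y\<in>B. emeasure (\<kappa> y) \<Lambda> \<partial>\<mu>)"
proof -
  have s: "space \<mu> = space N" using \<mu> sets_eq_imp_space_eq by auto
  have m: "(\<lambda>y. distr (\<kappa> y) (N \<Otimes>\<^sub>M L) (Pair y)) \<in> \<mu> \<rightarrow>\<^sub>M subprob_algebra (N \<Otimes>\<^sub>M L)"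
    using measurable_prob_algebraD[OF kernel_product_kernel[OF \<kappa>]] by (simp add: measurable_cong_sets[OF \<mu>(1) refl])
  have "emeasure (kernel_product N L \<mu> \<kappa>) (B \<times> \<Lambda>) = (\<integral>\<^sup>+y. emeasure (distr (\<kappa> y) (N \<Otimes>\<^sub>M L) (Pair y)) (B \<times> \<Lambda>) \<partial>\<mu>)"
    unfolding kernel_product_def by (rule emeasure_bind[OF \<mu>(2) m]) auto
  also have "\<dots> = (\<integral>\<^sup>+y\<in>B. emeasure (\<kappa> y) \<Lambda> \<partial>\<mu>)"
  proof (rule nn_integral_cong)
    fix y assume "y \<in> space \<mu>"
    then have y: "y \<in> space N" by (simp add: s)
    have sk: "sets (\<kappa> y) = sets L" using measurable_space[OF \<kappa> y] by (auto simp: space_prob_algebra)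
    have "Pair y \<in> \<kappa> y \<rightarrow>\<^sub>M N \<Otimes>\<^sub>M L" using y by (auto simp: measurable_cong_sets[OF sk refl])
    moreover have "Pair y -` (B \<times> \<Lambda>) \<inter> space (\<kappa> y) = (if y \<in> B then \<Lambda> else {})"
      using sets.sets_into_space[of \<Lambda> L] sets_eq_imp_space_eq[OF sk] by auto
    ultimately show "emeasure (distr (\<kappa> y) (N \<Otimes>\<^sub>M L) (Pair y)) (B \<times> \<Lambda>) = emeasure (\<kappa> y) \<Lambda> * indicator B y"
      by (simp add: emeasure_distr)
  qed
  finally show ?thesis .
qed


subsection \<open>The control model\<close>

text \<open>A Borel space is a Borel subset of a Polish space; the action space is such a subset
  of the type \<open>'a\<close>. Of the measure \<open>states\<close> only the measurable space is used.\<close>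

record ('x, 'a) mdp =
  states :: "'x measure"
  actions :: "'a set"
  available :: "'x \<Rightarrow> 'a set"
  transition :: "'x \<times> 'a \<Rightarrow> 'x measure"
  target :: "'x set"

definition action_space :: "('x, 'a::polish_space) mdp \<Rightarrow> 'a measure" where
  "action_space M = restrict_space borel (actions M)"

definition state_action :: "('x, 'a::polish_space) mdp \<Rightarrow> ('x \<times> 'a) measure" where
  "state_action M = states M \<Otimes>\<^sub>M action_space M"

definition constraint_set :: "('x, 'a) mdp \<Rightarrow> ('x \<times> 'a) set" where
  "constraint_set M = {(x, a). x \<in> space (states M) \<and> a \<in> available M x}"

locale control_model =
  fixes M :: "('x, 'a::polish_space) mdp"
  assumes actions_borel: "actions M \<in> sets borel"
    and available_sets: "\<And>x. x \<in> space (states M) \<Longrightarrow> available M x \<in> sets (action_space M)"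
    and available_nonempty: "\<And>x. x \<in> space (states M) \<Longrightarrow> available M x \<noteq> {}"
    and constraint_sets: "constraint_set M \<in> sets (state_action M)"
    and selector: "\<exists>f \<in> states M \<rightarrow>\<^sub>M action_space M. \<forall>x \<in> space (states M). f x \<in> available M x"
    and transition_kernel: "transition M \<in> state_action M \<rightarrow>\<^sub>M prob_algebra (states M)"
    and target_sets: "target M \<in> sets (states M)"


subsection \<open>Policies\<close>

text \<open>A history \<open>(x\<^sub>0, a\<^sub>0, \<dots>, a\<^sub>n\<^sub>-\<^sub>1, x\<^sub>n)\<close> is encoded as the pair of the family
  \<open>((x\<^sub>i, a\<^sub>i))\<^sub>i\<^sub><\<^sub>n\<close> and the current state \<open>x\<^sub>n\<close>.\<close>

definition history_space ::
    "('x, 'a::polish_space) mdp \<Rightarrow> nat \<Rightarrow> ((nat \<Rightarrow> 'x \<times> 'a) \<times> 'x) measure" where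
  "history_space M n = (\<Pi>\<^sub>M i\<in>{0..<n}. state_action M) \<Otimes>\<^sub>M states M"

definition policies ::
    "('x, 'a::polish_space) mdp \<Rightarrow> (nat \<Rightarrow> (nat \<Rightarrow> 'x \<times> 'a) \<times> 'x \<Rightarrow> 'a measure) set" where
  "policies M = {\<pi>. \<forall>n. \<pi> n \<in> history_space M n \<rightarrow>\<^sub>M prob_algebra (action_space M) \<and>
     (\<forall>h \<in> space (history_space M n). emeasure (\<pi> n h) (available M (snd h)) = 1)}"

definition admissible_kernels :: "('x, 'a::polish_space) mdp \<Rightarrow> ('x \<Rightarrow> 'a measure) set" where
  "admissible_kernels M = {\<sigma> \<in> states M \<rightarrow>\<^sub>M prob_algebra (action_space M).
     \<forall>x \<in> space (states M). emeasure (\<sigma> x) (available M x) = 1}"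

definition stationary ::
    "('x \<Rightarrow> 'a measure) \<Rightarrow> nat \<Rightarrow> (nat \<Rightarrow> 'x \<times> 'a) \<times> 'x \<Rightarrow> 'a measure" where
  "stationary \<sigma> n h = \<sigma> (snd h)"


subsection \<open>The controlled process\<close>

definition path_space :: "('x, 'a::polish_space) mdp \<Rightarrow> (nat \<Rightarrow> 'x \<times> 'a) measure" where
  "path_space M = (\<Pi>\<^sub>M i\<in>UNIV. state_action M)"

text \<open>The sequences \<open>(X\<^sub>0, A\<^sub>0, \<dots>, X\<^sub>n\<^sub>-\<^sub>1, A\<^sub>n\<^sub>-\<^sub>1)\<close> and \<open>(X\<^sub>0, A\<^sub>0, \<dots>, X\<^sub>n)\<close> along a path.\<close>

definition past :: "nat \<Rightarrow> (nat \<Rightarrow> 'x \<times> 'a) \<Rightarrow> (nat \<Rightarrow> 'x \<times> 'a)" where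
  "past n \<omega> = restrict \<omega> {0..<n}"

definition history :: "nat \<Rightarrow> (nat \<Rightarrow> 'x \<times> 'a) \<Rightarrow> (nat \<Rightarrow> 'x \<times> 'a) \<times> 'x" where
  "history n \<omega> = (past n \<omega>, fst (\<omega> n))"

text \<open>The conditional probabilities are conditional expectations of indicators, given the
  \<open>\<sigma>\<close>-algebra generated by the conditioning variable.\<close>

definition is_path_measure ::
    "('x, 'a::polish_space) mdp \<Rightarrow> 'x measure \<Rightarrow> (nat \<Rightarrow> (nat \<Rightarrow> 'x \<times> 'a) \<times> 'x \<Rightarrow> 'a measure)
      \<Rightarrow> (nat \<Rightarrow> 'x \<times> 'a) measure \<Rightarrow> bool" where
  "is_path_measure M \<eta> \<pi> P \<longleftrightarrow>
     prob_space P \<and> sets P = sets (path_space M) \<and>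
     distr P (states M) (\<lambda>\<omega>. fst (\<omega> 0)) = \<eta> \<and>
     (\<forall>n. \<forall>\<Lambda> \<in> sets (action_space M). AE \<omega> in P.
        real_cond_exp P (vimage_algebra (space P) (history n) (history_space M n))
          (indicator {\<omega>. snd (\<omega> n) \<in> \<Lambda>}) \<omega> = measure (\<pi> n (history n \<omega>)) \<Lambda>) \<and>
     (\<forall>n. \<forall>B \<in> sets (states M). AE \<omega> in P.
        real_cond_exp P (vimage_algebra (space P) (past (Suc n)) (\<Pi>\<^sub>M i\<in>{0..<Suc n}. state_action M))
          (indicator {\<omega>. fst (\<omega> (Suc n)) \<in> B}) \<omega> = measure (transition M (\<omega> n)) B)"

definition path_measure ::
    "('x, 'a::polish_space) mdp \<Rightarrow> 'x measure \<Rightarrow> (nat \<Rightarrow> (nat \<Rightarrow> 'x \<times> 'a) \<times> 'x \<Rightarrow> 'a measure)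
      \<Rightarrow> (nat \<Rightarrow> 'x \<times> 'a) measure" where
  "path_measure M \<eta> \<pi> = (THE P. is_path_measure M \<eta> \<pi> P)"

text \<open>The infimum is attained, and it is \<open>\<infinity>\<close> if the target is never hit.\<close>

definition hitting_time :: "('x, 'a) mdp \<Rightarrow> (nat \<Rightarrow> 'x \<times> 'a) \<Rightarrow> enat" where
  "hitting_time M \<omega> = (INF n \<in> {n. fst (\<omega> n) \<in> target M}. enat n)"

definition absorbing :: "('x, 'a::polish_space) mdp \<Rightarrow> 'x measure \<Rightarrow> bool" where
  "absorbing M \<eta> \<longleftrightarrow>
     (\<forall>x \<in> target M. \<forall>a \<in> actions M. emeasure (transition M (x, a)) (target M) = 1) \<and>
     (\<forall>\<pi> \<in> policies M. (\<integral>\<^sup>+\<omega>. ennreal_of_enat (hitting_time M \<omega>) \<partial>path_measure M \<eta> \<pi>) < \<infinity>)"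


subsection \<open>Occupation measures, characteristic equations, invariant measures\<close>

definition occupation_measure ::
    "('x, 'a::polish_space) mdp \<Rightarrow> 'x measure \<Rightarrow> (nat \<Rightarrow> (nat \<Rightarrow> 'x \<times> 'a) \<times> 'x \<Rightarrow> 'a measure)
      \<Rightarrow> ('x \<times> 'a) measure" where
  "occupation_measure M \<eta> \<pi> = measure_of (space (state_action M)) (sets (state_action M))
     (\<lambda>\<Gamma>. \<integral>\<^sup>+\<omega>. (\<Sum>t. indicator {\<omega>. hitting_time M \<omega> > enat t} \<omega> * indicator {\<omega>. \<omega> t \<in> \<Gamma>} \<omega>)
        \<partial>path_measure M \<eta> \<pi>)"

definition occupation_measures ::
    "('x, 'a::polish_space) mdp \<Rightarrow> 'x measure \<Rightarrow> ('x \<times> 'a) measure set" where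
  "occupation_measures M \<eta> = occupation_measure M \<eta> ` policies M"

definition marginal :: "('x, 'a) mdp \<Rightarrow> ('x \<times> 'a) measure \<Rightarrow> 'x measure" where
  "marginal M \<mu> = distr \<mu> (states M) fst"

definition characteristic_solutions ::
    "('x, 'a::polish_space) mdp \<Rightarrow> 'x measure \<Rightarrow> ('x \<times> 'a) measure set" where
  "characteristic_solutions M \<eta> = {\<mu> \<in> finite_measures (state_action M).
     emeasure \<mu> (space (state_action M) - constraint_set M) = 0 \<and>
     (\<forall>B \<in> sets (states M). emeasure (marginal M \<mu>) B =
        emeasure \<eta> (B - target M) + (\<integral>\<^sup>+z. emeasure (transition M z) (B - target M) \<partial>\<mu>))}"

definition invariant_measures ::
    "('x, 'a::polish_space) mdp \<Rightarrow> ('x \<times> 'a) measure set" where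
  "invariant_measures M = {\<theta> \<in> finite_measures (state_action M).
     emeasure \<theta> (space (state_action M) - constraint_set M) = 0 \<and>
     (\<forall>B \<in> sets (states M). emeasure (marginal M \<theta>) B =
        (\<integral>\<^sup>+z. emeasure (transition M z) (B - target M) \<partial>\<theta>))}"

subsection \<open>The path measure and the occupation measures are well defined\<close>

lemma cond_prob_iff:
  assumes P: "prob_space P" and Y[measurable]: "Y \<in> P \<rightarrow>\<^sub>M N" and Z[measurable]: "Z \<in> P \<rightarrow>\<^sub>M L"
    and \<kappa>[measurable]: "\<kappa> \<in> N \<rightarrow>\<^sub>M prob_algebra L" and L[measurable]: "\<Lambda> \<in> sets L"
  shows "(AE \<omega> in P. real_cond_exp P (vimage_algebra (space P) Y N) (indicator {\<omega>. Z \<omega> \<in> \<Lambda>}) \<omega>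
            = measure (\<kappa> (Y \<omega>)) \<Lambda>) \<longleftrightarrow>
    (\<forall>B \<in> sets N. emeasure (distr P (N \<Otimes>\<^sub>M L) (\<lambda>\<omega>. (Y \<omega>, Z \<omega>))) (B \<times> \<Lambda>) = (\<integral>\<^sup>+y\<in>B. emeasure (\<kappa> y) \<Lambda> \<partial>distr P N Y))"
    (is "?L \<longleftrightarrow> ?R")
proof -
  interpret P: prob_space P by fact
  let ?F = "vimage_algebra (space P) Y N"
  have Ysp: "Y \<in> space P \<rightarrow> space N" using measurable_space[OF Y] by auto
  have sF: "sets ?F = {Y -` B \<inter> space P | B. B \<in> sets N}"
    by (rule sets_vimage_algebra2[OF Ysp])
  have sub: "subalgebra P ?F"
    unfolding subalgebra_def sF by (auto intro: measurable_sets[OF Y])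
  interpret F: finite_measure_subalgebra P ?F
    by standard (rule sub)
  let ?E = "{\<omega> \<in> space P. Z \<omega> \<in> \<Lambda>}"
  let ?f = "indicator {\<omega>. Z \<omega> \<in> \<Lambda>} :: _ \<Rightarrow> real"
  let ?g = "\<lambda>\<omega>. measure (\<kappa> (Y \<omega>)) \<Lambda>"
  have pk: "prob_space (\<kappa> y)" if "y \<in> space N" for y
    using measurable_space[OF \<kappa> that] by (auto simp: space_prob_algebra)
  have gN: "(\<lambda>y. measure (\<kappa> y) \<Lambda>) \<in> borel_measurable N"
    by measurable
  have eN[measurable]: "(\<lambda>y. emeasure (\<kappa> y) \<Lambda>) \<in> borel_measurable N"
    by (rule measurable_compose[OF measurable_prob_algebraD[OF \<kappa>] measurable_emeasure_subprob_algebra[OF L]])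
  have em: "emeasure (\<kappa> (Y \<omega>)) \<Lambda> = ennreal (?g \<omega>)" if "\<omega> \<in> space P" for \<omega>
    by (rule finite_measure.emeasure_eq_measure[OF prob_space.finite_measure[OF pk]]) (use Ysp that in auto)
  have YF: "Y \<in> ?F \<rightarrow>\<^sub>M N" by (rule measurable_vimage_algebra1[OF Ysp])
  have gF: "?g \<in> borel_measurable ?F"
    by (rule measurable_compose[OF YF gN])
  have gP[measurable]: "?g \<in> borel_measurable P"
    by measurable
  have g1: "norm (?g \<omega>) \<le> 1" if "\<omega> \<in> space P" for \<omega>
    using prob_space.prob_le_1[OF pk] Ysp that by auto
  have gi: "integrable P ?g"
    by (rule P.integrable_const_bound[where B=1]) (use g1 in auto)
  have [measurable]: "?E \<in> sets P" by measurable
  have fm[measurable]: "?f \<in> borel_measurable P"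
    by (subst measurable_cong[where g="indicator ?E"]) (auto split: split_indicator)
  have fi: "integrable P ?f"
    by (rule P.integrable_const_bound[where B=1]) (auto split: split_indicator)
  have nf: "(LINT \<omega>:Y -` B \<inter> space P|P. ?f \<omega>) = measure P (Y -` B \<inter> ?E)" for B
  proof -
    have "(LINT \<omega>:Y -` B \<inter> space P|P. ?f \<omega>) = (LINT \<omega>|P. indicator (Y -` B \<inter> ?E) \<omega>)"
      unfolding set_lebesgue_integral_def by (intro Bochner_Integration.integral_cong) (auto split: split_indicator)
    then show ?thesis by (simp add: Int_assoc)
  qed
  have e1: "emeasure (distr P (N \<Otimes>\<^sub>M L) (\<lambda>\<omega>. (Y \<omega>, Z \<omega>))) (B \<times> \<Lambda>) = ennreal (LINT \<omega>:Y -` B \<inter> space P|P. ?f \<omega>)"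
    if [measurable]: "B \<in> sets N" for B
    unfolding nf
    by (subst emeasure_distr) (auto simp: P.emeasure_eq_measure intro!: arg_cong[where f="measure P"])
  have e2: "(\<integral>\<^sup>+y\<in>B. emeasure (\<kappa> y) \<Lambda> \<partial>distr P N Y) = ennreal (LINT \<omega>:Y -` B \<inter> space P|P. ?g \<omega>)"
    if B[measurable]: "B \<in> sets N" for B
  proof -
    have "(\<integral>\<^sup>+y\<in>B. emeasure (\<kappa> y) \<Lambda> \<partial>distr P N Y) = (\<integral>\<^sup>+\<omega>. emeasure (\<kappa> (Y \<omega>)) \<Lambda> * indicator B (Y \<omega>) \<partial>P)"
      by (subst nn_integral_distr) auto
    also have "\<dots> = (\<integral>\<^sup>+\<omega>. ennreal (indicator (Y -` B \<inter> space P) \<omega> * ?g \<omega>) \<partial>P)"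
      by (intro nn_integral_cong) (auto split: split_indicator simp: em)
    also have "\<dots> = ennreal (\<integral>\<omega>. indicator (Y -` B \<inter> space P) \<omega> * ?g \<omega> \<partial>P)"
      using integrable_mult_indicator[OF _ gi, of "Y -` B \<inter> space P"]
      by (intro nn_integral_eq_integral) auto
    finally show ?thesis by (simp add: set_lebesgue_integral_def)
  qed
  have nn: "0 \<le> (LINT \<omega>:C|P. ?f \<omega>)" "0 \<le> (LINT \<omega>:C|P. ?g \<omega>)" for C
    by (auto simp: set_lebesgue_integral_def intro!: integral_nonneg_AE)
  have R: "?R \<longleftrightarrow> (\<forall>C \<in> sets ?F. (LINT \<omega>:C|P. ?f \<omega>) = (LINT \<omega>:C|P. ?g \<omega>))"
    using nn by (auto simp: e1 e2 sF)
  show ?thesis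
  proof
    assume ?R
    then show ?L unfolding R
      by (intro F.real_cond_exp_charact fi gi gF) auto
  next
    assume ae: ?L
    show ?R unfolding R
    proof
      fix C assume C: "C \<in> sets ?F"
      then have [measurable]: "C \<in> sets P" using sub by (auto simp: subalgebra_def)
      have "(LINT \<omega>:C|P. ?f \<omega>) = (LINT \<omega>:C|P. real_cond_exp P ?F ?f \<omega>)"
        by (rule F.real_cond_exp_intA[OF fi C])
      also have "\<dots> = (LINT \<omega>:C|P. ?g \<omega>)"
        unfolding set_lebesgue_integral_def
        by (rule integral_cong_AE) (use ae in auto)
      finally show "(LINT \<omega>:C|P. ?f \<omega>) = (LINT \<omega>:C|P. ?g \<omega>)" .
    qed
  qed
qed

lemma kernel_product_space:
  assumes \<mu>: "\<mu> \<in> space (prob_algebra N)" and \<kappa>: "\<kappa> \<in> N \<rightarrow>\<^sub>M prob_algebra L"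
  shows "kernel_product N L \<mu> \<kappa> \<in> space (prob_algebra (N \<Otimes>\<^sub>M L))"
  unfolding kernel_product_def
  using measurable_space[OF measurable_bind_prob_space[OF measurable_ident kernel_product_kernel[OF \<kappa>]] \<mu>] by (simp add: id_def)

lemma pair_measure_eqI_rectangles:
  assumes "\<mu> \<in> space (prob_algebra (N \<Otimes>\<^sub>M L))" "\<nu> \<in> space (prob_algebra (N \<Otimes>\<^sub>M L))"
    "\<And>B \<Lambda>. B \<in> sets N \<Longrightarrow> \<Lambda> \<in> sets L \<Longrightarrow> emeasure \<mu> (B \<times> \<Lambda>) = emeasure \<nu> (B \<times> \<Lambda>)"
  shows "\<mu> = \<nu>"
proof (rule measure_eqI_generator_eq[where \<Omega>="space N \<times> space L" and E="{a \<times> b | a b. a \<in> sets N \<and> b \<in> sets L}"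
    and A="\<lambda>_. space N \<times> space L"])
  have s: "sets \<mu> = sets (N \<Otimes>\<^sub>M L)" "sets \<nu> = sets (N \<Otimes>\<^sub>M L)" using assms by (auto simp: space_prob_algebra)
  interpret m: prob_space \<mu> using assms by (auto simp: space_prob_algebra)
  show "sets \<mu> = sigma_sets (space N \<times> space L) {a \<times> b |a b. a \<in> sets N \<and> b \<in> sets L}"
    "sets \<nu> = sigma_sets (space N \<times> space L) {a \<times> b |a b. a \<in> sets N \<and> b \<in> sets L}"
    by (simp_all add: s sets_pair_measure)
  show "Int_stable {a \<times> b |a b. a \<in> sets N \<and> b \<in> sets L}" by (rule Int_stable_pair_measure_generator)
  show "{a \<times> b |a b. a \<in> sets N \<and> b \<in> sets L} \<subseteq> Pow (space N \<times> space L)" by (rule pair_measure_closed)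
qed (use assms in \<open>auto simp: space_prob_algebra prob_space.finite_measure finite_measure.emeasure_finite\<close>)

lemma cond_law_iff:
  assumes P: "prob_space P" and Y[measurable]: "Y \<in> P \<rightarrow>\<^sub>M N" and Z[measurable]: "Z \<in> P \<rightarrow>\<^sub>M L"
    and \<kappa>[measurable]: "\<kappa> \<in> N \<rightarrow>\<^sub>M prob_algebra L" 
  shows "(\<forall>\<Lambda>\<in>sets L. AE \<omega> in P. real_cond_exp P (vimage_algebra (space P) Y N) (indicator {\<omega>. Z \<omega> \<in> \<Lambda>}) \<omega>
            = measure (\<kappa> (Y \<omega>)) \<Lambda>) \<longleftrightarrow>
    distr P (N \<Otimes>\<^sub>M L) (\<lambda>\<omega>. (Y \<omega>, Z \<omega>)) = kernel_product N L (distr P N Y) \<kappa>"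
proof -
  have d: "distr P N Y \<in> space (prob_algebra N)" "distr P (N \<Otimes>\<^sub>M L) (\<lambda>\<omega>. (Y \<omega>, Z \<omega>)) \<in> space (prob_algebra (N \<Otimes>\<^sub>M L))"
    using P by (auto simp: space_prob_algebra intro!: prob_space.prob_space_distr)
  have d1: "sets (distr P N Y) = sets N" "space (distr P N Y) \<noteq> {}"
    using prob_space.not_empty[of "distr P N Y"] d(1) by (auto simp: space_prob_algebra)
  show ?thesis
    using pair_measure_eqI_rectangles[OF d(2) kernel_product_space[OF d(1) \<kappa>]] emeasure_kernel_product[OF d1 \<kappa>]
    by (auto simp: cond_prob_iff[OF P Y Z \<kappa>])
qed


lemma nn_integral_kernel_product:
  assumes \<mu>: "\<mu> \<in> space (prob_algebra N)" and \<kappa>: "\<kappa> \<in> N \<rightarrow>\<^sub>M prob_algebra L"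
    and f[measurable]: "f \<in> borel_measurable (N \<Otimes>\<^sub>M L)"
  shows "(\<integral>\<^sup>+z. f z \<partial>kernel_product N L \<mu> \<kappa>) = (\<integral>\<^sup>+y. (\<integral>\<^sup>+z. f (y, z) \<partial>\<kappa> y) \<partial>\<mu>)"
proof -
  have s: "sets \<mu> = sets N" "space \<mu> = space N" using \<mu> sets_eq_imp_space_eq by (auto simp: space_prob_algebra)
  have "(\<integral>\<^sup>+z. f z \<partial>kernel_product N L \<mu> \<kappa>) = (\<integral>\<^sup>+y. (\<integral>\<^sup>+z. f z \<partial>distr (\<kappa> y) (N \<Otimes>\<^sub>M L) (Pair y)) \<partial>\<mu>)"
    unfolding kernel_product_def
    by (rule nn_integral_bind[OF f]) (use measurable_prob_algebraD[OF kernel_product_kernel[OF \<kappa>]] in \<open>simp add: measurable_cong_sets[OF s(1) refl]\<close>)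
  also have "\<dots> = (\<integral>\<^sup>+y. (\<integral>\<^sup>+z. f (y, z) \<partial>\<kappa> y) \<partial>\<mu>)"
  proof (rule nn_integral_cong)
    fix y assume "y \<in> space \<mu>"
    then have y: "y \<in> space N" by (simp add: s)
    have sk: "sets (\<kappa> y) = sets L" using measurable_space[OF \<kappa> y] by (auto simp: space_prob_algebra)
    have "Pair y \<in> \<kappa> y \<rightarrow>\<^sub>M N \<Otimes>\<^sub>M L" using y by (auto simp: measurable_cong_sets[OF sk refl])
    then show "(\<integral>\<^sup>+z. f z \<partial>distr (\<kappa> y) (N \<Otimes>\<^sub>M L) (Pair y)) = (\<integral>\<^sup>+z. f (y, z) \<partial>\<kappa> y)"
      by (subst nn_integral_distr) auto
  qed
  finally show ?thesis .
qed

locale controlled_process = control_model M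
  for M :: "('x, 'a::polish_space) mdp" +
  fixes \<eta> :: "'x measure" and \<pi> :: "nat \<Rightarrow> (nat \<Rightarrow> 'x \<times> 'a) \<times> 'x \<Rightarrow> 'a measure"
  assumes \<eta>: "\<eta> \<in> space (prob_algebra (states M))" and \<pi>: "\<pi> \<in> policies M"
begin

abbreviation "X \<equiv> states M"
abbreviation "A \<equiv> action_space M"
abbreviation "S \<equiv> state_action M"
abbreviation "PS (n::nat) \<equiv> (\<Pi>\<^sub>M i\<in>{0..<n}. S)"
abbreviation "H n \<equiv> history_space M n"

lemma \<pi>m[measurable]: "\<pi> n \<in> H n \<rightarrow>\<^sub>M prob_algebra A"
  using \<pi> by (auto simp: policies_def)

lemma Qm[measurable]: "transition M \<in> S \<rightarrow>\<^sub>M prob_algebra X"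
  by (rule transition_kernel)

lemma fstS[measurable]: "fst \<in> S \<rightarrow>\<^sub>M X" "snd \<in> S \<rightarrow>\<^sub>M A" by (auto simp: state_action_def)

lemma Qm'[measurable]: "(\<lambda>h. transition M (h n)) \<in> PS (Suc n) \<rightarrow>\<^sub>M prob_algebra X"
  by (rule measurable_compose[OF _ Qm]) auto

lemma coordinate_m[measurable]: "(\<lambda>\<omega>. \<omega> n) \<in> path_space M \<rightarrow>\<^sub>M S"
  by (auto simp: path_space_def)

lemma past_m[measurable]: "past n \<in> path_space M \<rightarrow>\<^sub>M PS n"
  unfolding past_def[abs_def] path_space_def by (rule measurable_restrict_subset) auto

lemma history_m[measurable]: "history n \<in> path_space M \<rightarrow>\<^sub>M H n"
  unfolding history_def[abs_def] history_space_def by measurable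

lemma H_alt: "H n = PS n \<Otimes>\<^sub>M X" by (simp add: history_space_def)

lemma is_path_measure_iff:
  "is_path_measure M \<eta> \<pi> P \<longleftrightarrow> prob_space P \<and> sets P = sets (path_space M) \<and> 
    distr P X (\<lambda>\<omega>. fst (\<omega> 0)) = \<eta> \<and>
   (\<forall>n. distr P (H n \<Otimes>\<^sub>M A) (\<lambda>\<omega>. (history n \<omega>, snd (\<omega> n))) = kernel_product (H n) A (distr P (H n) (history n)) (\<pi> n)) \<and>
   (\<forall>n. distr P (H (Suc n)) (history (Suc n)) = kernel_product (PS (Suc n)) X (distr P (PS (Suc n)) (past (Suc n))) (\<lambda>h. transition M (h n)))"
proof (cases "prob_space P \<and> sets P = sets (path_space M)")
  case True
  then have P: "prob_space P" and [measurable_cong]: "sets P = sets (path_space M)" by auto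
  have 1: "history n \<in> P \<rightarrow>\<^sub>M H n" "(\<lambda>\<omega>. snd (\<omega> n)) \<in> P \<rightarrow>\<^sub>M A" "past (Suc n) \<in> P \<rightarrow>\<^sub>M PS (Suc n)" "(\<lambda>\<omega>. fst (\<omega> (Suc n))) \<in> P \<rightarrow>\<^sub>M X" for n
    by measurable
  have p: "past (Suc n) \<omega> n = \<omega> n" for n and \<omega> :: "nat \<Rightarrow> 'x \<times> 'a" by (simp add: past_def)
  have h: "history (Suc n) = (\<lambda>\<omega>. (past (Suc n) \<omega>, fst (\<omega> (Suc n))))" for n :: nat
    by (simp add: history_def[abs_def])
  show ?thesis
    unfolding is_path_measure_def
    using True cond_law_iff[OF P 1(1) 1(2) \<pi>m] cond_law_iff[OF P 1(3) 1(4) Qm'] 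
    by (simp add: p h H_alt)
qed (auto simp: is_path_measure_def)

lemma path_unique:
  assumes P: "is_path_measure M \<eta> \<pi> P" and P': "is_path_measure M \<eta> \<pi> P'"
  shows "P = P'"
proof -
  note a = P[unfolded is_path_measure_iff] and b = P'[unfolded is_path_measure_iff]
  have [measurable_cong]: "sets P = sets (path_space M)" "sets P' = sets (path_space M)" using a b by auto
  interpret P: prob_space P using a by auto
  have past_Suc: "past (Suc n) = (\<lambda>\<omega>. (\<lambda>z. (fst (fst z))(n := (snd (fst z), snd z))) (history n \<omega>, snd (\<omega> n)))"
    for n :: nat
    by (rule ext) (auto simp: past_def history_def)
  have up_m: "(\<lambda>z. (fst (fst z))(n := (snd (fst z), snd z))) \<in> H n \<Otimes>\<^sub>M A \<rightarrow>\<^sub>M PS (Suc n)" for n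
    unfolding H_alt by (rule measurable_fun_upd[where J="{0..<n}"]) (auto simp: state_action_def)
  have pS: "distr P (PS (Suc n)) (past (Suc n)) = distr P' (PS (Suc n)) (past (Suc n))"
    if "distr P (H n) (history n) = distr P' (H n) (history n)" for n
  proof -
    have e: "distr R (PS (Suc n)) (past (Suc n)) = distr (distr R (H n \<Otimes>\<^sub>M A) (\<lambda>\<omega>. (history n \<omega>, snd (\<omega> n)))) (PS (Suc n)) (\<lambda>z. (fst (fst z))(n := (snd (fst z), snd z)))"
      if [measurable_cong]: "sets R = sets (path_space M)" for R
      by (subst distr_distr[OF up_m]) (measurable, simp add: comp_def past_Suc)
    show ?thesis using e[of P] e[of P'] a b that by simp
  qed
  have hist: "distr P (H n) (history n) = distr P' (H n) (history n)" for n
  proof (induction n)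
    case 0
    have e: "distr R (H 0) (history 0) = distr (distr R X (\<lambda>\<omega>. fst (\<omega> 0))) (H 0) (\<lambda>x. (\<lambda>_. undefined, x))"
      if [measurable_cong]: "sets R = sets (path_space M)" for R
    proof -
      have m: "(\<lambda>x. (\<lambda>_. undefined, x)) \<in> X \<rightarrow>\<^sub>M H 0"
        unfolding H_alt by (rule measurable_Pair) (simp_all add: space_PiM)
      have f: "history 0 = (\<lambda>\<omega>. (\<lambda>_. undefined, fst (\<omega> 0 :: 'x \<times> 'a)))"
        by (rule ext) (simp add: history_def past_def restrict_def)
      show ?thesis
        by (subst distr_distr[OF m]) (measurable, simp add: comp_def f)
    qed
    show ?case using e[of P] e[of P'] a b by simp
  next
    case (Suc n)
    then show ?case using pS[OF Suc] a b by simp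
  qed
  have past: "distr P (PS n) (past n) = distr P' (PS n) (past n)" for n
  proof -
    have fH: "fst \<in> H n \<rightarrow>\<^sub>M PS n" by (simp add: H_alt)
    have e: "distr R (PS n) (past n) = distr (distr R (H n) (history n)) (PS n) fst"
      if [measurable_cong]: "sets R = sets (path_space M)" for R
      by (subst distr_distr[OF fH]) (measurable, simp add: comp_def history_def)
    show ?thesis using e[of P] e[of P'] a b hist[of n] by simp
  qed
  show ?thesis
  proof (rule measure_eqI_PiM_infinite[where I=UNIV and M="\<lambda>_. S"])
    show "sets P = sets (Pi\<^sub>M UNIV (\<lambda>_. S))" "sets P' = sets (Pi\<^sub>M UNIV (\<lambda>_. S))" using a b by (auto simp: path_space_def)
    show "finite_measure P" by unfold_locales
  next
    fix F :: "nat \<Rightarrow> ('x \<times> 'a) set" and J :: "nat set"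
    assume J: "finite J" and F: "\<And>i. i \<in> J \<Longrightarrow> F i \<in> sets S"
    then obtain n where n: "J \<subseteq> {0..<n}" using finite_nat_set_iff_bounded[of J] by (metis atLeast0LessThan lessThan_iff subsetI)
    have nn: "i < n" if "i \<in> J" for i using n that by auto
    let ?B = "prod_emb {0..<n} (\<lambda>_. S) J (Pi\<^sub>E J F)"
    have Bm[measurable]: "?B \<in> sets (PS n)" using n J F by auto
    have e: "prod_emb UNIV (\<lambda>_. S) J (Pi\<^sub>E J F) = past n -` ?B \<inter> space (path_space M)"
      using nn measurable_space[OF past_m] by (auto simp: prod_emb_def path_space_def space_PiM past_def PiE_iff extensional_def Pi_iff) 
    have "emeasure R (prod_emb UNIV (\<lambda>_. S) J (Pi\<^sub>E J F)) = emeasure (distr R (PS n) (past n)) ?B"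
      if [measurable_cong]: "sets R = sets (path_space M)" for R
      using sets_eq_imp_space_eq[OF that] by (simp add: emeasure_distr e)
    then show "emeasure P (prod_emb UNIV (\<lambda>_. S) J (Pi\<^sub>E J F)) = emeasure P' (prod_emb UNIV (\<lambda>_. S) J (Pi\<^sub>E J F))"
      using past[of n] a b by simp
  qed
qed

definition "k0 (n::nat) h = (if n = 0 then \<eta> else transition M (h (n - 1)))"

lemma k0_m[measurable]: "k0 n \<in> PS n \<rightarrow>\<^sub>M prob_algebra X"
proof (cases n)
  case 0
  then show ?thesis using \<eta> by (simp add: k0_def[abs_def])
next
  case (Suc m)
  then show ?thesis using Qm'[of m] by (simp add: k0_def[abs_def])
qed

definition "rho n h = kernel_product X A (k0 n h) (\<lambda>x. \<pi> n (h, x))"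

lemma rho_m: "rho n \<in> PS n \<rightarrow>\<^sub>M prob_algebra S"
proof -
  have [measurable]: "\<pi> n \<in> PS n \<Otimes>\<^sub>M X \<rightarrow>\<^sub>M prob_algebra A" using \<pi>m[of n] by (simp add: H_alt)
  have "(\<lambda>(h, x). distr (\<pi> n (h, x)) (X \<Otimes>\<^sub>M A) (Pair x)) \<in> PS n \<Otimes>\<^sub>M X \<rightarrow>\<^sub>M prob_algebra (X \<Otimes>\<^sub>M A)"
    unfolding split_beta' 
    by (rule measurable_distr_prob_space2[where M = A]) measurable
  from measurable_bind_prob_space2[OF k0_m this] show ?thesis
    unfolding rho_def[abs_def] kernel_product_def by (simp add: state_action_def)
qed

lemma path_exists: "\<exists>P. is_path_measure M \<eta> \<pi> P"
proof -
  interpret IT: Ionescu_Tulcea rho "\<lambda>_. S"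
    by (rule Ionescu_Tulcea.intro)
      (use measurable_space[OF rho_m] in \<open>simp_all only: measurable_prob_algebraD[OF rho_m] space_prob_algebra mem_Collect_eq\<close>)
  let ?L = "IT.PF.lim"
  have sL[measurable_cong]: "sets ?L = sets (path_space M)" by (simp add: path_space_def)
  let ?D = "\<lambda>n. IT.C 0 n (\<lambda>_. undefined)"
  have u0: "(\<lambda>_. undefined) \<in> space (PS 0)" by (simp add: space_PiM)
  have D: "distr ?L (PS n) (past n) = ?D n" for n
  proof -
    have "IT.up_to {0..<n} = n"
      using IT.up_to_iff[of "{0..<n}" n] IT.up_to_less[of "{0..<n}" "n - 1"] by (cases n) auto
    then show ?thesis
      using IT.distr_lim[of "{0..<n}"] IT.distr_C[of n n "\<lambda>_. undefined" 0] u0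
      by (simp add: IT.CI_def past_def[abs_def])
  qed
  have Dp: "?D n \<in> space (prob_algebra (PS n))" for n
    using IT.sets_C[OF u0, of n] IT.prob_space_C[OF u0, of n] by (simp add: space_prob_algebra)
  have PL: "prob_space ?L"
  proof (rule prob_space_distrD)
    show "past 0 \<in> ?L \<rightarrow>\<^sub>M PS 0" by measurable
    show "prob_space (distr ?L (PS 0) (past 0))" 
      using Dp[of 0] unfolding D[symmetric] space_prob_algebra by simp
  qed
  interpret PL: prob_space ?L by fact
  have pih: "\<pi> n (h, x) \<in> space (prob_algebra A)" if "h \<in> space (PS n)" "x \<in> space X" for n h x
    using measurable_space[OF \<pi>m, of "(h, x)" n] that by (simp add: H_alt space_pair_measure)
  have int: "(\<integral>\<^sup>+\<omega>. f (past (Suc n) \<omega>) \<partial>?L) = (\<integral>\<^sup>+h. \<integral>\<^sup>+x. \<integral>\<^sup>+a. f (h(n := (x, a))) \<partial>\<pi> n (h, x) \<partial>k0 n h \<partial>?D n)"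
    if f[measurable]: "f \<in> borel_measurable (PS (Suc n))" for f n
  proof -
    have "(\<integral>\<^sup>+\<omega>. f (past (Suc n) \<omega>) \<partial>?L) = (\<integral>\<^sup>+h. f h \<partial>?D (Suc n))"
      unfolding D[symmetric] by (subst nn_integral_distr) measurable
    also have "\<dots> = (\<integral>\<^sup>+h. \<integral>\<^sup>+g. f g \<partial>IT.eP n h \<partial>?D n)"
    proof -
      have "IT.eP n \<in> ?D n \<rightarrow>\<^sub>M subprob_algebra (PS (Suc n))"
        by (subst measurable_cong_sets[OF IT.sets_C[OF u0, of n] refl]) (use IT.measurable_eP[of n] in \<open>simp only: add_0\<close>)
      from nn_integral_bind[OF f this] show ?thesis by simp
    qed
    also have "\<dots> = (\<integral>\<^sup>+h. \<integral>\<^sup>+x. \<integral>\<^sup>+a. f (h(n := (x, a))) \<partial>\<pi> n (h, x) \<partial>k0 n h \<partial>?D n)"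
    proof (rule nn_integral_cong)
      fix h assume "h \<in> space (?D n)"
      then have h: "h \<in> space (PS n)" using IT.space_C[OF u0, of n] by simp
      have km: "(\<lambda>x. \<pi> n (h, x)) \<in> X \<rightarrow>\<^sub>M prob_algebra A"
        by (rule measurable_compose[OF _ \<pi>m]) (use h in \<open>simp add: H_alt\<close>)
      have up: "(\<lambda>z. h(n := z)) \<in> X \<Otimes>\<^sub>M A \<rightarrow>\<^sub>M PS (Suc n)"
        by (rule measurable_fun_upd[where J="{0..<n}"]) (use h in \<open>auto simp: state_action_def\<close>)
      have "(\<integral>\<^sup>+g. f g \<partial>IT.eP n h) = (\<integral>\<^sup>+z. f (h(n := z)) \<partial>rho n h)"
        by (rule IT.nn_integral_eP[OF h f])
      also have "\<dots> = (\<integral>\<^sup>+x. \<integral>\<^sup>+a. f (h(n := (x, a))) \<partial>\<pi> n (h, x) \<partial>k0 n h)"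
        unfolding rho_def
        by (rule nn_integral_kernel_product[OF measurable_space[OF k0_m h] km measurable_compose[OF up f]])
      finally show "(\<integral>\<^sup>+g. f g \<partial>IT.eP n h) = (\<integral>\<^sup>+x. \<integral>\<^sup>+a. f (h(n := (x, a))) \<partial>\<pi> n (h, x) \<partial>k0 n h)" .
    qed
    finally show ?thesis .
  qed
  have res: "restrict (h(n := z)) {0..<n} = h" if "h \<in> space (?D n)" for h n z
    using that IT.space_C[OF u0, of n] by (auto simp: space_PiM PiE_iff extensional_def restrict_def fun_eq_iff)
  have pastres: "past n \<omega> = restrict (past (Suc n) \<omega>) {0..<n}" "\<omega> n = past (Suc n) \<omega> n" for n and \<omega> :: "nat \<Rightarrow> 'x \<times> 'a"
    by (auto simp: past_def fun_eq_iff restrict_def)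
  have resm[measurable]: "(\<lambda>g. restrict g {0..<n}) \<in> PS (Suc n) \<rightarrow>\<^sub>M PS n" for n
    by (rule measurable_restrict_subset) auto
  have hist: "distr ?L (H n) (history n) = kernel_product (PS n) X (?D n) (k0 n)" for n
  proof (rule measure_eqI)
    have s: "sets (kernel_product (PS n) X (?D n) (k0 n)) = sets (PS n \<Otimes>\<^sub>M X)"
      using kernel_product_space[OF Dp[of n] k0_m] by (simp add: space_prob_algebra)
    show "sets (distr ?L (H n) (history n)) = sets (kernel_product (PS n) X (?D n) (k0 n))"
      by (simp add: s H_alt)
    fix E assume "E \<in> sets (distr ?L (H n) (history n))"
    then have E[measurable]: "E \<in> sets (PS n \<Otimes>\<^sub>M X)" by (simp add: H_alt)
    have EH[measurable]: "E \<in> sets (H n)" by (simp add: H_alt)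
    have "emeasure (distr ?L (H n) (history n)) E = (\<integral>\<^sup>+\<omega>. indicator E (history n \<omega>) \<partial>?L)"
      by (subst nn_integral_indicator[symmetric], simp, subst nn_integral_distr) measurable
    also have "\<dots> = (\<integral>\<^sup>+\<omega>. (\<lambda>g. indicator E (restrict g {0..<n}, fst (g n))) (past (Suc n) \<omega>) \<partial>?L)"
      by (simp add: history_def pastres[symmetric])
    also have "\<dots> = (\<integral>\<^sup>+h. \<integral>\<^sup>+x. \<integral>\<^sup>+a. indicator E (restrict (h(n := (x, a))) {0..<n}, fst ((h(n := (x, a))) n)) \<partial>\<pi> n (h, x) \<partial>k0 n h \<partial>?D n)"
      by (rule int) measurable
    also have "\<dots> = (\<integral>\<^sup>+h. \<integral>\<^sup>+x. indicator E (h, x) \<partial>k0 n h \<partial>?D n)"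
    proof (intro nn_integral_cong)
      fix h x assume h: "h \<in> space (?D n)" and x: "x \<in> space (k0 n h)"
      have h': "h \<in> space (PS n)" using IT.space_C[OF u0, of n] h by simp
      have "sets (k0 n h) = sets X" using measurable_space[OF k0_m h'] by (simp add: space_prob_algebra)
      then have "x \<in> space X" using x sets_eq_imp_space_eq by blast
      then have "prob_space (\<pi> n (h, x))" using pih[OF h'] by (simp add: space_prob_algebra)
      then show "(\<integral>\<^sup>+a. indicator E (restrict (h(n := (x, a))) {0..<n}, fst ((h(n := (x, a))) n)) \<partial>\<pi> n (h, x)) = indicator E (h, x)"
        unfolding res[OF h] by (simp add: prob_space.emeasure_space_1)
    qed
    also have "\<dots> = (\<integral>\<^sup>+z. indicator E z \<partial>kernel_product (PS n) X (?D n) (k0 n))"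
      by (rule nn_integral_kernel_product[OF Dp k0_m, symmetric]) measurable
    also have "\<dots> = emeasure (kernel_product (PS n) X (?D n) (k0 n)) E" by (simp add: s)
    finally show "emeasure (distr ?L (H n) (history n)) E = emeasure (kernel_product (PS n) X (?D n) (k0 n)) E" .
  qed
  have act: "distr ?L (H n \<Otimes>\<^sub>M A) (\<lambda>\<omega>. (history n \<omega>, snd (\<omega> n))) = kernel_product (H n) A (distr ?L (H n) (history n)) (\<pi> n)" for n
  proof (rule measure_eqI)
    have Hp: "distr ?L (H n) (history n) \<in> space (prob_algebra (H n))"
      by (auto simp: space_prob_algebra intro!: PL.prob_space_distr)
    have s: "sets (kernel_product (H n) A (distr ?L (H n) (history n)) (\<pi> n)) = sets (H n \<Otimes>\<^sub>M A)"
      using kernel_product_space[OF Hp \<pi>m] by (simp add: space_prob_algebra)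
    show "sets (distr ?L (H n \<Otimes>\<^sub>M A) (\<lambda>\<omega>. (history n \<omega>, snd (\<omega> n)))) = sets (kernel_product (H n) A (distr ?L (H n) (history n)) (\<pi> n))"
      by (simp add: s)
    fix E assume "E \<in> sets (distr ?L (H n \<Otimes>\<^sub>M A) (\<lambda>\<omega>. (history n \<omega>, snd (\<omega> n))))"
    then have E[measurable]: "E \<in> sets (H n \<Otimes>\<^sub>M A)" by simp
    have E'[measurable]: "E \<in> sets ((PS n \<Otimes>\<^sub>M X) \<Otimes>\<^sub>M A)" using E by (simp add: H_alt)
    have F: "(\<lambda>z. \<integral>\<^sup>+a. indicator E (z, a) \<partial>\<pi> n z) \<in> borel_measurable (PS n \<Otimes>\<^sub>M X)"
      unfolding H_alt[symmetric]
      by (rule nn_integral_measurable_subprob_algebra2[OF _ measurable_prob_algebraD[OF \<pi>m]]) measurable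
    have "emeasure (distr ?L (H n \<Otimes>\<^sub>M A) (\<lambda>\<omega>. (history n \<omega>, snd (\<omega> n)))) E = (\<integral>\<^sup>+\<omega>. indicator E (history n \<omega>, snd (\<omega> n)) \<partial>?L)"
      by (subst nn_integral_indicator[symmetric], simp, subst nn_integral_distr) measurable
    also have "\<dots> = (\<integral>\<^sup>+\<omega>. (\<lambda>g. indicator E ((restrict g {0..<n}, fst (g n)), snd (g n))) (past (Suc n) \<omega>) \<partial>?L)"
      by (simp add: history_def pastres[symmetric])
    also have "\<dots> = (\<integral>\<^sup>+h. \<integral>\<^sup>+x. \<integral>\<^sup>+a. indicator E ((restrict (h(n := (x, a))) {0..<n}, fst ((h(n := (x, a))) n)), snd ((h(n := (x, a))) n)) \<partial>\<pi> n (h, x) \<partial>k0 n h \<partial>?D n)"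
      by (rule int) measurable
    also have "\<dots> = (\<integral>\<^sup>+h. \<integral>\<^sup>+x. \<integral>\<^sup>+a. indicator E ((h, x), a) \<partial>\<pi> n (h, x) \<partial>k0 n h \<partial>?D n)"
      by (intro nn_integral_cong) (simp only: res, simp)
    also have "\<dots> = (\<integral>\<^sup>+z. \<integral>\<^sup>+a. indicator E (z, a) \<partial>\<pi> n z \<partial>kernel_product (PS n) X (?D n) (k0 n))"
      by (rule nn_integral_kernel_product[OF Dp k0_m F, symmetric])
    also have "\<dots> = (\<integral>\<^sup>+z. indicator E z \<partial>kernel_product (H n) A (distr ?L (H n) (history n)) (\<pi> n))"
      unfolding hist[symmetric]
      by (rule nn_integral_kernel_product[OF Hp \<pi>m, symmetric]) measurable
    also have "\<dots> = emeasure (kernel_product (H n) A (distr ?L (H n) (history n)) (\<pi> n)) E" by (simp add: s)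
    finally show "emeasure (distr ?L (H n \<Otimes>\<^sub>M A) (\<lambda>\<omega>. (history n \<omega>, snd (\<omega> n)))) E
      = emeasure (kernel_product (H n) A (distr ?L (H n) (history n)) (\<pi> n)) E" .
  qed
  have init: "distr ?L X (\<lambda>\<omega>. fst (\<omega> 0)) = \<eta>"
  proof (rule measure_eqI)
    have se: "sets \<eta> = sets X" using \<eta> by (simp add: space_prob_algebra)
    show "sets (distr ?L X (\<lambda>\<omega>. fst (\<omega> 0))) = sets \<eta>" by (simp add: se)
    fix B assume "B \<in> sets (distr ?L X (\<lambda>\<omega>. fst (\<omega> 0)))"
    then have B[measurable]: "B \<in> sets X" by simp
    have "emeasure (distr ?L X (\<lambda>\<omega>. fst (\<omega> 0))) B = (\<integral>\<^sup>+\<omega>. (indicator B (snd (history 0 \<omega>)) :: ennreal) \<partial>?L)"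
      by (subst nn_integral_indicator[symmetric], simp, subst nn_integral_distr) (measurable, simp add: history_def)
    also have "\<dots> = (\<integral>\<^sup>+z. indicator B (snd z) \<partial>distr ?L (H 0) (history 0))"
    proof -
      have "(\<lambda>z. indicator B (snd z) :: ennreal) \<in> borel_measurable (PS 0 \<Otimes>\<^sub>M X)"
        by measurable
      then have "(\<lambda>z. indicator B (snd z) :: ennreal) \<in> borel_measurable (distr ?L (H 0) (history 0))"
        by (simp only: measurable_distr_eq1 H_alt)
      from nn_integral_distr[OF _ this] show ?thesis by simp
    qed
    also have "\<dots> = (\<integral>\<^sup>+h. \<integral>\<^sup>+x. indicator B (snd (h, x)) \<partial>k0 0 h \<partial>?D 0)"
      unfolding hist by (rule nn_integral_kernel_product[OF Dp k0_m]) measurable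
    also have "\<dots> = emeasure \<eta> B"
      using Dp[of 0] by (simp add: k0_def se space_prob_algebra prob_space.emeasure_space_1)
    finally show "emeasure (distr ?L X (\<lambda>\<omega>. fst (\<omega> 0))) B = emeasure \<eta> B" .
  qed
  have k0S: "k0 (Suc n) = (\<lambda>h. transition M (h n))" for n by (auto simp: k0_def)
  have "is_path_measure M \<eta> \<pi> ?L"
    unfolding is_path_measure_iff
    using PL sL init act hist[of "Suc _"] by (simp add: D k0S)
  then show ?thesis by blast
qed

theorem path_measure_ex1: "\<exists>!P. is_path_measure M \<eta> \<pi> P"
  using path_exists path_unique by blast

lemma is_path_measure_path_measure: "is_path_measure M \<eta> \<pi> (path_measure M \<eta> \<pi>)"
  unfolding path_measure_def by (rule theI'[OF path_measure_ex1])

lemma less_hitting_time_iff: "hitting_time M \<omega> > enat t \<longleftrightarrow> (\<forall>n\<le>t. fst (\<omega> n) \<notin> target M)"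
proof
  assume t: "hitting_time M \<omega> > enat t"
  show "\<forall>n\<le>t. fst (\<omega> n) \<notin> target M"
  proof (intro allI impI notI)
    fix n assume "n \<le> t" "fst (\<omega> n) \<in> target M"
    then have "hitting_time M \<omega> \<le> enat n" by (auto simp: hitting_time_def intro: INF_lower)
    with t \<open>n \<le> t\<close> show False by (meson enat_ord_simps(1) leD order.trans)
  qed
next
  assume a: "\<forall>n\<le>t. fst (\<omega> n) \<notin> target M"
  have "enat (Suc t) \<le> hitting_time M \<omega>"
    unfolding hitting_time_def using a by (intro INF_greatest) (auto simp: not_le[symmetric] Suc_le_eq)
  then show "hitting_time M \<omega> > enat t" by (simp add: Suc_ile_eq)
qed

lemma emeasure_occupation_measure:
  assumes \<Gamma>: "\<Gamma> \<in> sets S"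
  shows "emeasure (occupation_measure M \<eta> \<pi>) \<Gamma> =
    (\<integral>\<^sup>+\<omega>. (\<Sum>t. indicator {\<omega>. hitting_time M \<omega> > enat t} \<omega> * indicator {\<omega>. \<omega> t \<in> \<Gamma>} \<omega>)
       \<partial>path_measure M \<eta> \<pi>)"
  unfolding occupation_measure_def
proof (rule emeasure_measure_of_sigma)
  let ?P = "path_measure M \<eta> \<pi>"
  let ?f = "\<lambda>\<Gamma> t \<omega>. indicator {\<omega>. hitting_time M \<omega> > enat t} \<omega> * indicator {\<omega>. \<omega> t \<in> \<Gamma>} \<omega> :: ennreal"
  have [measurable_cong]: "sets ?P = sets (path_space M)"
    using is_path_measure_path_measure by (simp add: is_path_measure_def)
  have [measurable]: "target M \<in> sets X" by (rule target_sets)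
  have T: "(\<lambda>\<omega>. indicator {\<omega>. hitting_time M \<omega> > enat t} \<omega> :: ennreal) \<in> borel_measurable ?P" for t
    unfolding less_hitting_time_iff indicator_def mem_Collect_eq by measurable
  have m: "?f B t \<in> borel_measurable ?P" if [measurable]: "B \<in> sets S" for B t
  proof (rule borel_measurable_times_ennreal[OF T])
    show "(\<lambda>\<omega>. indicator {\<omega>. \<omega> t \<in> B} \<omega> :: ennreal) \<in> borel_measurable ?P"
      unfolding indicator_def mem_Collect_eq by measurable
  qed
  show "sigma_algebra (space S) (sets S)" by (rule sets.sigma_algebra_axioms)
  show "positive (sets S) (\<lambda>\<Gamma>. \<integral>\<^sup>+\<omega>. (\<Sum>t. ?f \<Gamma> t \<omega>) \<partial>?P)" by (simp add: positive_def)
  show "countably_additive (sets S) (\<lambda>\<Gamma>. \<integral>\<^sup>+\<omega>. (\<Sum>t. ?f \<Gamma> t \<omega>) \<partial>?P)"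
  proof (rule countably_additiveI)
    fix B :: "nat \<Rightarrow> ('x \<times> 'a) set"
    assume B: "range B \<subseteq> sets S" "disjoint_family B"
    then have Bi: "B i \<in> sets S" for i by auto
    then have UB: "(\<Union>i. B i) \<in> sets S" by auto
    have f: "?f (\<Union>i. B i) t \<omega> = (\<Sum>i. ?f (B i) t \<omega>)" for t \<omega>
    proof -
      have "(\<Sum>i. indicator (B i) (\<omega> t) :: ennreal) = indicator (\<Union>i. B i) (\<omega> t)"
        by (rule suminf_indicator[OF B(2)])
      then show ?thesis by (simp add: indicator_def[abs_def])
    qed
    have i: "(\<integral>\<^sup>+\<omega>. (\<Sum>t. ?f C t \<omega>) \<partial>?P) = (\<Sum>t. \<integral>\<^sup>+\<omega>. ?f C t \<omega> \<partial>?P)" if "C \<in> sets S" for C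
      by (rule nn_integral_suminf[OF m[OF that]])
    have "(\<Sum>i. \<integral>\<^sup>+\<omega>. (\<Sum>t. ?f (B i) t \<omega>) \<partial>?P) = (\<Sum>i. \<Sum>t. \<integral>\<^sup>+\<omega>. ?f (B i) t \<omega> \<partial>?P)"
      by (simp only: i[OF Bi])
    also have "\<dots> = (\<Sum>t. \<Sum>i. \<integral>\<^sup>+\<omega>. ?f (B i) t \<omega> \<partial>?P)"
      using nn_integral_suminf[of "\<lambda>t i. \<integral>\<^sup>+\<omega>. ?f (B i) t \<omega> \<partial>?P" "count_space UNIV"]
      by (simp add: nn_integral_count_space_nat)
    also have "\<dots> = (\<Sum>t. \<integral>\<^sup>+\<omega>. ?f (\<Union>i. B i) t \<omega> \<partial>?P)"
      by (simp only: f nn_integral_suminf[OF m[OF Bi]])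
    also have "\<dots> = (\<integral>\<^sup>+\<omega>. (\<Sum>t. ?f (\<Union>i. B i) t \<omega>) \<partial>?P)"
      by (rule i[OF UB, symmetric])
    finally show "(\<Sum>i. \<integral>\<^sup>+\<omega>. (\<Sum>t. ?f (B i) t \<omega>) \<partial>?P) = (\<integral>\<^sup>+\<omega>. (\<Sum>t. ?f (\<Union>i. B i) t \<omega>) \<partial>?P)" .
  qed
qed fact

end

end

theory Submission
  imports Defs
begin

text \<open>
  Write \<open>Q'\<close> for the transition kernel killed at the target. Since the action space is Borel, every
  solution \<open>\<mu>\<close> of the characteristic equations disintegrates as \<open>\<mu>\<^sup>X \<otimes> \<sigma>\<close>, and \<open>\<sigma>\<close> can be chosen
  admissible because \<open>\<mu>\<close> lives on the constraint set (\<open>admissible_disintegration\<close>). Once \<open>\<sigma>\<close> is fixed,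
  the characteristic equation is the affine equation \<open>\<nu> = \<eta>' + \<nu> q\<close> for the state marginal, where
  \<open>\<eta>'\<close> is \<open>\<eta>\<close> off the target and \<open>q\<close> is \<open>Q'\<close> averaged over \<open>\<sigma>\<close>. Its least solution is the Neumann
  series \<open>\<Sum>\<^sub>t \<eta>' q\<^sup>t\<close>, which is the state marginal of the occupation measure of \<open>\<sigma>\<close>
  (\<open>occupation_minimal\<close>). The difference of the two solutions is therefore a measure, it solves the
  homogeneous equation \<open>\<nu> = \<nu> q\<close>, and so it is the state marginal of an invariant measure. This is the
  decomposition (\<open>characteristic_decomposition\<close>); the converse is linearity of the equations.

  If only the null measure is invariant, the decomposition turns every solution into an
  occupation measure, and conversely occupation measures always solve the equations. If the solution
  set is bounded, there is no nonzero invariant measure, since arbitrary multiples of it could be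
  added to a solution. What remains is that the occupation measures are uniformly bounded
  (\<open>occupation_measures_bounded\<close>), although the absorption times are only assumed to be integrable
  policy by policy. Suppose \<open>\<pi>\<^sub>k\<close> has expected absorption time above \<open>2\<^sup>k\<close>, and mix the laws
  of \<open>(X\<^sub>t, A\<^sub>t)\<close> before absorption with the weights \<open>2\<^sup>-\<^sup>k\<^sup>-\<^sup>1\<close>. The recursion that links the law at time
  \<open>t\<close> with the state marginal at time \<open>t + 1\<close> is linear and does not involve the policy, so the mixtures satisfy it.
  Disintegrating the mixture at each time gives a Markov policy with exactly these laws, and its
  expected absorption time is infinite.

  The disintegration theorem itself is obtained by coding points of a Polish space by reals in the
  unit interval and building the conditional distribution functions from Radon-Nikodym densities.
\<close>

section \<open>Sums of measures and kernel products\<close>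

lemma nn_integral_measure_add:
  assumes s[measurable_cong]: "sets \<mu> = sets \<nu>" and "f \<in> borel_measurable \<nu>"
  shows "(\<integral>\<^sup>+x. f x \<partial>measure_add \<mu> \<nu>) = (\<integral>\<^sup>+x. f x \<partial>\<mu>) + (\<integral>\<^sup>+x. f x \<partial>\<nu>)"
  using assms(2)
proof (induction rule: borel_measurable_induct)
  case (cong f g)
  have "integral\<^sup>N N f = integral\<^sup>N N g" if "sets N = sets \<nu>" for N
    using cong.hyps(3) sets_eq_imp_space_eq[OF that] by (intro nn_integral_cong) simp
  then show ?case using cong.IH s by simp
next
  case (set A)
  then show ?case using emeasure_measure_add[OF s, of A] s by simp
next
  case (mult u c)
  have "integral\<^sup>N N (\<lambda>x. c * u x) = c * integral\<^sup>N N u" if "sets N = sets \<nu>" for N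
    using mult.hyps(2) by (intro nn_integral_cmult) (simp only: measurable_cong_sets[OF that refl])
  then show ?case using mult.IH s by (simp add: distrib_left)
next
  case (add u v)
  have "(\<integral>\<^sup>+x. v x + u x \<partial>N) = integral\<^sup>N N v + integral\<^sup>N N u" if "sets N = sets \<nu>" for N
    using add.hyps(1,3) by (intro nn_integral_add) (simp_all only: measurable_cong_sets[OF that refl])
  then show ?case using add.IH s by (simp add: ac_simps)
next
  case (seq U)
  have [measurable]: "U i \<in> borel_measurable \<mu>" "U i \<in> borel_measurable (measure_add \<mu> \<nu>)" for i
    using seq.hyps(1) by (simp_all add: measurable_cong_sets[OF s refl] measurable_cong_sets[OF sets_measure_add refl])
  have m: "incseq (\<lambda>i. integral\<^sup>N N (U i))" for N
    using seq.hyps(3) by (auto simp: incseq_def le_fun_def intro!: nn_integral_mono)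
  have sup: "(\<integral>\<^sup>+x. (SUP i. U i) x \<partial>N) = (SUP i. integral\<^sup>N N (U i))"
    if "\<And>i. U i \<in> borel_measurable N" for N
    unfolding SUP_apply using seq.hyps(3) that by (rule nn_integral_monotone_convergence_SUP)
  have "(\<integral>\<^sup>+x. (SUP i. U i) x \<partial>measure_add \<mu> \<nu>) = (SUP i. integral\<^sup>N (measure_add \<mu> \<nu>) (U i))"
    by (rule sup) measurable
  also have "\<dots> = (SUP i. integral\<^sup>N \<mu> (U i) + integral\<^sup>N \<nu> (U i))"
    by (simp only: seq.IH)
  also have "\<dots> = (SUP i. integral\<^sup>N \<mu> (U i)) + (SUP i. integral\<^sup>N \<nu> (U i))"
    by (rule ennreal_SUP_add[OF m m])
  also have "(SUP i. integral\<^sup>N \<mu> (U i)) = (\<integral>\<^sup>+x. (SUP i. U i) x \<partial>\<mu>)"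
    by (rule sup[symmetric]) measurable
  also have "(SUP i. integral\<^sup>N \<nu> (U i)) = (\<integral>\<^sup>+x. (SUP i. U i) x \<partial>\<nu>)"
    by (rule sup[symmetric]) (rule seq.hyps(1))
  finally show ?case .
qed

lemma sets_kernel_product:
  assumes "sets \<nu> = sets N" "space N \<noteq> {}" "\<kappa> \<in> N \<rightarrow>\<^sub>M prob_algebra L"
  shows "sets (kernel_product N L \<nu> \<kappa>) = sets (N \<Otimes>\<^sub>M L)"
  unfolding kernel_product_def
proof (rule sets_bind_measurable)
  show "(\<lambda>y. distr (\<kappa> y) (N \<Otimes>\<^sub>M L) (Pair y)) \<in> \<nu> \<rightarrow>\<^sub>M subprob_algebra (N \<Otimes>\<^sub>M L)"
    using measurable_prob_algebraD[OF kernel_product_kernel[OF assms(3)]] by (simp add: measurable_cong_sets[OF assms(1) refl])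
qed (use assms sets_eq_imp_space_eq[OF assms(1)] in auto)

text \<open>
  Occupation measures and invariant measures have arbitrary finite mass, so the Fubini formula for
  \<open>\<nu> \<otimes> \<kappa>\<close> is stated for measures \<open>\<nu>\<close> that need not be probabilities.
\<close>

lemma nn_integral_kernel_product_sets:
  assumes \<nu>: "sets \<nu> = sets N" and \<kappa>: "\<kappa> \<in> N \<rightarrow>\<^sub>M prob_algebra L"
    and f[measurable]: "f \<in> borel_measurable (N \<Otimes>\<^sub>M L)"
  shows "(\<integral>\<^sup>+z. f z \<partial>kernel_product N L \<nu> \<kappa>) = (\<integral>\<^sup>+y. (\<integral>\<^sup>+z. f (y, z) \<partial>\<kappa> y) \<partial>\<nu>)"
proof -
  have "(\<integral>\<^sup>+z. f z \<partial>kernel_product N L \<nu> \<kappa>) = (\<integral>\<^sup>+y. (\<integral>\<^sup>+z. f z \<partial>distr (\<kappa> y) (N \<Otimes>\<^sub>M L) (Pair y)) \<partial>\<nu>)"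
    unfolding kernel_product_def
    by (rule nn_integral_bind[OF f]) (use measurable_prob_algebraD[OF kernel_product_kernel[OF \<kappa>]] in \<open>simp add: measurable_cong_sets[OF \<nu> refl]\<close>)
  also have "\<dots> = (\<integral>\<^sup>+y. (\<integral>\<^sup>+z. f (y, z) \<partial>\<kappa> y) \<partial>\<nu>)"
  proof (rule nn_integral_cong)
    fix y assume "y \<in> space \<nu>"
    then have y: "y \<in> space N" using sets_eq_imp_space_eq[OF \<nu>] by simp
    have sk: "sets (\<kappa> y) = sets L" using measurable_space[OF \<kappa> y] by (auto simp: space_prob_algebra)
    have "Pair y \<in> \<kappa> y \<rightarrow>\<^sub>M N \<Otimes>\<^sub>M L" using y by (auto simp: measurable_cong_sets[OF sk refl])
    then show "(\<integral>\<^sup>+z. f z \<partial>distr (\<kappa> y) (N \<Otimes>\<^sub>M L) (Pair y)) = (\<integral>\<^sup>+z. f (y, z) \<partial>\<kappa> y)"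
      by (subst nn_integral_distr) auto
  qed
  finally show ?thesis .
qed

lemma emeasure_kernel_product_sections:
  assumes \<nu>: "sets \<nu> = sets N" and ne: "space N \<noteq> {}" and \<kappa>: "\<kappa> \<in> N \<rightarrow>\<^sub>M prob_algebra L"
    and \<Gamma>: "\<Gamma> \<in> sets (N \<Otimes>\<^sub>M L)"
  shows "emeasure (kernel_product N L \<nu> \<kappa>) \<Gamma> = (\<integral>\<^sup>+x. \<integral>\<^sup>+a. indicator \<Gamma> (x, a) \<partial>\<kappa> x \<partial>\<nu>)"
  using nn_integral_kernel_product_sets[OF \<nu> \<kappa> borel_measurable_indicator[OF \<Gamma>]] \<Gamma>
  by (simp add: sets_kernel_product[OF \<nu> ne \<kappa>])

lemma kernel_product_cong_AE:
  assumes \<nu>: "sets \<nu> = sets N" and ne: "space N \<noteq> {}"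
    and \<kappa>: "\<kappa> \<in> N \<rightarrow>\<^sub>M prob_algebra L" and \<kappa>': "\<kappa>' \<in> N \<rightarrow>\<^sub>M prob_algebra L" and ae: "AE x in \<nu>. \<kappa> x = \<kappa>' x"
  shows "kernel_product N L \<nu> \<kappa> = kernel_product N L \<nu> \<kappa>'"
proof (rule measure_eqI)
  show s: "sets (kernel_product N L \<nu> \<kappa>) = sets (kernel_product N L \<nu> \<kappa>')"
    by (simp add: sets_kernel_product[OF \<nu> ne] \<kappa> \<kappa>')
  fix \<Gamma> assume "\<Gamma> \<in> sets (kernel_product N L \<nu> \<kappa>)"
  then have \<Gamma>: "\<Gamma> \<in> sets (N \<Otimes>\<^sub>M L)" by (simp add: sets_kernel_product[OF \<nu> ne \<kappa>])
  show "emeasure (kernel_product N L \<nu> \<kappa>) \<Gamma> = emeasure (kernel_product N L \<nu> \<kappa>') \<Gamma>"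
    unfolding emeasure_kernel_product_sections[OF \<nu> ne \<kappa> \<Gamma>] emeasure_kernel_product_sections[OF \<nu> ne \<kappa>' \<Gamma>]
    by (rule nn_integral_cong_AE) (use ae in eventually_elim, simp)
qed

lemma kernel_product_measure_add:
  assumes \<nu>1: "sets \<nu>1 = sets N" and \<nu>2: "sets \<nu>2 = sets N" and ne: "space N \<noteq> {}" and \<kappa>: "\<kappa> \<in> N \<rightarrow>\<^sub>M prob_algebra L"
  shows "kernel_product N L (measure_add \<nu>1 \<nu>2) \<kappa> = measure_add (kernel_product N L \<nu>1 \<kappa>) (kernel_product N L \<nu>2 \<kappa>)"
proof (rule measure_eqI)
  have s: "sets (measure_add \<nu>1 \<nu>2) = sets N" by (simp add: \<nu>1)
  note sets_kp = sets_kernel_product[OF s ne \<kappa>] sets_kernel_product[OF \<nu>1 ne \<kappa>] sets_kernel_product[OF \<nu>2 ne \<kappa>]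
  show "sets (kernel_product N L (measure_add \<nu>1 \<nu>2) \<kappa>) = sets (measure_add (kernel_product N L \<nu>1 \<kappa>) (kernel_product N L \<nu>2 \<kappa>))"
    by (simp add: sets_kp)
  fix \<Gamma> assume "\<Gamma> \<in> sets (kernel_product N L (measure_add \<nu>1 \<nu>2) \<kappa>)"
  then have \<Gamma>: "\<Gamma> \<in> sets (N \<Otimes>\<^sub>M L)" by (simp add: sets_kp)
  have m: "(\<lambda>x. \<integral>\<^sup>+a. indicator \<Gamma> (x, a) \<partial>\<kappa> x) \<in> borel_measurable \<nu>2"
    unfolding measurable_cong_sets[OF \<nu>2 refl]
    by (rule nn_integral_measurable_subprob_algebra2[OF _ measurable_prob_algebraD[OF \<kappa>]]) (use \<Gamma> in \<open>simp add: split_beta'\<close>)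
  have "emeasure (kernel_product N L (measure_add \<nu>1 \<nu>2) \<kappa>) \<Gamma>
      = emeasure (kernel_product N L \<nu>1 \<kappa>) \<Gamma> + emeasure (kernel_product N L \<nu>2 \<kappa>) \<Gamma>"
    using nn_integral_measure_add[OF _ m, of \<nu>1] \<nu>1 \<nu>2
    by (simp add: emeasure_kernel_product_sections[OF _ ne \<kappa> \<Gamma>])
  also have "\<dots> = emeasure (measure_add (kernel_product N L \<nu>1 \<kappa>) (kernel_product N L \<nu>2 \<kappa>)) \<Gamma>"
    by (rule emeasure_measure_add[symmetric]) (simp_all add: sets_kp \<Gamma>)
  finally show "emeasure (kernel_product N L (measure_add \<nu>1 \<nu>2) \<kappa>) \<Gamma>
      = emeasure (measure_add (kernel_product N L \<nu>1 \<kappa>) (kernel_product N L \<nu>2 \<kappa>)) \<Gamma>" .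
qed

section \<open>Disintegration over a Borel space\<close>

text \<open>
  Comparing the two integrals over the set where \<open>g < f\<close> shows that this set is null; finiteness of the
  integral of \<open>f\<close> allows the subtraction.
\<close>

lemma AE_le_if_set_integrals_le:
  assumes [measurable]: "f \<in> borel_measurable M" "g \<in> borel_measurable M"
    and fin: "(\<integral>\<^sup>+x. f x \<partial>M) < \<infinity>"
    and le: "\<And>B. B \<in> sets M \<Longrightarrow> (\<integral>\<^sup>+x\<in>B. f x \<partial>M) \<le> (\<integral>\<^sup>+x\<in>B. g x \<partial>M)"
  shows "AE x in M. f x \<le> g x"
proof -
  let ?N = "{x \<in> space M. g x < f x}"
  have [measurable]: "?N \<in> sets M" by measurable
  have fN: "(\<integral>\<^sup>+x\<in>?N. f x \<partial>M) < \<infinity>"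
    by (rule le_less_trans[OF nn_integral_mono fin]) (auto split: split_indicator)
  have gf: "(\<integral>\<^sup>+x\<in>?N. g x \<partial>M) \<le> (\<integral>\<^sup>+x\<in>?N. f x \<partial>M)"
    by (intro nn_integral_mono) (auto split: split_indicator)
  have "(\<integral>\<^sup>+x. f x * indicator ?N x - g x * indicator ?N x \<partial>M)
      = (\<integral>\<^sup>+x\<in>?N. f x \<partial>M) - (\<integral>\<^sup>+x\<in>?N. g x \<partial>M)"
    using gf fN by (intro nn_integral_diff) (auto split: split_indicator)
  also have "\<dots> = 0"
    using le[of ?N] fN by (simp add: diff_eq_0_iff_ennreal)
  finally have "AE x in M. f x * indicator ?N x - g x * indicator ?N x = 0"
    by (subst (asm) nn_integral_0_iff_AE) auto
  moreover have "AE x in M. f x \<noteq> \<infinity>"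
    using fin by (intro nn_integral_noteq_infinite) auto
  ultimately show ?thesis
    using AE_space[of M]
  proof eventually_elim
    case (elim x)
    then show ?case by (cases "g x < f x") (auto simp: diff_eq_0_iff_ennreal)
  qed
qed


lemma interval_distribution_kernel:
  fixes F :: "'x \<Rightarrow> real \<Rightarrow> real"
  assumes mono: "\<And>x r s. x \<in> space X \<Longrightarrow> r \<le> s \<Longrightarrow> F x r \<le> F x s"
    and cont: "\<And>x r. x \<in> space X \<Longrightarrow> continuous (at_right r) (F x)"
    and bot: "\<And>x. x \<in> space X \<Longrightarrow> (F x \<longlongrightarrow> 0) at_bot" and top: "\<And>x. x \<in> space X \<Longrightarrow> (F x \<longlongrightarrow> 1) at_top"
    and meas[measurable]: "\<And>r. (\<lambda>x. F x r) \<in> borel_measurable X"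
  shows "(\<lambda>x. interval_measure (F x)) \<in> X \<rightarrow>\<^sub>M prob_algebra borel"
proof (rule measurable_prob_algebra_generated[where \<Omega>=UNIV and G="range atMost"])
  show "sets borel = sigma_sets UNIV (range (atMost :: real \<Rightarrow> real set))"
    by (simp add: borel_eq_atMost)
  show "Int_stable (range (atMost :: real \<Rightarrow> real set))"
    by (auto simp: Int_stable_def)
next
  fix x assume x: "x \<in> space X"
  interpret real_distribution "interval_measure (F x)"
    using mono[OF x] cont[OF x] bot[OF x] top[OF x] by (rule real_distribution_interval_measure)
  show "prob_space (interval_measure (F x))" by unfold_locales
next
  fix B :: "real set" assume "B \<in> range atMost"
  then obtain r where B: "B = {..r}" by auto
  have "emeasure (interval_measure (F x)) B = ennreal (F x r)" if x: "x \<in> space X" for x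
    unfolding B using mono[OF x] cont[OF x] bot[OF x] by (rule emeasure_interval_measure_Iic)
  then show "(\<lambda>x. emeasure (interval_measure (F x)) B) \<in> borel_measurable X"
    by (simp cong: measurable_cong)
qed simp_all

text \<open>
  The density \<open>f\<^sub>r\<close> of \<open>B \<mapsto> \<mu> (B \<times> {..r})\<close> with respect to the marginal is a candidate for the conditional
  distribution function at \<open>r\<close>, but monotonicity and right continuity hold only almost everywhere. Taking the
  infimum of \<open>min 1 f\<^sub>q\<close> over the rationals \<open>q > r\<close> repairs this at every point: such an infimum is
  monotone and right continuous in \<open>r\<close> whatever the functions \<open>f\<^sub>q\<close> are. Support in the unit interval makes it
  possible to prescribe the values \<open>0\<close> and \<open>1\<close> outside, so that the limits at infinity are right, too, and
  every \<open>x\<close> yields a distribution function.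
\<close>

lemma disintegration_unit_interval:
  fixes \<mu> :: "('x \<times> real) measure"
  assumes sets_\<mu>[measurable_cong]: "sets \<mu> = sets (X \<Otimes>\<^sub>M borel)" and fin: "finite_measure \<mu>"
    and unit: "AE z in \<mu>. snd z \<in> {0..1}"
  shows "\<exists>\<tau> \<in> X \<rightarrow>\<^sub>M prob_algebra borel. \<forall>B \<in> sets X. \<forall>\<Lambda> \<in> sets borel.
    emeasure \<mu> (B \<times> \<Lambda>) = (\<integral>\<^sup>+x\<in>B. emeasure (\<tau> x) \<Lambda> \<partial>distr \<mu> X fst)"
proof -
  interpret \<mu>: finite_measure \<mu> by fact
  have sp: "space \<mu> = space X \<times> UNIV"
    using sets_eq_imp_space_eq[OF sets_\<mu>] by (simp add: space_pair_measure)
  define \<nu> where "\<nu> = distr \<mu> X fst"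
  have [measurable_cong, simp]: "sets \<nu> = sets X" and [simp]: "space \<nu> = space X" by (simp_all add: \<nu>_def)
  interpret \<nu>: finite_measure \<nu> unfolding \<nu>_def by (rule \<mu>.finite_measure_distr) measurable
  have vimage: "fst -` B \<inter> space \<mu> = B \<times> UNIV" if "B \<in> sets X" for B
    using sets.sets_into_space[OF that] by (auto simp: sp)
  have \<nu>_eq: "emeasure \<nu> B = emeasure \<mu> (B \<times> UNIV)" if "B \<in> sets X" for B
    using that by (simp add: \<nu>_def emeasure_distr vimage)
  have "\<exists>f \<in> borel_measurable X. \<forall>B \<in> sets X. (\<integral>\<^sup>+x\<in>B. f x \<partial>\<nu>) = emeasure \<mu> (B \<times> {..r})" for r
  proof -
    define \<nu>r where "\<nu>r = distr (density \<mu> (indicator (space X \<times> {..r}))) X fst"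
    have e: "emeasure \<nu>r B = emeasure \<mu> (B \<times> {..r})" if [measurable]: "B \<in> sets X" for B
    proof -
      have "emeasure \<nu>r B = (\<integral>\<^sup>+z. indicator (space X \<times> {..r}) z * indicator (B \<times> UNIV) z \<partial>\<mu>)"
        by (simp add: \<nu>r_def emeasure_distr emeasure_density vimage)
      also have "\<dots> = (\<integral>\<^sup>+z. indicator (B \<times> {..r}) z \<partial>\<mu>)"
        using sets.sets_into_space[OF that] by (intro nn_integral_cong) (auto split: split_indicator)
      finally show ?thesis by simp
    qed
    have "absolutely_continuous \<nu> \<nu>r"
      unfolding absolutely_continuous_def
    proof
      fix B assume "B \<in> null_sets \<nu>"
      then have B: "B \<in> sets X" "emeasure \<mu> (B \<times> UNIV) = 0" by (auto simp: null_sets_def \<nu>_eq)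
      have "emeasure \<mu> (B \<times> {..r}) \<le> emeasure \<mu> (B \<times> UNIV)"
        using B by (intro emeasure_mono) auto
      then show "B \<in> null_sets \<nu>r" using B by (simp add: null_sets_def e) (simp add: \<nu>r_def)
    qed
    moreover have "sets \<nu>r = sets \<nu>" by (simp add: \<nu>r_def)
    ultimately obtain f where f: "f \<in> borel_measurable \<nu>" "density \<nu> f = \<nu>r"
      using \<nu>.Radon_Nikodym by blast
    have "(\<integral>\<^sup>+x\<in>B. f x \<partial>\<nu>) = emeasure \<mu> (B \<times> {..r})" if "B \<in> sets X" for B
      using e[OF that] f(1) that unfolding f(2)[symmetric] by (simp add: emeasure_density)
    then show ?thesis using f(1) by (intro bexI[of _ f]) auto
  qed
  then obtain f where f[measurable]: "\<And>r. f r \<in> borel_measurable X"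
    and f_int: "\<And>r B. B \<in> sets X \<Longrightarrow> (\<integral>\<^sup>+x\<in>B. f r x \<partial>\<nu>) = emeasure \<mu> (B \<times> {..r})"
    by metis
  have f_fin: "(\<integral>\<^sup>+x. f r x \<partial>\<nu>) < \<infinity>" for r
  proof -
    have "(\<integral>\<^sup>+x. f r x \<partial>\<nu>) = (\<integral>\<^sup>+x\<in>space X. f r x \<partial>\<nu>)"
      by (intro nn_integral_cong) auto
    then show ?thesis using \<mu>.emeasure_finite[of "space X \<times> {..r}"] by (simp add: f_int \<mu>.emeasure_finite less_top[symmetric])
  qed
  have f_mono: "AE x in \<nu>. f r x \<le> f s x" if "r \<le> s" for r s
    by (rule AE_le_if_set_integrals_le) (use f_fin that in \<open>auto simp: f_int intro!: emeasure_mono\<close>)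
  have f_le1: "AE x in \<nu>. f r x \<le> 1" for r
    by (rule AE_le_if_set_integrals_le) (use f_fin in \<open>auto simp: f_int \<nu>_eq intro!: emeasure_mono\<close>)
  \<comment> \<open>For every \<open>x\<close>, not only almost every one, \<open>G\<close> is monotone and right continuous in \<open>r\<close>.\<close>
  define G where "G r x = (INF q \<in> \<rat> \<inter> {r<..}. min 1 (f q x))" for r x
  define F where "F x r = (if r < 0 then 0 else if 1 \<le> r then 1 else enn2real (G r x))" for x r
  have G_m[measurable]: "G r \<in> borel_measurable X" for r
  proof -
    have "countable (\<rat> \<inter> {r<..})" using countable_rat by blast
    then show ?thesis unfolding G_def[abs_def] by (intro borel_measurable_INF) measurable
  qed
  have ne: "\<rat> \<inter> {r<..} \<noteq> {}" for r :: real
    using Rats_dense_in_real[of r "r + 1"] by auto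
  have G_le1: "G r x \<le> 1" for r x
  proof -
    obtain q where "q \<in> \<rat> \<inter> {r<..}" using ne by blast
    then show ?thesis unfolding G_def by (rule INF_lower2) simp
  qed
  have G_mono: "G r x \<le> G s x" if "r \<le> s" for r s x
    unfolding G_def using that by (intro INF_superset_mono) auto
  have GF: "ennreal (enn2real (G r x)) = G r x" for r x
    using G_le1[of r x] by (intro ennreal_enn2real) (metis ennreal_one_less_top order_le_less_trans infinity_ennreal_def)
  have F_01: "0 \<le> F x r" "F x r \<le> 1" for x r
    using G_le1[of r x] enn2real_mono[of "G r x" 1] by (auto simp: F_def)
  have F_mono: "F x r \<le> F x s" if "r \<le> s" for x r s
    using that G_mono[OF that, of x] G_le1[of s x] F_01[of x s] F_01[of x r]
    by (auto simp: F_def intro!: enn2real_mono intro: le_less_trans)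
  have F_cont: "continuous (at_right r) (F x)" for x r
    unfolding continuous_within
  proof (rule tendstoI)
    fix e :: real assume e: "0 < e"
    have "\<exists>q > r. F x q < F x r + e"
    proof (cases "r < 0 \<or> 1 \<le> r")
      case True
      then show ?thesis
      proof
        assume "r < 0" then show ?thesis using e by (intro exI[of _ "r/2"]) (simp add: F_def)
      next
        assume "1 \<le> r" then show ?thesis using e by (intro exI[of _ "r+1"]) (simp add: F_def)
      qed
    next
      case False
      then have Fr: "ennreal (F x r) = G r x" by (simp add: F_def GF)
      have "G r x < ennreal (F x r + e)"
        unfolding Fr[symmetric] using e F_01[of x r] by (intro ennreal_lessI) auto
      then obtain q where q: "q \<in> \<rat>" "r < q" "min 1 (f q x) < ennreal (F x r + e)"
        unfolding G_def INF_less_iff by auto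
      obtain s where s: "r < s" "s < min q 1" using dense[of r "min q 1"] q False by auto
      have "ennreal (F x s) = G s x" using s False by (simp add: F_def GF)
      also have "\<dots> \<le> min 1 (f q x)" unfolding G_def using s q by (intro INF_lower) auto
      also note q(3)
      finally have "F x s < F x r + e" using F_01[of x s] by (simp add: ennreal_less_iff)
      then show ?thesis using s by blast
    qed
    then obtain q where q: "q > r" "F x q < F x r + e" by blast
    have "\<forall>\<^sub>F s in at_right r. s < q" by (rule eventually_at_rightI[OF _ q(1)]) auto
    moreover have "\<forall>\<^sub>F s in at_right r. r < s" by (rule eventually_at_right_less)
    ultimately show "\<forall>\<^sub>F s in at_right r. dist (F x s) (F x r) < e"
    proof eventually_elim
      case (elim s)
      then show ?case using F_mono[of s q x] F_mono[of r s x] q by (simp add: dist_real_def)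
    qed
  qed
  have F_bot: "(F x \<longlongrightarrow> 0) at_bot" for x
    by (rule tendsto_eventually) (auto simp: F_def eventually_at_bot_linorder intro!: exI[of _ "-1"])
  have F_top: "(F x \<longlongrightarrow> 1) at_top" for x
    by (rule tendsto_eventually) (auto simp: F_def eventually_at_top_linorder intro!: exI[of _ 1])
  have F_m: "(\<lambda>x. F x r) \<in> borel_measurable X" for r
    unfolding F_def by measurable
  define \<tau> where "\<tau> x = interval_measure (F x)" for x
  have \<tau>_m[measurable]: "\<tau> \<in> X \<rightarrow>\<^sub>M prob_algebra borel"
    unfolding \<tau>_def[abs_def] by (rule interval_distribution_kernel) (use F_mono F_cont F_bot F_top F_m in auto)
  have \<tau>_r: "emeasure (\<tau> x) {..r} = ennreal (F x r)" for x r
    unfolding \<tau>_def by (rule emeasure_interval_measure_Iic[OF F_mono F_cont F_bot])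
  \<comment> \<open>Almost everywhere \<open>f\<^sub>r\<close> lies below all \<open>f\<^sub>q\<close> with rational \<open>q > r\<close>, hence below their infimum.\<close>
  have G_ge: "(\<integral>\<^sup>+x\<in>B. G r x \<partial>\<nu>) \<ge> emeasure \<mu> (B \<times> {..r})" if [measurable]: "B \<in> sets X" for B r
  proof -
    have "AE x in \<nu>. \<forall>q \<in> \<rat> \<inter> {r<..}. f r x \<le> f q x"
      using countable_rat f_mono by (subst AE_ball_countable) (auto intro: less_imp_le)
    with f_le1[of r] have "AE x in \<nu>. f r x \<le> G r x"
      by eventually_elim (auto simp: G_def intro!: INF_greatest)
    then have "(\<integral>\<^sup>+x\<in>B. f r x \<partial>\<nu>) \<le> (\<integral>\<^sup>+x\<in>B. G r x \<partial>\<nu>)"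
      by (intro nn_integral_mono_AE) (auto split: split_indicator)
    then show ?thesis by (simp add: f_int)
  qed
  \<comment> \<open>Conversely, the infimum lies below \<open>f\<^sub>q\<close> for rational \<open>q\<close> arbitrarily close to \<open>r\<close>; let \<open>q\<close> tend to \<open>r\<close>.\<close>
  have G_le: "(\<integral>\<^sup>+x\<in>B. G r x \<partial>\<nu>) \<le> emeasure \<mu> (B \<times> {..r})" if [measurable]: "B \<in> sets X" for B r
  proof -
    have le: "(\<integral>\<^sup>+x\<in>B. G r x \<partial>\<nu>) \<le> emeasure \<mu> (B \<times> {..r + 1 / Suc n})" for n
    proof -
      obtain q where q: "q \<in> \<rat>" "r < q" "q < r + 1 / Suc n"
        using Rats_dense_in_real[of r "r + 1 / Suc n"] by auto
      have "(\<integral>\<^sup>+x\<in>B. G r x \<partial>\<nu>) \<le> (\<integral>\<^sup>+x\<in>B. f q x \<partial>\<nu>)"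
        using q by (intro nn_integral_mono) (auto simp: G_def split: split_indicator intro!: INF_lower2[of q])
      also have "\<dots> \<le> emeasure \<mu> (B \<times> {..r + 1 / Suc n})"
        unfolding f_int[OF that] using q by (intro emeasure_mono) auto
      finally show ?thesis .
    qed
    have "(\<Inter>n. B \<times> {..r + 1 / Suc n}) = B \<times> {..r}"
    proof (intro set_eqI iffI)
      fix z assume z: "z \<in> (\<Inter>n. B \<times> {..r + 1 / Suc n})"
      have "snd z \<le> r"
      proof (rule field_le_epsilon)
        fix e :: real assume "0 < e"
        then obtain n where "1 / Suc n < e"
          using reals_Archimedean[of e] by (auto simp: inverse_eq_divide)
        moreover have "snd z \<le> r + 1 / Suc n" using z by auto
        ultimately show "snd z \<le> r + e" by linarith
      qed
      then show "z \<in> B \<times> {..r}" using z by auto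
    qed (auto simp: add_increasing2)
    moreover have "(\<lambda>n. emeasure \<mu> (B \<times> {..r + 1 / Suc n})) \<longlonglongrightarrow> emeasure \<mu> (\<Inter>n. B \<times> {..r + 1 / Suc n})"
      by (rule Lim_emeasure_decseq)
        (auto simp: decseq_def frac_le intro: order_trans)
    ultimately show ?thesis using le by (auto intro!: LIMSEQ_le_const)
  qed
  have unit_r: "emeasure \<mu> (B \<times> {..r}) = emeasure \<mu> (B \<times> UNIV)" if "1 \<le> r" "B \<in> sets X" for r B
    using unit that by (intro emeasure_eq_AE) auto
  have unit_l: "emeasure \<mu> (B \<times> {..r}) = 0" if "r < 0" "B \<in> sets X" for r B
    using unit that by (subst emeasure_eq_AE[of "B \<times> {..r}" "{}" \<mu>]) auto
  have \<tau>_Iic: "emeasure \<mu> (B \<times> {..r}) = (\<integral>\<^sup>+x\<in>B. emeasure (\<tau> x) {..r} \<partial>\<nu>)" if [measurable]: "B \<in> sets X" for B r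
  proof -
    consider "r < 0" | "1 \<le> r" | "0 \<le> r" "r < 1" by linarith
    then show ?thesis
    proof cases
      case 3
      then show ?thesis using antisym[OF G_ge G_le, of B r] by (simp add: \<tau>_r F_def GF)
    qed (simp_all add: unit_r unit_l \<tau>_r F_def \<nu>_eq)
  qed
  have "emeasure \<mu> (B \<times> \<Lambda>) = (\<integral>\<^sup>+x\<in>B. emeasure (\<tau> x) \<Lambda> \<partial>\<nu>)"
    if [measurable]: "B \<in> sets X" and [measurable]: "\<Lambda> \<in> sets borel" for B \<Lambda>
  proof (cases "space X = {}")
    case True
    then have "B = {}" using sets.sets_into_space[OF that(1)] by simp
    then show ?thesis by simp
  next
    case False
    \<comment> \<open>For fixed \<open>B\<close> both sides are finite measures in \<open>\<Lambda>\<close> with the same distribution function.\<close>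
  define M1 where "M1 = distr (density \<mu> (indicator (B \<times> UNIV))) borel snd"
    define M2 where "M2 = density \<nu> (indicator B) \<bind> \<tau>"
    have \<tau>_s: "\<tau> \<in> density \<nu> (indicator B) \<rightarrow>\<^sub>M subprob_algebra borel"
      using measurable_prob_algebraD[OF \<tau>_m] by simp
    have sM2: "sets M2 = sets borel" unfolding M2_def
      using False by (subst sets_bind_measurable[OF \<tau>_s]) auto
    have e1: "emeasure M1 C = emeasure \<mu> (B \<times> C)" if [measurable]: "C \<in> sets borel" for C
    proof -
      have v: "snd -` C \<inter> space \<mu> = space X \<times> C" by (auto simp: sp)
      have "emeasure M1 C = (\<integral>\<^sup>+z. indicator (B \<times> UNIV) z * indicator (space X \<times> C) z \<partial>\<mu>)"
        by (simp add: M1_def emeasure_distr emeasure_density v)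
      also have "\<dots> = (\<integral>\<^sup>+z. indicator (B \<times> C) z \<partial>\<mu>)"
        using sets.sets_into_space[OF \<open>B \<in> sets X\<close>] by (intro nn_integral_cong) (auto split: split_indicator)
      finally show ?thesis by simp
    qed
    have e2: "emeasure M2 C = (\<integral>\<^sup>+x\<in>B. emeasure (\<tau> x) C \<partial>\<nu>)" if [measurable]: "C \<in> sets borel" for C
    proof -
      have "(\<lambda>x. emeasure (\<tau> x) C) \<in> borel_measurable X"
        by (rule measurable_compose[OF measurable_prob_algebraD[OF \<tau>_m] measurable_emeasure_subprob_algebra[OF that]])
      then show ?thesis
        unfolding M2_def using False by (subst emeasure_bind[OF _ \<tau>_s that]) (auto simp: nn_integral_density ac_simps)
    qed
    have e12: "emeasure M1 {..r} = emeasure M2 {..r}" for r by (simp add: e1 e2 \<tau>_Iic)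
    have fin1: "finite_measure M1"
      by (rule finite_measureI) (use e1[of UNIV] \<mu>.emeasure_finite in \<open>simp add: M1_def\<close>)
    have "emeasure M2 UNIV = emeasure \<nu> B"
    proof -
      have "(\<integral>\<^sup>+x\<in>B. emeasure (\<tau> x) UNIV \<partial>\<nu>) = (\<integral>\<^sup>+x. indicator B x \<partial>\<nu>)"
      proof (intro nn_integral_cong)
        fix x assume "x \<in> space \<nu>"
        then have "\<tau> x \<in> space (prob_algebra borel)" using measurable_space[OF \<tau>_m] by auto
        then have "prob_space (\<tau> x)" "space (\<tau> x) = UNIV"
          by (auto simp: space_prob_algebra dest: sets_eq_imp_space_eq)
        then show "emeasure (\<tau> x) UNIV * indicator B x = indicator B x"
          using prob_space.emeasure_space_1[of "\<tau> x"] by simp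
      qed
      then show ?thesis by (simp add: e2)
    qed
    then have fin2: "finite_measure M2"
      using sets_eq_imp_space_eq[OF sM2] by (intro finite_measureI) simp
    have "M1 = M2"
    proof (rule cdf_unique')
      show "finite_borel_measure M1" "finite_borel_measure M2"
        using fin1 fin2 sM2 by (auto simp: finite_borel_measure_def finite_borel_measure_axioms_def M1_def)
      show "cdf M1 = cdf M2" by (simp add: cdf_def fun_eq_iff measure_def e12)
    qed
    then show ?thesis using e1[OF that(2)] e2[OF that(2)] by simp
  qed
  then show ?thesis using \<tau>_m unfolding \<nu>_def by blast
qed

text \<open>
  Points of the Cantor set, with digits \<open>0\<close> and \<open>2\<close>: unlike with binary expansions, distinct bit
  sequences have distinct codes and the first digit is read off by one comparison.
\<close>

definition ternary_code :: "(nat \<Rightarrow> bool) \<Rightarrow> real" where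
  "ternary_code b = (\<Sum>n. of_bool (b n) * 2 / 3 ^ Suc n)"

text \<open>
  Removes the first \<open>n\<close> ternary digits, so that the next digit can be read off by comparison with
  \<open>2/3\<close>; see \<open>ternary_tail_code\<close>.
\<close>

fun ternary_tail :: "nat \<Rightarrow> real \<Rightarrow> real" where
  "ternary_tail 0 r = r"
| "ternary_tail (Suc n) r = (let s = ternary_tail n r in 3 * s - (if 2 / 3 \<le> s then 2 else 0))"

lemma ternary_code_sums: "(\<lambda>n. of_bool (b n) * 2 / 3 ^ Suc n :: real) sums ternary_code b"
  and ternary_code_bounds: "0 \<le> ternary_code b" "ternary_code b \<le> 1"
proof -
  have g: "(\<lambda>n. 2 / 3 ^ Suc n :: real) sums 1"
    using sums_mult[OF geometric_sums[of "1/3 :: real"], of "2/3"] by (simp add: power_one_over field_simps)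
  have s: "summable (\<lambda>n. of_bool (b n) * 2 / 3 ^ Suc n :: real)"
    by (rule summable_comparison_test'[OF sums_summable[OF g], of 0]) auto
  show "(\<lambda>n. of_bool (b n) * 2 / 3 ^ Suc n :: real) sums ternary_code b"
    unfolding ternary_code_def using s by (rule summable_sums)
  show "0 \<le> ternary_code b" unfolding ternary_code_def using s by (rule suminf_nonneg) auto
  show "ternary_code b \<le> 1"
    unfolding sums_unique[OF g] ternary_code_def by (rule suminf_le[OF _ s sums_summable[OF g]]) auto
qed

lemma ternary_code_step: "ternary_code b = (of_bool (b 0) * 2 + ternary_code (\<lambda>n. b (Suc n))) / 3"
proof -
  have "(\<lambda>n. (of_bool (b (Suc n)) * 2 / 3 ^ Suc n) / 3 :: real) sums (ternary_code (\<lambda>n. b (Suc n)) / 3)"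
    by (rule sums_divide[OF ternary_code_sums])
  then have "(\<lambda>n. of_bool (b (Suc n)) * 2 / 3 ^ Suc (Suc n) :: real) sums (ternary_code (\<lambda>n. b (Suc n)) / 3)"
    by (simp add: field_simps)
  from sums_Suc[OF this] show ?thesis
    using sums_unique2[OF ternary_code_sums] by (fastforce simp: add_divide_distrib)
qed

lemma ternary_digit: "2 / 3 \<le> ternary_code b \<longleftrightarrow> b 0"
  using ternary_code_step[of b] ternary_code_bounds[of "\<lambda>n. b (Suc n)"] by (cases "b 0") auto

lemma ternary_tail_code: "ternary_tail n (ternary_code b) = ternary_code (\<lambda>k. b (k + n))"
proof (induction n)
  case (Suc n)
  have "ternary_code (\<lambda>k. b (k + n)) = (of_bool (b n) * 2 + ternary_code (\<lambda>k. b (k + Suc n))) / 3"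
    using ternary_code_step[of "\<lambda>k. b (k + n)"] by simp
  moreover have "2 / 3 \<le> ternary_code (\<lambda>k. b (k + n)) \<longleftrightarrow> b n"
    using ternary_digit[of "\<lambda>k. b (k + n)"] by simp
  ultimately show ?case by (cases "b n") (simp_all add: Suc Let_def)
qed simp

text \<open>
  A point \<open>a\<close> is coded by the bits that tell, for a dense sequence \<open>d\<close>, whether \<open>dist a (d i) < 1/(n+1)\<close>. The
  decoder takes for each \<open>n\<close> the first \<open>d i\<close> that the code declares to be \<open>1/(n+1)\<close>-close and passes to the
  limit. This gives a measurable left inverse on all of the reals, along which kernels can be pushed back.
\<close>

lemma polish_space_unit_interval_retract:
  "\<exists>(h :: 'a::polish_space \<Rightarrow> real) \<in> borel_measurable borel. \<exists>g \<in> borel_measurable borel.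
     (\<forall>a. h a \<in> {0..1}) \<and> (\<forall>a. g (h a) = a)"
proof -
  obtain D :: "'a set" where D: "countable D" "\<And>U. open U \<Longrightarrow> U \<noteq> {} \<Longrightarrow> \<exists>d \<in> D. d \<in> U"
    using countable_dense_exists by blast
  have "D \<noteq> {}" using D(2)[of UNIV] by auto
  define d where "d = from_nat_into D"
  have dense: "\<exists>i. dist a (d i) < e" if "0 < e" for a e
  proof -
    have "\<exists>x \<in> D. x \<in> ball a e" by (rule D(2)) (simp_all add: that not_le)
    then obtain x where "x \<in> D" "x \<in> ball a e" by blast
    then show ?thesis
      using from_nat_into_to_nat_on[OF D(1)] by (intro exI[of _ "to_nat_on D x"]) (simp add: d_def)
  qed
  define h where "h a = ternary_code (\<lambda>m. case prod_decode m of (i, n) \<Rightarrow> dist a (d i) < 1 / Suc n)" for a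
  define digit where "digit i n r = (2 / 3 \<le> ternary_tail (prod_encode (i, n)) r)" for i n r
  define p where "p r n = d (LEAST i. digit i n r)" for r n
  \<comment> \<open>Arguments that are not codes may give a divergent sequence; the default keeps the decoder measurable.\<close>
  define g where "g r = (if Cauchy (p r) then lim (p r) else d 0)" for r
  have [measurable]: "ternary_tail n \<in> borel_measurable borel" for n
    by (induction n) (simp_all add: Let_def)
  have [measurable]: "Measurable.pred borel (digit i n)" for i n
    unfolding digit_def[abs_def] by measurable
  have p[measurable]: "(\<lambda>r. p r n) \<in> borel_measurable borel" for n
    unfolding p_def by measurable
  have g: "g \<in> borel_measurable borel"
  proof (rule borel_measurable_LIMSEQ_metric)
    show "(\<lambda>n. if Cauchy (p r) then p r n else d 0) \<longlonglongrightarrow> g r" for r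
      unfolding g_def using Cauchy_convergent_iff[of "p r"] by (auto simp: convergent_LIMSEQ_iff)
  qed measurable
  have h: "h \<in> borel_measurable borel"
    unfolding h_def ternary_code_def split_beta' by measurable
  have "g (h a) = a" for a
  proof -
    have "digit i n (h a) \<longleftrightarrow> dist a (d i) < 1 / Suc n" for i n
      unfolding digit_def h_def ternary_tail_code ternary_digit by simp
    then have "p (h a) n = d (LEAST i. dist a (d i) < 1 / Suc n)" for n
      by (simp add: p_def)
    then have close: "dist a (p (h a) n) < 1 / Suc n" for n
      using LeastI_ex[OF dense[of "1 / Suc n" a]] by simp
    have "p (h a) \<longlonglongrightarrow> a"
    proof (rule metric_LIMSEQ_I)
      fix e :: real assume "0 < e"
      then obtain N where N: "1 / Suc N < e" using reals_Archimedean[of e] by (auto simp: inverse_eq_divide)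
      show "\<exists>N. \<forall>n\<ge>N. dist (p (h a) n) a < e"
      proof (intro exI allI impI)
        fix n assume "N \<le> n"
        then have "1 / Suc n \<le> 1 / Suc N" by (simp add: frac_le)
        then show "dist (p (h a) n) a < e" using close[of n] N by (simp add: dist_commute)
      qed
    qed
    then show ?thesis
      by (simp add: g_def LIMSEQ_imp_Cauchy limI)
  qed
  moreover have "h a \<in> {0..1}" for a unfolding h_def using ternary_code_bounds by simp
  ultimately show ?thesis using g h by blast
qed

text \<open>
  Transport \<open>\<mu>\<close> to the unit interval by the code, disintegrate there, and push the kernel back by the
  decoder, corrected to take values in \<open>C\<close>.
\<close>

theorem disintegration:
  fixes \<mu> :: "('x \<times> 'a::polish_space) measure"
  assumes C: "C \<in> sets borel" "C \<noteq> {}"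
    and sets_\<mu>: "sets \<mu> = sets (X \<Otimes>\<^sub>M restrict_space borel C)" and fin: "finite_measure \<mu>"
    and ne: "space X \<noteq> {}"
  shows "\<exists>\<kappa> \<in> X \<rightarrow>\<^sub>M prob_algebra (restrict_space borel C).
    \<mu> = kernel_product X (restrict_space borel C) (distr \<mu> X fst) \<kappa>"
proof -
  let ?L = "restrict_space borel C"
  note [measurable_cong] = sets_\<mu>
  interpret \<mu>: finite_measure \<mu> by fact
  have sp: "space \<mu> = space X \<times> C"
    using sets_eq_imp_space_eq[OF sets_\<mu>] by (simp add: space_pair_measure space_restrict_space)
  obtain h :: "'a \<Rightarrow> real" and g where h[measurable]: "h \<in> borel_measurable borel" and g[measurable]: "g \<in> borel_measurable borel"
    and h01: "\<And>a. h a \<in> {0..1}" and gh: "\<And>a. g (h a) = a"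
    using polish_space_unit_interval_retract[where 'a='a] by blast
  obtain c where c: "c \<in> C" using C by blast
  define g' where "g' r = (if g r \<in> C then g r else c)" for r
  have g'[measurable]: "g' \<in> borel \<rightarrow>\<^sub>M ?L"
  proof (rule measurable_restrict_space2)
    note C(1)[measurable]
    show "g' \<in> borel_measurable borel" unfolding g'_def by measurable
  qed (simp add: g'_def c)
  have [measurable]: "h \<in> ?L \<rightarrow>\<^sub>M borel" by (rule measurable_restrict_space1[OF h])
  define \<mu>' where "\<mu>' = distr \<mu> (X \<Otimes>\<^sub>M borel) (\<lambda>z. (fst z, h (snd z)))"
  have m: "distr \<mu>' X fst = distr \<mu> X fst"
    unfolding \<mu>'_def by (subst distr_distr) (auto simp: comp_def)
  have "\<exists>\<tau> \<in> X \<rightarrow>\<^sub>M prob_algebra borel. \<forall>B \<in> sets X. \<forall>\<Lambda> \<in> sets borel.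
    emeasure \<mu>' (B \<times> \<Lambda>) = (\<integral>\<^sup>+x\<in>B. emeasure (\<tau> x) \<Lambda> \<partial>distr \<mu>' X fst)"
  proof (rule disintegration_unit_interval)
    show "finite_measure \<mu>'" unfolding \<mu>'_def by (rule \<mu>.finite_measure_distr) measurable
    show "AE z in \<mu>'. snd z \<in> {0..1}" unfolding \<mu>'_def using h01 by (subst AE_distr_iff) auto
  qed (simp add: \<mu>'_def)
  then obtain \<tau> where \<tau>[measurable]: "\<tau> \<in> X \<rightarrow>\<^sub>M prob_algebra borel"
    and \<tau>_eq: "\<And>B \<Lambda>. B \<in> sets X \<Longrightarrow> \<Lambda> \<in> sets borel \<Longrightarrow>
      emeasure \<mu>' (B \<times> \<Lambda>) = (\<integral>\<^sup>+x\<in>B. emeasure (\<tau> x) \<Lambda> \<partial>distr \<mu> X fst)"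
    unfolding m by blast
  define \<kappa> where "\<kappa> x = distr (\<tau> x) ?L g'" for x
  have \<kappa>[measurable]: "\<kappa> \<in> X \<rightarrow>\<^sub>M prob_algebra ?L"
    unfolding \<kappa>_def by (rule measurable_distr_prob_space2[where M=borel]) measurable
  have sk: "sets (kernel_product X ?L (distr \<mu> X fst) \<kappa>) = sets (X \<Otimes>\<^sub>M ?L)"
    by (rule sets_kernel_product) (use ne \<kappa> in auto)
  have "\<mu> = kernel_product X ?L (distr \<mu> X fst) \<kappa>"
  proof (rule measure_eqI_generator_eq[where \<Omega>="space X \<times> C" and E="{a \<times> b | a b. a \<in> sets X \<and> b \<in> sets ?L}"
        and A="\<lambda>_. space X \<times> C"])
    show "sets \<mu> = sigma_sets (space X \<times> C) {a \<times> b |a b. a \<in> sets X \<and> b \<in> sets ?L}"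
      "sets (kernel_product X ?L (distr \<mu> X fst) \<kappa>) = sigma_sets (space X \<times> C) {a \<times> b |a b. a \<in> sets X \<and> b \<in> sets ?L}"
      by (simp_all add: sets_\<mu> sk sets_pair_measure space_restrict_space)
    show "Int_stable {a \<times> b |a b. a \<in> sets X \<and> b \<in> sets ?L}" by (rule Int_stable_pair_measure_generator)
    show "{a \<times> b |a b. a \<in> sets X \<and> b \<in> sets ?L} \<subseteq> Pow (space X \<times> C)"
      using pair_measure_closed[of X ?L] by (simp add: space_restrict_space)
    have "C \<in> sets ?L" using sets.top[of ?L] by (simp add: space_restrict_space)
    then show "range (\<lambda>_::nat. space X \<times> C) \<subseteq> {a \<times> b |a b. a \<in> sets X \<and> b \<in> sets ?L}" by auto
    fix Y assume "Y \<in> {a \<times> b |a b. a \<in> sets X \<and> b \<in> sets ?L}"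
    then obtain B \<Lambda> where Y: "Y = B \<times> \<Lambda>" and [measurable]: "B \<in> sets X" "\<Lambda> \<in> sets ?L" by auto
    have \<Lambda>C: "\<Lambda> \<subseteq> C" using sets.sets_into_space[OF \<open>\<Lambda> \<in> sets ?L\<close>] by (simp add: space_restrict_space)
    have pre[measurable]: "g' -` \<Lambda> \<in> sets borel" using measurable_sets[OF g' \<open>\<Lambda> \<in> sets ?L\<close>] by simp
    have "emeasure (kernel_product X ?L (distr \<mu> X fst) \<kappa>) (B \<times> \<Lambda>) = (\<integral>\<^sup>+x\<in>B. emeasure (\<kappa> x) \<Lambda> \<partial>distr \<mu> X fst)"
      by (rule emeasure_kernel_product) (use ne in auto)
    also have "\<dots> = (\<integral>\<^sup>+x\<in>B. emeasure (\<tau> x) (g' -` \<Lambda>) \<partial>distr \<mu> X fst)"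
    proof (rule nn_integral_cong)
      fix x assume "x \<in> space (distr \<mu> X fst)"
      then have "sets (\<tau> x) = sets borel"
        using measurable_space[OF \<tau>, of x] by (auto simp: space_prob_algebra)
      then show "emeasure (\<kappa> x) \<Lambda> * indicator B x = emeasure (\<tau> x) (g' -` \<Lambda>) * indicator B x"
        using sets_eq_imp_space_eq[of "\<tau> x" borel]
        by (simp add: \<kappa>_def emeasure_distr measurable_cong_sets[OF _ refl, of "\<tau> x" borel])
    qed
    also have "\<dots> = emeasure \<mu>' (B \<times> g' -` \<Lambda>)" by (simp add: \<tau>_eq)
    also have "\<dots> = emeasure \<mu> (B \<times> \<Lambda>)"
      unfolding \<mu>'_def
    proof (subst emeasure_distr)
      show "emeasure \<mu> ((\<lambda>z. (fst z, h (snd z))) -` (B \<times> g' -` \<Lambda>) \<inter> space \<mu>) = emeasure \<mu> (B \<times> \<Lambda>)"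
        using sets.sets_into_space[OF \<open>B \<in> sets X\<close>] \<Lambda>C
        by (intro arg_cong[where f="emeasure \<mu>"]) (auto simp: sp g'_def gh)
    qed measurable
    finally show "emeasure \<mu> Y = emeasure (kernel_product X ?L (distr \<mu> X fst) \<kappa>) Y" by (simp add: Y)
  qed (use \<mu>.emeasure_finite in auto)
  then show ?thesis using \<kappa> by blast
qed

section \<open>Admissible kernels and Markov policies\<close>

context control_model
begin

lemma target_m[measurable]: "target M \<in> sets (states M)" by (rule target_sets)

lemma transition_m[measurable]: "transition M \<in> state_action M \<rightarrow>\<^sub>M prob_algebra (states M)"
  by (rule transition_kernel)

lemma projections_m[measurable]:
  "fst \<in> state_action M \<rightarrow>\<^sub>M states M" "snd \<in> state_action M \<rightarrow>\<^sub>M action_space M"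
  by (auto simp: state_action_def)

lemma space_transition: "z \<in> space (state_action M) \<Longrightarrow> prob_space (transition M z) \<and> sets (transition M z) = sets (states M)"
  using measurable_space[OF transition_m, of z] by (simp add: space_prob_algebra)

lemma sets_marginal[simp, measurable_cong]: "sets (marginal M \<mu>) = sets (states M)"
  by (simp add: marginal_def)

lemma nn_integral_marginal:
  assumes s[measurable_cong]: "sets \<mu> = sets (state_action M)" and [measurable]: "f \<in> borel_measurable (states M)"
  shows "(\<integral>\<^sup>+x. f x \<partial>marginal M \<mu>) = (\<integral>\<^sup>+z. f (fst z) \<partial>\<mu>)"
  unfolding marginal_def by (rule nn_integral_distr) measurable

lemma emeasure_marginal:
  assumes s[measurable_cong]: "sets \<mu> = sets (state_action M)" and [measurable]: "B \<in> sets (states M)"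
  shows "emeasure (marginal M \<mu>) B = emeasure \<mu> (B \<times> space (action_space M))"
proof -
  have "fst -` B \<inter> space \<mu> = B \<times> space (action_space M)"
    using sets_eq_imp_space_eq[OF s] sets.sets_into_space[OF assms(2)]
    by (auto simp: state_action_def space_pair_measure)
  then show ?thesis unfolding marginal_def by (subst emeasure_distr) auto
qed

lemma sections_m[measurable]:
  assumes \<sigma>: "\<sigma> \<in> states M \<rightarrow>\<^sub>M prob_algebra (action_space M)" and f: "f \<in> borel_measurable (state_action M)"
  shows "(\<lambda>x. \<integral>\<^sup>+a. f (x, a) \<partial>\<sigma> x) \<in> borel_measurable (states M)"
  by (rule nn_integral_measurable_subprob_algebra2[OF _ measurable_prob_algebraD[OF \<sigma>]])
    (use f in \<open>simp add: split_beta' state_action_def\<close>)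

lemma marginal_kernel_product:
  assumes \<nu>: "sets \<nu> = sets (states M)" and ne: "space (states M) \<noteq> {}"
    and \<sigma>: "\<sigma> \<in> states M \<rightarrow>\<^sub>M prob_algebra (action_space M)"
  shows "marginal M (kernel_product (states M) (action_space M) \<nu> \<sigma>) = \<nu>"
proof (rule measure_eqI)
  let ?kp = "kernel_product (states M) (action_space M) \<nu> \<sigma>"
  have s: "sets ?kp = sets (state_action M)" by (simp add: sets_kernel_product[OF \<nu> ne \<sigma>] state_action_def)
  show "sets (marginal M ?kp) = sets \<nu>" by (simp add: \<nu>)
  fix B assume "B \<in> sets (marginal M ?kp)"
  then have B: "B \<in> sets (states M)" by simp
  have "emeasure (marginal M ?kp) B = (\<integral>\<^sup>+x\<in>B. emeasure (\<sigma> x) (space (action_space M)) \<partial>\<nu>)"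
    unfolding emeasure_marginal[OF s B]
    by (rule emeasure_kernel_product) (use \<nu> ne \<sigma> B sets_eq_imp_space_eq[OF \<nu>] in auto)
  also have "\<dots> = (\<integral>\<^sup>+x. indicator B x \<partial>\<nu>)"
  proof (rule nn_integral_cong)
    fix x assume "x \<in> space \<nu>"
    then have "\<sigma> x \<in> space (prob_algebra (action_space M))"
      using measurable_space[OF \<sigma>] sets_eq_imp_space_eq[OF \<nu>] by simp
    then have "prob_space (\<sigma> x)" "space (\<sigma> x) = space (action_space M)"
      by (auto simp: space_prob_algebra dest: sets_eq_imp_space_eq)
    then show "emeasure (\<sigma> x) (space (action_space M)) * indicator B x = indicator B x"
      using prob_space.emeasure_space_1[of "\<sigma> x"] by simp
  qed
  finally show "emeasure (marginal M ?kp) B = emeasure \<nu> B" using B \<nu> by simp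
qed

lemma admissible_kernelD:
  assumes "\<sigma> \<in> admissible_kernels M"
  shows "\<sigma> \<in> states M \<rightarrow>\<^sub>M prob_algebra (action_space M)"
    and "x \<in> space (states M) \<Longrightarrow> emeasure (\<sigma> x) (available M x) = 1"
  using assms by (auto simp: admissible_kernels_def)

text \<open>
  The section of the constraint set at \<open>x\<close> is the set of available actions, so measurability and null
  set statements about \<open>x \<mapsto> \<kappa> x (available M x)\<close> can be read off the constraint set.
\<close>

lemma constraint_section:
  assumes "\<kappa> \<in> states M \<rightarrow>\<^sub>M prob_algebra (action_space M)" and x: "x \<in> space (states M)"
  shows "(\<integral>\<^sup>+a. indicator (constraint_set M) (x, a) \<partial>\<kappa> x) = emeasure (\<kappa> x) (available M x)"
    and "(\<integral>\<^sup>+a. indicator (space (state_action M) - constraint_set M) (x, a) \<partial>\<kappa> x) = 0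
      \<longleftrightarrow> emeasure (\<kappa> x) (available M x) = 1"
proof -
  have \<kappa>: "prob_space (\<kappa> x)" "sets (\<kappa> x) = sets (action_space M)"
    using measurable_space[OF assms] by (auto simp: space_prob_algebra)
  interpret prob_space "\<kappa> x" by fact
  have av: "available M x \<in> sets (\<kappa> x)" using available_sets[OF x] \<kappa> by simp
  have sp: "space (\<kappa> x) = space (action_space M)" using \<kappa> sets_eq_imp_space_eq by blast
  have "(\<integral>\<^sup>+a. indicator (constraint_set M) (x, a) \<partial>\<kappa> x) = (\<integral>\<^sup>+a. indicator (available M x) a \<partial>\<kappa> x)"
    using x by (intro nn_integral_cong) (auto simp: constraint_set_def split: split_indicator)
  then show "(\<integral>\<^sup>+a. indicator (constraint_set M) (x, a) \<partial>\<kappa> x) = emeasure (\<kappa> x) (available M x)"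
    using av by simp
  have "(\<integral>\<^sup>+a. indicator (space (state_action M) - constraint_set M) (x, a) \<partial>\<kappa> x)
      = (\<integral>\<^sup>+a. indicator (space (\<kappa> x) - available M x) a \<partial>\<kappa> x)"
    using x by (intro nn_integral_cong)
      (auto simp: constraint_set_def state_action_def space_pair_measure sp split: split_indicator)
  also have "\<dots> = emeasure (\<kappa> x) (space (\<kappa> x) - available M x)" using av by simp
  also have "\<dots> = 0 \<longleftrightarrow> emeasure (\<kappa> x) (available M x) = 1"
    using av prob_compl[OF av] by (simp add: emeasure_eq_measure)
  finally show "(\<integral>\<^sup>+a. indicator (space (state_action M) - constraint_set M) (x, a) \<partial>\<kappa> x) = 0
      \<longleftrightarrow> emeasure (\<kappa> x) (available M x) = 1" .
qed

lemma off_constraint_m[measurable]: "space (state_action M) - constraint_set M \<in> sets (state_action M)"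
  using constraint_sets by auto

lemma kernel_product_constraint:
  assumes \<nu>: "sets \<nu> = sets (states M)" and ne: "space (states M) \<noteq> {}" and \<sigma>: "\<sigma> \<in> admissible_kernels M"
  shows "emeasure (kernel_product (states M) (action_space M) \<nu> \<sigma>) (space (state_action M) - constraint_set M) = 0"
proof -
  note \<sigma>' = admissible_kernelD[OF \<sigma>]
  have "emeasure (kernel_product (states M) (action_space M) \<nu> \<sigma>) (space (state_action M) - constraint_set M)
      = (\<integral>\<^sup>+x. \<integral>\<^sup>+a. indicator (space (state_action M) - constraint_set M) (x, a) \<partial>\<sigma> x \<partial>\<nu>)"
    by (rule emeasure_kernel_product_sections[OF \<nu> ne \<sigma>'(1)]) (use off_constraint_m in \<open>simp add: state_action_def\<close>)
  also have "\<dots> = (\<integral>\<^sup>+x. 0 \<partial>\<nu>)"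
  proof (rule nn_integral_cong)
    fix x assume "x \<in> space \<nu>"
    then have "x \<in> space (states M)" using sets_eq_imp_space_eq[OF \<nu>] by simp
    then show "(\<integral>\<^sup>+a. indicator (space (state_action M) - constraint_set M) (x, a) \<partial>\<sigma> x) = 0"
      using constraint_section(2)[OF \<sigma>'(1)] \<sigma>'(2) by blast
  qed
  finally show ?thesis by simp
qed

lemma admissible_kernels_nonempty: "admissible_kernels M \<noteq> {}"
proof -
  obtain f where f: "f \<in> states M \<rightarrow>\<^sub>M action_space M" "\<And>x. x \<in> space (states M) \<Longrightarrow> f x \<in> available M x"
    using selector by blast
  have "(\<lambda>x. return (action_space M) (f x)) \<in> admissible_kernels M"
    unfolding admissible_kernels_def
    using measurable_compose[OF f(1) measurable_return_prob_space] available_sets f(2) by (simp add: emeasure_return)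
  then show ?thesis by blast
qed

text \<open>
  The kernel obtained by disintegration charges the available actions only for almost every state; on
  the exceptional null set it is replaced by the measurable selector, which does not change the
  product.
\<close>

lemma admissible_disintegration:
  assumes \<mu>: "\<mu> \<in> finite_measures (state_action M)" and ne: "space (states M) \<noteq> {}"
    and K: "emeasure \<mu> (space (state_action M) - constraint_set M) = 0"
  shows "\<exists>\<sigma> \<in> admissible_kernels M. \<mu> = kernel_product (states M) (action_space M) (marginal M \<mu>) \<sigma>"
proof -
  let ?X = "states M" and ?A = "action_space M"
  have s\<mu>: "sets \<mu> = sets (?X \<Otimes>\<^sub>M ?A)" and fin: "finite_measure \<mu>"
    using \<mu> by (auto simp: finite_measures_def state_action_def)
  obtain f where f: "f \<in> ?X \<rightarrow>\<^sub>M ?A" using selector by blast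
  have "actions M \<noteq> {}"
    using ne measurable_space[OF f] by (auto simp: action_space_def space_restrict_space)
  from disintegration[OF actions_borel this s\<mu>[unfolded action_space_def] fin ne]
  obtain \<kappa> where \<kappa>[measurable]: "\<kappa> \<in> ?X \<rightarrow>\<^sub>M prob_algebra ?A"
    and \<mu>_eq: "\<mu> = kernel_product ?X ?A (marginal M \<mu>) \<kappa>"
    unfolding action_space_def marginal_def by blast
  obtain \<delta> where \<delta>: "\<delta> \<in> admissible_kernels M" using admissible_kernels_nonempty by blast
  note [measurable] = admissible_kernelD(1)[OF \<delta>]
  define \<sigma> where "\<sigma> x = (if emeasure (\<kappa> x) (available M x) = 1 then \<kappa> x else \<delta> x)" for x
  have "(\<lambda>x. \<integral>\<^sup>+a. indicator (constraint_set M) (x, a) \<partial>\<kappa> x) \<in> borel_measurable ?X"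
    by (rule sections_m[OF \<kappa>]) (use constraint_sets in simp)
  then have [measurable]: "(\<lambda>x. emeasure (\<kappa> x) (available M x)) \<in> borel_measurable ?X"
    by (simp add: constraint_section(1)[OF \<kappa>] cong: measurable_cong)
  have \<sigma>_m: "\<sigma> \<in> ?X \<rightarrow>\<^sub>M prob_algebra ?A" unfolding \<sigma>_def by measurable
  have \<sigma>: "\<sigma> \<in> admissible_kernels M"
    using \<sigma>_m admissible_kernelD(2)[OF \<delta>] by (simp add: admissible_kernels_def \<sigma>_def)
  have m: "(\<lambda>x. \<integral>\<^sup>+a. indicator (space (state_action M) - constraint_set M) (x, a) \<partial>\<kappa> x) \<in> borel_measurable ?X"
    by (rule sections_m[OF \<kappa>]) (use off_constraint_m in simp)
  have "(\<integral>\<^sup>+x. \<integral>\<^sup>+a. indicator (space (state_action M) - constraint_set M) (x, a) \<partial>\<kappa> x \<partial>marginal M \<mu>) = 0"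
    using K emeasure_kernel_product_sections[OF sets_marginal ne \<kappa>, of "space (state_action M) - constraint_set M" \<mu>]
      off_constraint_m \<mu>_eq by (simp add: state_action_def)
  then have "AE x in marginal M \<mu>. (\<integral>\<^sup>+a. indicator (space (state_action M) - constraint_set M) (x, a) \<partial>\<kappa> x) = 0"
    using m by (subst (asm) nn_integral_0_iff_AE) simp_all
  then have "AE x in marginal M \<mu>. \<kappa> x = \<sigma> x"
    using AE_space[of "marginal M \<mu>"]
  proof eventually_elim
    case (elim x)
    then have "x \<in> space ?X" by (simp add: marginal_def)
    then show ?case using elim(1) constraint_section(2)[OF \<kappa>] by (simp add: \<sigma>_def)
  qed
  then have "\<mu> = kernel_product ?X ?A (marginal M \<mu>) \<sigma>"
    using \<mu>_eq kernel_product_cong_AE[OF sets_marginal ne \<kappa> \<sigma>_m] by simp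
  with \<sigma> show ?thesis by blast
qed

lemma Markov_policy:
  assumes "\<And>n. \<sigma> n \<in> admissible_kernels M"
  shows "(\<lambda>n h. \<sigma> n (snd h)) \<in> policies M"
proof -
  have "snd \<in> history_space M n \<rightarrow>\<^sub>M states M" for n unfolding history_space_def by measurable
  then show ?thesis
    using admissible_kernelD[OF assms] measurable_compose[of snd] measurable_space[of snd]
    unfolding policies_def by blast
qed

lemma stationary_policy:
  assumes "\<sigma> \<in> admissible_kernels M"
  shows "stationary \<sigma> \<in> policies M"
  using Markov_policy[of "\<lambda>_. \<sigma>"] assms by (simp add: stationary_def[abs_def])

end

section \<open>Transitions killed at the target\<close>

definition off_target :: "('x, 'a) mdp \<Rightarrow> 'x measure \<Rightarrow> 'x measure" where
  "off_target M \<rho> = density \<rho> (indicator (space (states M) - target M))"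

text \<open>
  The law of the next state on the event that it lies off the target, when the current
  state-action pair is distributed according to \<open>\<mu>\<close>.
\<close>

definition killed_step :: "('x, 'a::polish_space) mdp \<Rightarrow> ('x \<times> 'a) measure \<Rightarrow> 'x measure" where
  "killed_step M \<mu> = \<mu> \<bind> (\<lambda>z. off_target M (transition M z))"

context control_model
begin

lemma sets_off_target[simp, measurable_cong]: "sets (off_target M \<rho>) = sets \<rho>"
  by (simp add: off_target_def)

lemma space_off_target[simp]: "space (off_target M \<rho>) = space \<rho>"
  by (simp add: off_target_def)

lemma emeasure_off_target:
  assumes [measurable_cong]: "sets \<rho> = sets (states M)" and [measurable]: "B \<in> sets (states M)"
  shows "emeasure (off_target M \<rho>) B = emeasure \<rho> (B - target M)"
proof -
  have "emeasure (off_target M \<rho>) B = (\<integral>\<^sup>+x. indicator (space (states M) - target M) x * indicator B x \<partial>\<rho>)"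
    unfolding off_target_def by (rule emeasure_density) measurable
  also have "\<dots> = (\<integral>\<^sup>+x. indicator (B - target M) x \<partial>\<rho>)"
    using sets.sets_into_space[OF assms(2)] by (intro nn_integral_cong) (auto split: split_indicator)
  finally show ?thesis using assms by simp
qed

lemma off_target_kernel[measurable]:
  "(\<lambda>z. off_target M (transition M z)) \<in> state_action M \<rightarrow>\<^sub>M subprob_algebra (states M)"
proof (rule measurable_subprob_algebra)
  fix z assume z: "z \<in> space (state_action M)"
  have Q: "prob_space (transition M z)" "sets (transition M z) = sets (states M)"
    using space_transition[OF z] by auto
  interpret prob_space "transition M z" by (rule Q(1))
  show "sets (off_target M (transition M z)) = sets (states M)" using Q(2) by simp
  show "subprob_space (off_target M (transition M z))"
  proof
    have "emeasure (off_target M (transition M z)) (space (states M)) \<le> 1"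
      unfolding emeasure_off_target[OF Q(2) sets.top] by (rule measure_le_1)
    then show "emeasure (off_target M (transition M z)) (space (off_target M (transition M z))) \<le> 1"
      unfolding space_off_target sets_eq_imp_space_eq[OF Q(2)] .
    show "space (off_target M (transition M z)) \<noteq> {}"
      unfolding space_off_target by (rule not_empty)
  qed
next
  fix B assume [measurable]: "B \<in> sets (states M)"
  have "(\<lambda>z. emeasure (transition M z) (B - target M)) \<in> borel_measurable (state_action M)"
    by (rule measurable_compose[OF measurable_prob_algebraD[OF transition_m] measurable_emeasure_subprob_algebra]) measurable
  moreover have "emeasure (off_target M (transition M z)) B = emeasure (transition M z) (B - target M)"
    if "z \<in> space (state_action M)" for z
    using space_transition[OF that] by (intro emeasure_off_target) auto
  ultimately show "(\<lambda>z. emeasure (off_target M (transition M z)) B) \<in> borel_measurable (state_action M)"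
    by (simp cong: measurable_cong)
qed

lemma nn_integral_killed_step:
  assumes s: "sets \<mu> = sets (state_action M)" and f: "f \<in> borel_measurable (states M)"
  shows "(\<integral>\<^sup>+x. f x \<partial>killed_step M \<mu>) = (\<integral>\<^sup>+z. \<integral>\<^sup>+x. f x \<partial>off_target M (transition M z) \<partial>\<mu>)"
  unfolding killed_step_def
  by (rule nn_integral_bind[OF f]) (simp add: measurable_cong_sets[OF s refl])

lemma sets_killed_step:
  assumes "sets \<mu> = sets (state_action M)" "space (state_action M) \<noteq> {}"
  shows "sets (killed_step M \<mu>) = sets (states M)"
  unfolding killed_step_def
  by (rule sets_bind_measurable)
    (use assms sets_eq_imp_space_eq[OF assms(1)] in \<open>simp_all add: measurable_cong_sets[OF assms(1) refl]\<close>)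

lemma emeasure_killed_step:
  assumes s: "sets \<mu> = sets (state_action M)" and ne: "space (state_action M) \<noteq> {}"
    and B: "B \<in> sets (states M)"
  shows "emeasure (killed_step M \<mu>) B = (\<integral>\<^sup>+z. emeasure (transition M z) (B - target M) \<partial>\<mu>)"
proof -
  have "emeasure (killed_step M \<mu>) B = (\<integral>\<^sup>+z. emeasure (off_target M (transition M z)) B \<partial>\<mu>)"
    unfolding killed_step_def
    by (rule emeasure_bind) (use ne B sets_eq_imp_space_eq[OF s] in \<open>simp_all add: measurable_cong_sets[OF s refl]\<close>)
  also have "\<dots> = (\<integral>\<^sup>+z. emeasure (transition M z) (B - target M) \<partial>\<mu>)"
    using B sets_eq_imp_space_eq[OF s] by (intro nn_integral_cong emeasure_off_target) (auto simp: space_transition)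
  finally show ?thesis .
qed

text \<open>
  The characteristic equations as one equation between measures, which allows integrating arbitrary
  functions against both sides.
\<close>

lemma characteristic_solutions_iff:
  assumes \<eta>: "\<eta> \<in> space (prob_algebra (states M))" and ne: "space (state_action M) \<noteq> {}"
  shows "\<mu> \<in> characteristic_solutions M \<eta> \<longleftrightarrow> \<mu> \<in> finite_measures (state_action M) \<and>
    emeasure \<mu> (space (state_action M) - constraint_set M) = 0 \<and>
    marginal M \<mu> = measure_add (off_target M \<eta>) (killed_step M \<mu>)"
proof -
  have s\<eta>: "sets \<eta> = sets (states M)" using \<eta> by (simp add: space_prob_algebra)
  have "(marginal M \<mu> = measure_add (off_target M \<eta>) (killed_step M \<mu>)) \<longleftrightarrow>
    (\<forall>B \<in> sets (states M). emeasure (marginal M \<mu>) B =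
        emeasure \<eta> (B - target M) + (\<integral>\<^sup>+z. emeasure (transition M z) (B - target M) \<partial>\<mu>))"
    if s: "sets \<mu> = sets (state_action M)"
  proof -
    have "emeasure (measure_add (off_target M \<eta>) (killed_step M \<mu>)) B =
        emeasure \<eta> (B - target M) + (\<integral>\<^sup>+z. emeasure (transition M z) (B - target M) \<partial>\<mu>)"
      if "B \<in> sets (states M)" for B
      using that s\<eta> s ne by (subst emeasure_measure_add) (simp_all add: sets_killed_step emeasure_off_target emeasure_killed_step)
    then show ?thesis
      by (auto intro!: measure_eqI simp: s\<eta>)
  qed
  then show ?thesis unfolding characteristic_solutions_def finite_measures_def by auto
qed

lemma invariant_measures_iff:
  assumes ne: "space (state_action M) \<noteq> {}"
  shows "\<theta> \<in> invariant_measures M \<longleftrightarrow> \<theta> \<in> finite_measures (state_action M) \<and>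
    emeasure \<theta> (space (state_action M) - constraint_set M) = 0 \<and> marginal M \<theta> = killed_step M \<theta>"
proof -
  have "(marginal M \<theta> = killed_step M \<theta>) \<longleftrightarrow>
    (\<forall>B \<in> sets (states M). emeasure (marginal M \<theta>) B = (\<integral>\<^sup>+z. emeasure (transition M z) (B - target M) \<partial>\<theta>))"
    if s: "sets \<theta> = sets (state_action M)"
    using emeasure_killed_step[OF s ne] sets_killed_step[OF s ne]
    by (auto intro!: measure_eqI)
  then show ?thesis unfolding invariant_measures_def finite_measures_def by auto
qed

end

section \<open>Laws of the process before absorption\<close>

text \<open>
  The subprobability law of \<open>(X\<^sub>t, A\<^sub>t)\<close> on the event that the target has not been reached by time \<open>t\<close>.
  The occupation measure is the sum of these laws over \<open>t\<close>; see \<open>emeasure_occupation_law\<close>.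
\<close>

definition surviving_law ::
    "('x, 'a::polish_space) mdp \<Rightarrow> 'x measure \<Rightarrow> (nat \<Rightarrow> (nat \<Rightarrow> 'x \<times> 'a) \<times> 'x \<Rightarrow> 'a measure)
      \<Rightarrow> nat \<Rightarrow> ('x \<times> 'a) measure" where
  "surviving_law M \<eta> \<pi> t = distr
     (density (path_measure M \<eta> \<pi>) (\<lambda>\<omega>. indicator {\<omega>. hitting_time M \<omega> > enat t} \<omega>))
     (state_action M) (\<lambda>\<omega>. \<omega> t)"

context controlled_process
begin

abbreviation "P \<equiv> path_measure M \<eta> \<pi>"
abbreviation "law \<equiv> surviving_law M \<eta> \<pi>"

lemma sets_\<eta>: "sets \<eta> = sets X" and prob_\<eta>: "prob_space \<eta>"
  using \<eta> by (simp_all add: space_prob_algebra)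

lemma path_prob: "prob_space P" and sets_path[measurable_cong]: "sets P = sets (path_space M)"
  using is_path_measure_path_measure by (simp_all add: is_path_measure_def)

lemma surviving_m[measurable]: "Measurable.pred (path_space M) (\<lambda>\<omega>. hitting_time M \<omega> > enat t)"
  unfolding less_hitting_time_iff by measurable

lemma space_X: "space X \<noteq> {}"
  using prob_space.not_empty[OF prob_\<eta>] sets_eq_imp_space_eq[OF sets_\<eta>] by simp

lemma sets_law[simp, measurable_cong]: "sets (law t) = sets S"
  by (simp add: surviving_law_def)

lemma nn_integral_law:
  assumes [measurable]: "f \<in> borel_measurable S"
  shows "(\<integral>\<^sup>+z. f z \<partial>law t) = (\<integral>\<^sup>+\<omega>. indicator {\<omega>. hitting_time M \<omega> > enat t} \<omega> * f (\<omega> t) \<partial>P)"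
proof -
  have [measurable]: "(\<lambda>\<omega>. indicator {\<omega>. hitting_time M \<omega> > enat t} \<omega> :: ennreal) \<in> borel_measurable P"
    unfolding indicator_def mem_Collect_eq by measurable
  have "(\<integral>\<^sup>+z. f z \<partial>law t) = (\<integral>\<^sup>+\<omega>. f (\<omega> t)
      \<partial>density P (\<lambda>\<omega>. indicator {\<omega>. hitting_time M \<omega> > enat t} \<omega>))"
    unfolding surviving_law_def by (rule nn_integral_distr[where T="\<lambda>\<omega>. \<omega> t"])
      (simp_all add: coordinate_m measurable_cong_sets[OF sets_path refl])
  also have "\<dots> = (\<integral>\<^sup>+\<omega>. indicator {\<omega>. hitting_time M \<omega> > enat t} \<omega> * f (\<omega> t) \<partial>P)"
    by (rule nn_integral_density[where f="indicator {\<omega>. hitting_time M \<omega> > enat t}"]) measurable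
  finally show ?thesis .
qed

lemma emeasure_law:
  assumes "\<Gamma> \<in> sets S"
  shows "emeasure (law t) \<Gamma> = (\<integral>\<^sup>+\<omega>. indicator {\<omega>. hitting_time M \<omega> > enat t} \<omega> * indicator \<Gamma> (\<omega> t) \<partial>P)"
  using nn_integral_law[of "indicator \<Gamma>" t] assms by simp

lemma law_subprob: "law t \<in> space (subprob_algebra S)"
proof -
  interpret P: prob_space P by (rule path_prob)
  have "emeasure (law t) (space S) \<le> (\<integral>\<^sup>+\<omega>. 1 \<partial>P)"
    by (subst emeasure_law[OF sets.top], intro nn_integral_mono) (auto split: split_indicator)
  also have "\<dots> = 1" by (simp add: P.emeasure_space_1)
  finally have "emeasure (law t) (space S) \<le> 1" .
  moreover have "space S \<noteq> {}"
    using P.not_empty measurable_space[OF coordinate_m, of _ 0] sets_eq_imp_space_eq[OF sets_path] by blast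
  ultimately show ?thesis
    using sets_eq_imp_space_eq[OF sets_law] by (auto simp: space_subprob_algebra intro!: subprob_spaceI)
qed

lemma space_S: "space S \<noteq> {}"
  using law_subprob[of 0] sets_eq_imp_space_eq[OF sets_law[of 0]]
  by (auto simp: space_subprob_algebra dest: subprob_space.subprob_not_empty)

lemma sets_occupation: "sets (occupation_measure M \<eta> \<pi>) = sets S"
  by (simp add: occupation_measure_def)

lemma emeasure_occupation_law:
  assumes [measurable]: "\<Gamma> \<in> sets S"
  shows "emeasure (occupation_measure M \<eta> \<pi>) \<Gamma> = (\<Sum>t. emeasure (law t) \<Gamma>)"
proof -
  have [measurable]: "(\<lambda>\<omega>. indicator {\<omega>. hitting_time M \<omega> > enat t} \<omega> :: ennreal) \<in> borel_measurable P" for t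
    unfolding indicator_def mem_Collect_eq by measurable
  have i: "indicator {\<omega>. \<omega> t \<in> \<Gamma>} \<omega> = (indicator \<Gamma> (\<omega> t) :: ennreal)" for t and \<omega> :: "nat \<Rightarrow> 'x \<times> 'a"
    by (simp add: indicator_def)
  show ?thesis
    unfolding emeasure_occupation_measure[OF assms] i emeasure_law[OF assms]
    by (rule nn_integral_suminf) measurable
qed

text \<open>
  Writing the occupation measure as a mixture over counting measure makes the integral formula
  a case of the one for the Giry monad.
\<close>

lemma occupation_bind: "occupation_measure M \<eta> \<pi> = count_space UNIV \<bind> law"
proof (rule measure_eqI)
  have l: "law \<in> count_space UNIV \<rightarrow>\<^sub>M subprob_algebra S" using law_subprob by auto
  show "sets (occupation_measure M \<eta> \<pi>) = sets (count_space UNIV \<bind> law)"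
    by (simp add: sets_occupation sets_bind_measurable[OF l])
  fix \<Gamma> assume "\<Gamma> \<in> sets (occupation_measure M \<eta> \<pi>)"
  then show "emeasure (occupation_measure M \<eta> \<pi>) \<Gamma> = emeasure (count_space UNIV \<bind> law) \<Gamma>"
    by (simp add: sets_occupation emeasure_occupation_law emeasure_bind[OF _ l] nn_integral_count_space_nat)
qed

lemma nn_integral_occupation:
  assumes "f \<in> borel_measurable S"
  shows "(\<integral>\<^sup>+z. f z \<partial>occupation_measure M \<eta> \<pi>) = (\<Sum>t. \<integral>\<^sup>+z. f z \<partial>law t)"
  unfolding occupation_bind
  by (subst nn_integral_bind[OF assms]) (use law_subprob in \<open>auto simp: nn_integral_count_space_nat\<close>)

text \<open>
  The number of times \<open>t\<close> with \<open>t < T\<close> is \<open>T\<close>, so the absorbing property says exactly that all occupation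
  measures are finite.
\<close>

lemma emeasure_occupation_space:
  "emeasure (occupation_measure M \<eta> \<pi>) (space S) = (\<integral>\<^sup>+\<omega>. ennreal_of_enat (hitting_time M \<omega>) \<partial>P)"
  unfolding emeasure_occupation_measure[OF sets.top]
proof (rule nn_integral_cong)
  fix \<omega> assume \<omega>: "\<omega> \<in> space P"
  have "(\<Sum>t. indicator {\<omega>. hitting_time M \<omega> > enat t} \<omega> * indicator {\<omega>. \<omega> t \<in> space S} \<omega> :: ennreal)
      = (\<integral>\<^sup>+t. indicator {t. enat t < hitting_time M \<omega>} t \<partial>count_space UNIV)"
    unfolding nn_integral_count_space_nat
    using \<omega> measurable_space[OF coordinate_m] sets_eq_imp_space_eq[OF sets_path]
    by (intro suminf_cong) (auto simp: indicator_def)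
  also have "\<dots> = ennreal_of_enat (hitting_time M \<omega>)"
    by (cases "hitting_time M \<omega>") (auto simp: emeasure_count_space_finite lessThan_def[symmetric])
  finally show "(\<Sum>t. indicator {\<omega>. hitting_time M \<omega> > enat t} \<omega> * indicator {\<omega>. \<omega> t \<in> space S} \<omega>)
      = ennreal_of_enat (hitting_time M \<omega>)" .
qed

lemma marginal_law_0: "marginal M (law 0) = off_target M \<eta>"
proof (rule measure_eqI)
  show "sets (marginal M (law 0)) = sets (off_target M \<eta>)" by (simp add: sets_\<eta>)
  fix B assume "B \<in> sets (marginal M (law 0))"
  then have [measurable]: "B \<in> sets X" by simp
  have "emeasure (marginal M (law 0)) B = (\<integral>\<^sup>+z. indicator B (fst z) \<partial>law 0)"
    using nn_integral_marginal[of "law 0" "indicator B"] by simp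
  also have "\<dots> = (\<integral>\<^sup>+\<omega>. indicator (B - target M) (fst (\<omega> 0)) \<partial>P)"
    by (subst nn_integral_law, measurable) (auto intro!: nn_integral_cong simp: less_hitting_time_iff split: split_indicator)
  also have "\<dots> = (\<integral>\<^sup>+x. indicator (B - target M) x \<partial>distr P X (\<lambda>\<omega>. fst (\<omega> 0)))"
    by (rule nn_integral_distr[symmetric]) measurable
  also have "distr P X (\<lambda>\<omega>. fst (\<omega> 0)) = \<eta>"
    using is_path_measure_path_measure by (simp add: is_path_measure_def)
  finally show "emeasure (marginal M (law 0)) B = emeasure (off_target M \<eta>) B"
    by (simp add: emeasure_off_target sets_\<eta>)
qed

text \<open>
  The event of survival up to time \<open>t\<close> depends on the path up to time \<open>t\<close> only, so the transition kernel is the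
  conditional law of the next state on it. The policy does not enter this recursion.
\<close>

lemma marginal_law_Suc: "marginal M (law (Suc t)) = killed_step M (law t)"
proof (rule measure_eqI)
  show "sets (marginal M (law (Suc t))) = sets (killed_step M (law t))"
    by (simp add: sets_killed_step space_S)
  fix B assume "B \<in> sets (marginal M (law (Suc t)))"
  then have B[measurable]: "B \<in> sets X" by simp
  interpret P: prob_space P by (rule path_prob)
  let ?alive = "\<lambda>h. \<forall>n\<in>{..t}. fst (h n) \<notin> target M"
  let ?f = "\<lambda>z. indicator {h. ?alive h} (fst z) * indicator (B - target M) (snd z) :: ennreal"
  have coord[measurable]: "(\<lambda>h. h n) \<in> PS (Suc t) \<rightarrow>\<^sub>M S" if "n \<in> {..t}" for n
    using that by (intro measurable_component_singleton) auto
  have alive[measurable]: "Measurable.pred (PS (Suc t)) ?alive"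
    by measurable
  have al[measurable]: "(\<lambda>h. indicator {h. ?alive h} h :: ennreal) \<in> borel_measurable (PS (Suc t))"
    unfolding indicator_def mem_Collect_eq by measurable
  have hm: "history (Suc t) \<in> P \<rightarrow>\<^sub>M H (Suc t)" by measurable
  have f_m: "?f \<in> borel_measurable (PS (Suc t) \<Otimes>\<^sub>M X)"
    by (rule borel_measurable_times_ennreal[OF measurable_compose[OF measurable_fst al]]) measurable
  have Q[measurable]: "(\<lambda>z. emeasure (transition M z) (B - target M)) \<in> borel_measurable S"
    by (rule measurable_compose[OF measurable_prob_algebraD[OF transition_m] measurable_emeasure_subprob_algebra]) measurable
  have past_P: "distr P (PS (Suc t)) (past (Suc t)) \<in> space (prob_algebra (PS (Suc t)))"
    by (auto simp: space_prob_algebra intro!: P.prob_space_distr)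
  have "emeasure (marginal M (law (Suc t))) B = (\<integral>\<^sup>+z. indicator B (fst z) \<partial>law (Suc t))"
    using nn_integral_marginal[of "law (Suc t)" "indicator B"] by simp
  also have "\<dots> = (\<integral>\<^sup>+\<omega>. ?f (history (Suc t) \<omega>) \<partial>P)"
    by (subst nn_integral_law, measurable)
      (auto intro!: nn_integral_cong simp: less_hitting_time_iff history_def past_def le_Suc_eq split: split_indicator)
  also have "\<dots> = (\<integral>\<^sup>+z. ?f z \<partial>distr P (H (Suc t)) (history (Suc t)))"
    by (rule nn_integral_distr[OF hm, symmetric]) (simp only: measurable_distr_eq1 H_alt f_m)
  also have "distr P (H (Suc t)) (history (Suc t)) =
      kernel_product (PS (Suc t)) X (distr P (PS (Suc t)) (past (Suc t))) (\<lambda>h. transition M (h t))"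
    using is_path_measure_path_measure unfolding is_path_measure_iff by blast
  also have "(\<integral>\<^sup>+z. ?f z \<partial>\<dots>) = (\<integral>\<^sup>+h. \<integral>\<^sup>+x. ?f (h, x) \<partial>transition M (h t) \<partial>distr P (PS (Suc t)) (past (Suc t)))"
    by (rule nn_integral_kernel_product[OF past_P Qm' f_m])
  also have "\<dots> = (\<integral>\<^sup>+h. indicator {h. ?alive h} h * emeasure (transition M (h t)) (B - target M) \<partial>distr P (PS (Suc t)) (past (Suc t)))"
  proof (rule nn_integral_cong)
    fix h assume "h \<in> space (distr P (PS (Suc t)) (past (Suc t)))"
    then have "h t \<in> space S" using measurable_space[OF coord[of t], of h] by simp
    then have "sets (transition M (h t)) = sets X" using space_transition by blast
    then show "(\<integral>\<^sup>+x. ?f (h, x) \<partial>transition M (h t)) = indicator {h. ?alive h} h * emeasure (transition M (h t)) (B - target M)"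
      by (simp add: nn_integral_cmult)
  qed
  also have "\<dots> = (\<integral>\<^sup>+\<omega>. indicator {\<omega>. hitting_time M \<omega> > enat t} \<omega> * emeasure (transition M (\<omega> t)) (B - target M) \<partial>P)"
    by (subst nn_integral_distr, measurable)
      (auto intro!: nn_integral_cong simp: less_hitting_time_iff past_def split: split_indicator)
  also have "\<dots> = emeasure (killed_step M (law t)) B"
    by (simp add: nn_integral_law emeasure_killed_step space_S)
  finally show "emeasure (marginal M (law (Suc t))) B = emeasure (killed_step M (law t)) B" .
qed

text \<open>
  Survival up to time \<open>t\<close> is already determined by the history up to \<open>X\<^sub>t\<close>, so the last action can be
  integrated out with the policy.
\<close>

lemma nn_integral_law_action:
  assumes g[measurable]: "g \<in> borel_measurable S"
  shows "(\<integral>\<^sup>+z. g z \<partial>law t) = (\<integral>\<^sup>+\<omega>. indicator {\<omega>. hitting_time M \<omega> > enat t} \<omega> *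
     (\<integral>\<^sup>+a. g (fst (\<omega> t), a) \<partial>\<pi> t (history t \<omega>)) \<partial>P)"
proof -
  interpret P: prob_space P by (rule path_prob)
  let ?alive = "\<lambda>h. (\<forall>n\<in>{..<t}. fst (fst h n) \<notin> target M) \<and> snd h \<notin> target M"
  let ?i = "\<lambda>h. indicator {h. ?alive h} h :: ennreal"
  have coord[measurable]: "(\<lambda>h. fst h n) \<in> H t \<rightarrow>\<^sub>M S" if "n \<in> {..<t}" for n
    unfolding H_alt by (rule measurable_compose[OF measurable_fst measurable_component_singleton]) (use that in auto)
  have sn[measurable]: "snd \<in> H t \<rightarrow>\<^sub>M X" unfolding H_alt by measurable
  have [measurable]: "Measurable.pred (H t) ?alive" by measurable
  have al[measurable]: "?i \<in> borel_measurable (H t)"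
    unfolding indicator_def mem_Collect_eq by measurable
  have gS[measurable]: "g \<in> borel_measurable (X \<Otimes>\<^sub>M A)" using g by (simp add: state_action_def)
  have gm[measurable]: "(\<lambda>z. g (snd (fst z), snd z)) \<in> borel_measurable (H t \<Otimes>\<^sub>M A)"
    by measurable
  have hm: "history t \<in> P \<rightarrow>\<^sub>M H t" by measurable
  have I: "(\<lambda>h. \<integral>\<^sup>+a. g (snd h, a) \<partial>\<pi> t h) \<in> borel_measurable (H t)"
    by (rule nn_integral_measurable_subprob_algebra2[OF _ measurable_prob_algebraD[OF \<pi>m]]) (simp add: split_beta' gm)
  have F: "(\<lambda>z. ?i (fst z) * g (snd (fst z), snd z)) \<in> borel_measurable (H t \<Otimes>\<^sub>M A)"
    by (rule borel_measurable_times_ennreal[OF measurable_compose[OF measurable_fst al] gm])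
  have ham: "(\<lambda>\<omega>. (history t \<omega>, snd (\<omega> t))) \<in> P \<rightarrow>\<^sub>M H t \<Otimes>\<^sub>M A" by measurable
  have hist_P: "distr P (H t) (history t) \<in> space (prob_algebra (H t))"
    by (auto simp: space_prob_algebra intro!: P.prob_space_distr)
  have act: "distr P (H t \<Otimes>\<^sub>M A) (\<lambda>\<omega>. (history t \<omega>, snd (\<omega> t))) = kernel_product (H t) A (distr P (H t) (history t)) (\<pi> t)"
    using is_path_measure_path_measure unfolding is_path_measure_iff by blast
  have i: "indicator {\<omega>. hitting_time M \<omega> > enat t} \<omega> = ?i (history t \<omega>)" for \<omega>
  proof -
    have "(\<forall>n\<le>t. Q n) \<longleftrightarrow> (\<forall>n\<in>{..<t}. Q n) \<and> Q t" for Q :: "nat \<Rightarrow> bool"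
      by (metis lessThan_iff less_or_eq_imp_le nat_less_le)
    then show ?thesis by (simp add: less_hitting_time_iff history_def past_def indicator_def)
  qed
  have "(\<integral>\<^sup>+z. g z \<partial>law t) = (\<integral>\<^sup>+\<omega>. (\<lambda>z. ?i (fst z) * g (snd (fst z), snd z)) (history t \<omega>, snd (\<omega> t)) \<partial>P)"
    by (simp only: nn_integral_law[OF g] i fst_conv snd_conv) (simp add: history_def)
  also have "\<dots> = (\<integral>\<^sup>+z. ?i (fst z) * g (snd (fst z), snd z) \<partial>distr P (H t \<Otimes>\<^sub>M A) (\<lambda>\<omega>. (history t \<omega>, snd (\<omega> t))))"
    by (rule nn_integral_distr[OF ham, symmetric]) (simp only: measurable_distr_eq1 F)
  also have "\<dots> = (\<integral>\<^sup>+z. ?i (fst z) * g (snd (fst z), snd z) \<partial>kernel_product (H t) A (distr P (H t) (history t)) (\<pi> t))"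
    by (simp only: act)
  also have "\<dots> = (\<integral>\<^sup>+h. \<integral>\<^sup>+a. ?i h * g (snd h, a) \<partial>\<pi> t h \<partial>distr P (H t) (history t))"
    by (subst nn_integral_kernel_product[OF hist_P \<pi>m F]) (simp only: fst_conv snd_conv)
  also have "\<dots> = (\<integral>\<^sup>+h. ?i h * (\<integral>\<^sup>+a. g (snd h, a) \<partial>\<pi> t h) \<partial>distr P (H t) (history t))"
  proof (rule nn_integral_cong)
    fix h assume "h \<in> space (distr P (H t) (history t))"
    then have h: "h \<in> space (H t)" by simp
    have s: "sets (\<pi> t h) = sets A"
      using measurable_space[OF \<pi>m h] by (simp add: space_prob_algebra)
    have "snd h \<in> space X" using measurable_space[OF sn h] .
    then have "(\<lambda>a. g (snd h, a)) \<in> borel_measurable A"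
      by (rule measurable_compose[OF measurable_Pair1' gS])
    then have "(\<lambda>a. g (snd h, a)) \<in> borel_measurable (\<pi> t h)"
      by (simp only: measurable_cong_sets[OF s refl])
    then show "(\<integral>\<^sup>+a. ?i h * g (snd h, a) \<partial>\<pi> t h) = ?i h * (\<integral>\<^sup>+a. g (snd h, a) \<partial>\<pi> t h)"
      by (rule nn_integral_cmult)
  qed
  also have "\<dots> = (\<integral>\<^sup>+\<omega>. ?i (history t \<omega>) * (\<integral>\<^sup>+a. g (snd (history t \<omega>), a) \<partial>\<pi> t (history t \<omega>)) \<partial>P)"
    by (subst nn_integral_distr[OF hm]) (simp_all only: measurable_distr_eq1 borel_measurable_times_ennreal[OF al I])
  finally show ?thesis unfolding i by (simp only: history_def snd_conv)
qed

lemma law_constraint: "emeasure (law t) (space S - constraint_set M) = 0"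
proof -
  have K: "space S - constraint_set M \<in> sets S" using constraint_sets by auto
  have "emeasure (law t) (space S - constraint_set M) = (\<integral>\<^sup>+\<omega>. 0 \<partial>P)"
    unfolding nn_integral_indicator[OF K[folded sets_law[of t]], symmetric] nn_integral_law_action[OF borel_measurable_indicator[OF K]]
  proof (rule nn_integral_cong)
    fix \<omega> assume \<omega>: "\<omega> \<in> space P"
    then have \<omega>': "\<omega> \<in> space (path_space M)" using sets_eq_imp_space_eq[OF sets_path] by simp
    have h: "history t \<omega> \<in> space (H t)" using measurable_space[OF history_m \<omega>'] .
    have x: "fst (\<omega> t) \<in> space X" using measurable_space[OF coordinate_m \<omega>'] measurable_space[OF fstS(1)] by blast
    have p: "prob_space (\<pi> t (history t \<omega>))" "sets (\<pi> t (history t \<omega>)) = sets A"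
      using measurable_space[OF \<pi>m h] by (simp_all add: space_prob_algebra)
    interpret prob_space "\<pi> t (history t \<omega>)" by fact
    have "emeasure (\<pi> t (history t \<omega>)) (available M (snd (history t \<omega>))) = 1"
      using \<pi> h unfolding policies_def by blast
    then have "emeasure (\<pi> t (history t \<omega>)) (available M (fst (\<omega> t))) = 1"
      by (simp add: history_def)
    then have "AE a in \<pi> t (history t \<omega>). a \<in> available M (fst (\<omega> t))"
      using available_sets[OF x] p(2) by (subst AE_in_set_eq_1) (auto simp: emeasure_eq_measure)
    then have "AE a in \<pi> t (history t \<omega>). indicator (space S - constraint_set M) (fst (\<omega> t), a) = (0::ennreal)"
      by eventually_elim (use x in \<open>auto simp: constraint_set_def\<close>)
    then show "indicator {\<omega>. hitting_time M \<omega> > enat t} \<omega> *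
      (\<integral>\<^sup>+a. indicator (space S - constraint_set M) (fst (\<omega> t), a) \<partial>\<pi> t (history t \<omega>)) = 0"
      by (subst nn_integral_cong_AE[where v="\<lambda>_. 0"]) auto
  qed
  then show ?thesis by simp
qed

text \<open>
  When the decision at time \<open>t\<close> depends on the current state only, the law is determined by its state
  marginal. Together with \<open>marginal_law_0\<close> and \<open>marginal_law_Suc\<close> this determines the laws of a Markov policy
  recursively.
\<close>

lemma law_Markov:
  assumes \<pi>_eq: "\<And>h. \<pi> t h = \<sigma> (snd h)" and \<sigma>[measurable]: "\<sigma> \<in> X \<rightarrow>\<^sub>M prob_algebra A"
  shows "law t = kernel_product X A (marginal M (law t)) \<sigma>"
proof (rule measure_eqI)
  show "sets (law t) = sets (kernel_product X A (marginal M (law t)) \<sigma>)"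
    by (simp add: sets_kernel_product[OF sets_marginal space_X \<sigma>] state_action_def)
  fix \<Gamma> assume "\<Gamma> \<in> sets (law t)"
  then have G[measurable]: "\<Gamma> \<in> sets S" by simp
  then have GX[measurable]: "\<Gamma> \<in> sets (X \<Otimes>\<^sub>M A)" by (simp add: state_action_def)
  have [measurable]: "(\<lambda>x. \<integral>\<^sup>+a. indicator \<Gamma> (x, a) \<partial>\<sigma> x) \<in> borel_measurable X"
    by (rule nn_integral_measurable_subprob_algebra2[OF _ measurable_prob_algebraD[OF \<sigma>]]) measurable
  have "emeasure (law t) \<Gamma> = (\<integral>\<^sup>+z. indicator \<Gamma> z \<partial>law t)" by simp
  also have "\<dots> = (\<integral>\<^sup>+\<omega>. indicator {\<omega>. hitting_time M \<omega> > enat t} \<omega> *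
      (\<integral>\<^sup>+a. indicator \<Gamma> (fst (\<omega> t), a) \<partial>\<sigma> (fst (\<omega> t))) \<partial>P)"
    by (subst nn_integral_law_action) (simp_all add: \<pi>_eq history_def)
  also have "\<dots> = (\<integral>\<^sup>+z. \<integral>\<^sup>+a. indicator \<Gamma> (fst z, a) \<partial>\<sigma> (fst z) \<partial>law t)"
    by (rule nn_integral_law[symmetric]) measurable
  also have "\<dots> = (\<integral>\<^sup>+x. \<integral>\<^sup>+a. indicator \<Gamma> (x, a) \<partial>\<sigma> x \<partial>marginal M (law t))"
    by (rule nn_integral_marginal[symmetric]) measurable
  also have "\<dots> = (\<integral>\<^sup>+z. indicator \<Gamma> z \<partial>kernel_product X A (marginal M (law t)) \<sigma>)"
    by (rule nn_integral_kernel_product_sets[symmetric]) measurable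
  also have "\<dots> = emeasure (kernel_product X A (marginal M (law t)) \<sigma>) \<Gamma>"
    by (rule nn_integral_indicator) (simp add: sets_kernel_product[OF sets_marginal space_X \<sigma>])
  finally show "emeasure (law t) \<Gamma> = emeasure (kernel_product X A (marginal M (law t)) \<sigma>) \<Gamma>" .
qed

end

section \<open>Solutions of the characteristic equations\<close>

context control_model
begin

text \<open>
  A probability measure lives on a nonempty space; this is recorded because the bind of a measure on
  the empty space is degenerate.
\<close>

lemma state_space_nonempty:
  assumes "\<eta> \<in> space (prob_algebra (states M))"
  shows "space (states M) \<noteq> {}" and "space (state_action M) \<noteq> {}"
proof -
  obtain \<sigma> where \<sigma>: "\<sigma> \<in> admissible_kernels M" using admissible_kernels_nonempty by blast
  interpret controlled_process M \<eta> "stationary \<sigma>"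
    by unfold_locales (use assms stationary_policy[OF \<sigma>] in auto)
  show "space (states M) \<noteq> {}" "space (state_action M) \<noteq> {}" by (rule space_X space_S)+
qed

lemma killed_step_measure_add:
  assumes s1: "sets \<mu>1 = sets (state_action M)" and s2: "sets \<mu>2 = sets (state_action M)"
    and ne: "space (state_action M) \<noteq> {}" and B: "B \<in> sets (states M)"
  shows "emeasure (killed_step M (measure_add \<mu>1 \<mu>2)) B = emeasure (killed_step M \<mu>1) B + emeasure (killed_step M \<mu>2) B"
proof -
  have m: "(\<lambda>z. emeasure (transition M z) (B - target M)) \<in> borel_measurable \<mu>2"
    unfolding measurable_cong_sets[OF s2 refl]
    by (rule measurable_compose[OF measurable_prob_algebraD[OF transition_m] measurable_emeasure_subprob_algebra]) (use B in measurable)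
  show ?thesis
    using nn_integral_measure_add[OF _ m, of \<mu>1] s1 s2 ne B by (simp add: emeasure_killed_step)
qed

lemma characteristic_add_invariant:
  assumes \<eta>: "\<eta> \<in> space (prob_algebra (states M))"
    and \<mu>: "\<mu> \<in> characteristic_solutions M \<eta>" and \<theta>: "\<theta> \<in> invariant_measures M"
  shows "measure_add \<mu> \<theta> \<in> characteristic_solutions M \<eta>"
proof -
  note ne = state_space_nonempty(2)[OF \<eta>]
  note \<mu>' = \<mu>[unfolded characteristic_solutions_iff[OF \<eta> ne]] and \<theta>' = \<theta>[unfolded invariant_measures_iff[OF ne]]
  have s: "sets \<mu> = sets (state_action M)" "sets \<theta> = sets (state_action M)" and "finite_measure \<mu>" "finite_measure \<theta>"
    using \<mu>' \<theta>' by (auto simp: finite_measures_def)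
  interpret \<mu>: finite_measure \<mu> by fact
  interpret \<theta>: finite_measure \<theta> by fact
  have s\<eta>: "sets \<eta> = sets (states M)" using \<eta> by (simp add: space_prob_algebra)
  have e: "emeasure (measure_add \<mu> \<theta>) \<Gamma> = emeasure \<mu> \<Gamma> + emeasure \<theta> \<Gamma>" if "\<Gamma> \<in> sets (state_action M)" for \<Gamma>
    by (rule emeasure_measure_add) (use s that in auto)
  have "finite_measure (measure_add \<mu> \<theta>)"
    by (rule finite_measureI, subst e) (use sets.top[of "measure_add \<mu> \<theta>"] s in auto)
  moreover have "marginal M (measure_add \<mu> \<theta>) = measure_add (off_target M \<eta>) (killed_step M (measure_add \<mu> \<theta>))"
  proof (rule measure_eqI)
    show "sets (marginal M (measure_add \<mu> \<theta>)) = sets (measure_add (off_target M \<eta>) (killed_step M (measure_add \<mu> \<theta>)))"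
      by (simp add: s\<eta>)
    fix B assume "B \<in> sets (marginal M (measure_add \<mu> \<theta>))"
    then have B: "B \<in> sets (states M)" by simp
    then have "B \<times> space (action_space M) \<in> sets (state_action M)" unfolding state_action_def by auto
    then have "emeasure (marginal M (measure_add \<mu> \<theta>)) B = emeasure (marginal M \<mu>) B + emeasure (marginal M \<theta>) B"
      using s B by (simp add: emeasure_marginal e)
    also have "\<dots> = emeasure (off_target M \<eta>) B + (emeasure (killed_step M \<mu>) B + emeasure (killed_step M \<theta>) B)"
      using \<mu>' \<theta>' s\<eta> B sets_killed_step[OF s(1) ne] by (simp add: emeasure_measure_add ac_simps)
    also have "\<dots> = emeasure (measure_add (off_target M \<eta>) (killed_step M (measure_add \<mu> \<theta>))) B"
      using s\<eta> B sets_killed_step[OF _ ne, of "measure_add \<mu> \<theta>"] s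
      by (simp add: emeasure_measure_add killed_step_measure_add[OF s ne B])
    finally show "emeasure (marginal M (measure_add \<mu> \<theta>)) B
        = emeasure (measure_add (off_target M \<eta>) (killed_step M (measure_add \<mu> \<theta>))) B" .
  qed
  moreover have "emeasure (measure_add \<mu> \<theta>) (space (state_action M) - constraint_set M) = 0"
    using \<mu>' \<theta>' e[OF off_constraint_m] by simp
  ultimately show ?thesis
    unfolding characteristic_solutions_iff[OF \<eta> ne] finite_measures_def using s by simp
qed

end

context controlled_process
begin

abbreviation "occ \<equiv> occupation_measure M \<eta> \<pi>"

text \<open>
  Sum the recursion for the laws over time: the first term is the initial distribution off the target and
  the remaining ones form a killed step of the whole sum.
\<close>

lemma marginal_occupation: "marginal M occ = measure_add (off_target M \<eta>) (killed_step M occ)"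
proof (rule measure_eqI)
  have s: "sets (off_target M \<eta>) = sets (killed_step M occ)"
    by (simp add: sets_killed_step[OF sets_occupation space_S] sets_\<eta>)
  show "sets (marginal M occ) = sets (measure_add (off_target M \<eta>) (killed_step M occ))"
    by (simp add: sets_\<eta>)
  fix B assume "B \<in> sets (marginal M occ)"
  then have B[measurable]: "B \<in> sets X" by simp
  have BA: "B \<times> space A \<in> sets S" unfolding state_action_def by auto
  have Q: "(\<lambda>z. emeasure (transition M z) (B - target M)) \<in> borel_measurable S"
    by (rule measurable_compose[OF measurable_prob_algebraD[OF transition_m] measurable_emeasure_subprob_algebra]) measurable
  have "emeasure (marginal M occ) B = (\<Sum>t. emeasure (marginal M (law t)) B)"
    by (simp add: emeasure_marginal sets_occupation emeasure_occupation_law[OF BA])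
  also have "\<dots> = emeasure (marginal M (law 0)) B + (\<Sum>t. emeasure (marginal M (law (Suc t))) B)"
    using suminf_offset[of "\<lambda>t. emeasure (marginal M (law t)) B" 1] by simp
  also have "\<dots> = emeasure (off_target M \<eta>) B + (\<Sum>t. \<integral>\<^sup>+z. emeasure (transition M z) (B - target M) \<partial>law t)"
    by (simp add: marginal_law_0 marginal_law_Suc emeasure_killed_step space_S)
  also have "\<dots> = emeasure (off_target M \<eta>) B + emeasure (killed_step M occ) B"
    by (simp add: nn_integral_occupation[OF Q] emeasure_killed_step sets_occupation space_S)
  also have "\<dots> = emeasure (measure_add (off_target M \<eta>) (killed_step M occ)) B"
    by (rule emeasure_measure_add[symmetric, OF s]) (simp add: sets_\<eta>)
  finally show "emeasure (marginal M occ) B = emeasure (measure_add (off_target M \<eta>) (killed_step M occ)) B" .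
qed

lemma occupation_constraint: "emeasure occ (space S - constraint_set M) = 0"
  by (simp add: emeasure_occupation_law[OF off_constraint_m] law_constraint)

lemma occupation_characteristic:
  assumes "absorbing M \<eta>"
  shows "occ \<in> characteristic_solutions M \<eta>"
proof -
  have "emeasure occ (space S) < \<infinity>"
    unfolding emeasure_occupation_space using assms \<pi> by (simp add: absorbing_def)
  then have "finite_measure occ"
    using sets_eq_imp_space_eq[OF sets_occupation] by (intro finite_measureI) auto
  then show ?thesis
    unfolding characteristic_solutions_iff[OF \<eta> space_S] finite_measures_def
    using marginal_occupation occupation_constraint sets_occupation by simp
qed

end

context control_model
begin

lemma controlled_process_stationary:
  assumes "\<eta> \<in> space (prob_algebra (states M))" and "\<sigma> \<in> admissible_kernels M"
  shows "controlled_process M \<eta> (stationary \<sigma>)"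
  by unfold_locales (use assms stationary_policy in auto)

section \<open>Decomposition of the solutions\<close>

lemma occupation_stationary:
  assumes \<eta>: "\<eta> \<in> space (prob_algebra (states M))" and \<sigma>: "\<sigma> \<in> admissible_kernels M"
  shows "occupation_measure M \<eta> (stationary \<sigma>) = kernel_product (states M) (action_space M)
    (marginal M (occupation_measure M \<eta> (stationary \<sigma>))) \<sigma>"
proof (rule measure_eqI)
  interpret controlled_process M \<eta> "stationary \<sigma>" by (rule controlled_process_stationary[OF \<eta> \<sigma>])
  note \<sigma>m = admissible_kernelD(1)[OF \<sigma>]
  have markov: "law t = kernel_product X A (marginal M (law t)) \<sigma>" for t
    by (rule law_Markov[OF _ \<sigma>m]) (simp add: stationary_def)
  show "sets occ = sets (kernel_product X A (marginal M occ) \<sigma>)"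
    by (simp add: sets_kernel_product[OF sets_marginal space_X \<sigma>m] sets_occupation state_action_def)
  fix \<Gamma> assume "\<Gamma> \<in> sets occ"
  then have \<Gamma>: "\<Gamma> \<in> sets S" by (simp add: sets_occupation)
  then have \<Gamma>': "\<Gamma> \<in> sets (X \<Otimes>\<^sub>M A)" by (simp add: state_action_def)
  let ?g = "\<lambda>x. \<integral>\<^sup>+a. indicator \<Gamma> (x, a) \<partial>\<sigma> x"
  have g: "?g \<in> borel_measurable X" by (rule sections_m[OF \<sigma>m]) (use \<Gamma> in simp)
  have "emeasure occ \<Gamma> = (\<Sum>t. emeasure (law t) \<Gamma>)" by (rule emeasure_occupation_law[OF \<Gamma>])
  also have "\<dots> = (\<Sum>t. \<integral>\<^sup>+z. ?g (fst z) \<partial>law t)"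
    by (subst markov) (simp only: emeasure_kernel_product_sections[OF sets_marginal space_X \<sigma>m \<Gamma>'] nn_integral_marginal[OF sets_law g])
  also have "\<dots> = (\<integral>\<^sup>+z. ?g (fst z) \<partial>occ)"
    by (rule nn_integral_occupation[symmetric]) (rule measurable_compose[OF fstS(1) g])
  also have "\<dots> = emeasure (kernel_product X A (marginal M occ) \<sigma>) \<Gamma>"
    by (simp only: emeasure_kernel_product_sections[OF sets_marginal space_X \<sigma>m \<Gamma>'] nn_integral_marginal[OF sets_occupation g])
  finally show "emeasure occ \<Gamma> = emeasure (kernel_product X A (marginal M occ) \<sigma>) \<Gamma>" .
qed

text \<open>
  The partial sums of the Neumann series stay below every solution. The induction is on the number of
  terms, for all test functions at once: one more step applied to the partial sum replaces a test
  function \<open>f\<close> by the function \<open>q f\<close>, and the induction hypothesis is used for that function.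
\<close>

lemma occupation_minimal:
  assumes \<eta>: "\<eta> \<in> space (prob_algebra (states M))" and \<sigma>: "\<sigma> \<in> admissible_kernels M"
    and \<mu>: "\<mu> \<in> characteristic_solutions M \<eta>"
    and \<mu>_eq: "\<mu> = kernel_product (states M) (action_space M) (marginal M \<mu>) \<sigma>"
    and B: "B \<in> sets (states M)"
  shows "emeasure (marginal M (occupation_measure M \<eta> (stationary \<sigma>))) B \<le> emeasure (marginal M \<mu>) B"
proof -
  interpret controlled_process M \<eta> "stationary \<sigma>" by (rule controlled_process_stationary[OF \<eta> \<sigma>])
  note \<sigma>m = admissible_kernelD(1)[OF \<sigma>]
  have markov: "law t = kernel_product X A (marginal M (law t)) \<sigma>" for t
    by (rule law_Markov[OF _ \<sigma>m]) (simp add: stationary_def)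
  note \<mu>' = \<mu>[unfolded characteristic_solutions_iff[OF \<eta> space_S]]
  have s: "sets \<mu> = sets S" using \<mu>' by (simp add: finite_measures_def)
  have sadd: "sets (off_target M \<eta>) = sets (killed_step M \<mu>)" by (simp add: sets_\<eta> sets_killed_step[OF s space_S])
  have "(\<Sum>t<n. \<integral>\<^sup>+x. f x \<partial>marginal M (law t)) \<le> (\<integral>\<^sup>+x. f x \<partial>marginal M \<mu>)"
    if "f \<in> borel_measurable X" for n f
    using that
  proof (induction n arbitrary: f)
    case (Suc n)
    \<comment> \<open>\<open>?g\<close> is the function \<open>q f\<close>.\<close>
    let ?h = "\<lambda>z. \<integral>\<^sup>+x. f x \<partial>off_target M (transition M z)"
    let ?g = "\<lambda>x. \<integral>\<^sup>+a. ?h (x, a) \<partial>\<sigma> x"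
    have h: "?h \<in> borel_measurable S"
      by (rule measurable_compose[OF off_target_kernel nn_integral_measurable_subprob_algebra[OF Suc.prems]])
    have g: "?g \<in> borel_measurable X" by (rule sections_m[OF \<sigma>m h])
    have step: "(\<integral>\<^sup>+x. f x \<partial>killed_step M \<rho>) = (\<integral>\<^sup>+x. ?g x \<partial>marginal M \<rho>)"
      if "sets \<rho> = sets S" and \<rho>: "\<rho> = kernel_product X A (marginal M \<rho>) \<sigma>" for \<rho>
    proof -
      have "(\<integral>\<^sup>+x. f x \<partial>killed_step M \<rho>) = (\<integral>\<^sup>+z. ?h z \<partial>\<rho>)"
        by (rule nn_integral_killed_step[OF that(1) Suc.prems])
      also have "\<dots> = (\<integral>\<^sup>+z. ?h z \<partial>kernel_product X A (marginal M \<rho>) \<sigma>)"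
        using \<rho> by simp
      also have "\<dots> = (\<integral>\<^sup>+x. ?g x \<partial>marginal M \<rho>)"
        by (rule nn_integral_kernel_product_sets[OF sets_marginal \<sigma>m]) (use h in \<open>simp add: state_action_def\<close>)
      finally show ?thesis .
    qed
    have "(\<Sum>t<Suc n. \<integral>\<^sup>+x. f x \<partial>marginal M (law t))
        = (\<integral>\<^sup>+x. f x \<partial>off_target M \<eta>) + (\<Sum>t<n. \<integral>\<^sup>+x. f x \<partial>killed_step M (law t))"
      by (simp only: sum.lessThan_Suc_shift marginal_law_0 marginal_law_Suc)
    also have "\<dots> = (\<integral>\<^sup>+x. f x \<partial>off_target M \<eta>) + (\<Sum>t<n. \<integral>\<^sup>+x. ?g x \<partial>marginal M (law t))"
      by (simp only: step[OF sets_law markov])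
    also have "\<dots> \<le> (\<integral>\<^sup>+x. f x \<partial>off_target M \<eta>) + (\<integral>\<^sup>+x. ?g x \<partial>marginal M \<mu>)"
      by (intro add_left_mono Suc.IH g)
    also have "\<dots> = (\<integral>\<^sup>+x. f x \<partial>off_target M \<eta>) + (\<integral>\<^sup>+x. f x \<partial>killed_step M \<mu>)"
      by (simp only: step[OF s \<mu>_eq])
    also have "\<dots> = (\<integral>\<^sup>+x. f x \<partial>marginal M \<mu>)"
    proof -
      have "f \<in> borel_measurable (killed_step M \<mu>)"
        using Suc.prems by (simp only: measurable_cong_sets[OF sets_killed_step[OF s space_S] refl])
      from nn_integral_measure_add[OF sadd this] show ?thesis using \<mu>' by simp
    qed
    finally show ?case .
  qed simp
  from this[of "indicator B"] B have le: "(\<Sum>t<n. emeasure (marginal M (law t)) B) \<le> emeasure (marginal M \<mu>) B" for n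
    by simp
  have BA: "B \<times> space A \<in> sets S" using B unfolding state_action_def by auto
  have "emeasure (marginal M occ) B = (\<Sum>t. emeasure (marginal M (law t)) B)"
    using B by (simp add: emeasure_marginal sets_occupation emeasure_occupation_law[OF BA])
  also have "\<dots> \<le> emeasure (marginal M \<mu>) B"
    unfolding suminf_eq_SUP using le by (intro SUP_least)
  finally show ?thesis .
qed

text \<open>
  Both the given solution and the occupation measure of its disintegrating kernel solve the same affine
  equation. Subtracting them, which is possible by minimality and finiteness, leaves a solution of the
  homogeneous one.
\<close>

lemma characteristic_decomposition:
  assumes \<eta>: "\<eta> \<in> space (prob_algebra (states M))" and abs: "absorbing M \<eta>"
    and \<mu>: "\<mu> \<in> characteristic_solutions M \<eta>"
  shows "\<exists>\<sigma> \<in> admissible_kernels M. \<exists>\<nu> \<in> finite_measures (states M).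
    kernel_product (states M) (action_space M) \<nu> \<sigma> \<in> invariant_measures M \<and>
    \<mu> = measure_add (occupation_measure M \<eta> (stationary \<sigma>)) (kernel_product (states M) (action_space M) \<nu> \<sigma>)"
proof -
  let ?X = "states M" and ?A = "action_space M" and ?S = "state_action M"
  note ne = state_space_nonempty[OF \<eta>]
  note \<mu>' = \<mu>[unfolded characteristic_solutions_iff[OF \<eta> ne(2)]]
  have s\<mu>: "sets \<mu> = sets ?S" and fin\<mu>: "finite_measure \<mu>" using \<mu>' by (auto simp: finite_measures_def)
  obtain \<sigma> where \<sigma>: "\<sigma> \<in> admissible_kernels M" and \<mu>_eq: "\<mu> = kernel_product ?X ?A (marginal M \<mu>) \<sigma>"
    using admissible_disintegration[OF _ ne(1)] \<mu>' by blast
  note \<sigma>m = admissible_kernelD(1)[OF \<sigma>]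
  interpret controlled_process M \<eta> "stationary \<sigma>" by (rule controlled_process_stationary[OF \<eta> \<sigma>])
  have occ: "occ \<in> characteristic_solutions M \<eta>" by (rule occupation_characteristic[OF abs])
  then have fin_occ: "finite_measure occ" by (simp add: characteristic_solutions_def finite_measures_def)
  have fin_marg: "finite_measure (marginal M \<rho>)" if "finite_measure \<rho>" "sets \<rho> = sets S" for \<rho>
    unfolding marginal_def using that(1)
    by (rule finite_measure.finite_measure_distr) (simp add: measurable_cong_sets[OF that(2) refl])
  note fm = fin_marg[OF fin\<mu> s\<mu>] fin_marg[OF fin_occ sets_occupation]
  define \<nu> where "\<nu> = diff_measure (marginal M \<mu>) (marginal M occ)"
  have s\<nu>: "sets \<nu> = sets X" by (simp add: \<nu>_def)
  have le: "emeasure (marginal M occ) B \<le> emeasure (marginal M \<mu>) B" if "B \<in> sets X" for B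
    by (rule occupation_minimal[OF \<eta> \<sigma> \<mu> \<mu>_eq that])
  have \<nu>_B: "emeasure \<nu> B = emeasure (marginal M \<mu>) B - emeasure (marginal M occ) B" if "B \<in> sets X" for B
    unfolding \<nu>_def by (rule emeasure_diff_measure[OF fm]) (use le that in auto)
  have marg_add: "marginal M \<mu> = measure_add (marginal M occ) \<nu>"
  proof (rule measure_eqI)
    fix B assume "B \<in> sets (marginal M \<mu>)"
    then have B: "B \<in> sets X" by simp
    have "emeasure (measure_add (marginal M occ) \<nu>) B = emeasure (marginal M occ) B + emeasure \<nu> B"
      by (rule emeasure_measure_add) (use B s\<nu> in auto)
    also have "\<dots> = emeasure (marginal M \<mu>) B"
      using le[OF B] by (simp add: \<nu>_B[OF B] add_diff_inverse_ennreal)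
    finally show "emeasure (marginal M \<mu>) B = emeasure (measure_add (marginal M occ) \<nu>) B" ..
  qed simp
  let ?\<theta> = "kernel_product X A \<nu> \<sigma>"
  have s\<theta>: "sets ?\<theta> = sets S" by (simp add: sets_kernel_product[OF s\<nu> ne(1) \<sigma>m] state_action_def)
  have \<mu>_add: "\<mu> = measure_add occ ?\<theta>"
  proof -
    have "\<mu> = kernel_product X A (measure_add (marginal M occ) \<nu>) \<sigma>" using \<mu>_eq by (simp only: marg_add)
    also have "\<dots> = measure_add (kernel_product X A (marginal M occ) \<sigma>) ?\<theta>"
      by (rule kernel_product_measure_add[OF sets_marginal s\<nu> ne(1) \<sigma>m])
    also have "\<dots> = measure_add occ ?\<theta>" by (simp only: occupation_stationary[OF \<eta> \<sigma>, symmetric])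
    finally show ?thesis .
  qed
  have marg_\<theta>: "marginal M ?\<theta> = \<nu>" by (rule marginal_kernel_product[OF s\<nu> ne(1) \<sigma>m])
  have fin\<nu>: "finite_measure \<nu>"
  proof (rule finite_measureI)
    interpret \<mu>X: finite_measure "marginal M \<mu>" by (rule fm)
    have "emeasure \<nu> (space X) \<le> emeasure (marginal M \<mu>) (space X)"
      unfolding \<nu>_B[OF sets.top] by (rule diff_le_self_ennreal)
    then show "emeasure \<nu> (space \<nu>) \<noteq> \<infinity>"
      using \<mu>X.emeasure_finite[of "space X"] sets_eq_imp_space_eq[OF s\<nu>] by (auto simp: top_unique)
  qed
  have fin\<theta>: "finite_measure ?\<theta>"
  proof (rule finite_measureI)
    interpret finite_measure \<mu> by (rule fin\<mu>)
    have "emeasure ?\<theta> (space S) \<le> emeasure occ (space S) + emeasure ?\<theta> (space S)" by simp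
    also have "\<dots> = emeasure \<mu> (space S)"
      unfolding \<mu>_add by (rule emeasure_measure_add[symmetric]) (simp_all add: sets_occupation s\<theta>)
    finally show "emeasure ?\<theta> (space ?\<theta>) \<noteq> \<infinity>"
      using emeasure_finite[of "space S"] sets_eq_imp_space_eq[OF s\<theta>] by (auto simp: top_unique)
  qed
  have "marginal M ?\<theta> = killed_step M ?\<theta>"
  proof (rule measure_eqI)
    show "sets (marginal M ?\<theta>) = sets (killed_step M ?\<theta>)" by (simp add: sets_killed_step[OF s\<theta> ne(2)])
    fix B assume "B \<in> sets (marginal M ?\<theta>)"
    then have B: "B \<in> sets X" by simp
    have "emeasure (marginal M \<mu>) B = emeasure (off_target M \<eta>) B + emeasure (killed_step M \<mu>) B"
      using \<mu>' B sets_killed_step[OF s\<mu> ne(2)] by (simp add: emeasure_measure_add sets_\<eta>)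
    also have "emeasure (killed_step M \<mu>) B = emeasure (killed_step M occ) B + emeasure (killed_step M ?\<theta>) B"
      by (subst \<mu>_add) (rule killed_step_measure_add[OF sets_occupation s\<theta> ne(2) B])
    also have "emeasure (off_target M \<eta>) B + (emeasure (killed_step M occ) B + emeasure (killed_step M ?\<theta>) B)
        = emeasure (marginal M occ) B + emeasure (killed_step M ?\<theta>) B"
      unfolding marginal_occupation
      using B sets_killed_step[OF sets_occupation ne(2)] by (simp add: emeasure_measure_add sets_\<eta> ac_simps)
    finally have "emeasure (marginal M \<mu>) B = emeasure (marginal M occ) B + emeasure (killed_step M ?\<theta>) B" .
    then show "emeasure (marginal M ?\<theta>) B = emeasure (killed_step M ?\<theta>) B"
      using finite_measure.emeasure_finite[OF fm(2), of B] by (simp add: marg_\<theta> \<nu>_B[OF B])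
  qed
  then have "?\<theta> \<in> invariant_measures M"
    unfolding invariant_measures_iff[OF ne(2)] finite_measures_def
    using fin\<theta> s\<theta> kernel_product_constraint[OF s\<nu> ne(1) \<sigma>] by simp
  then show ?thesis
    using \<sigma> \<mu>_add fin\<nu> s\<nu> by (auto simp: finite_measures_def)
qed

section \<open>Invariant measures and boundedness\<close>

lemma invariant_scale:
  assumes \<theta>: "\<theta> \<in> invariant_measures M" and r: "r < \<infinity>"
  shows "scale_measure r \<theta> \<in> invariant_measures M"
proof -
  have s[measurable_cong]: "sets \<theta> = sets (state_action M)" and "finite_measure \<theta>"
    using \<theta> by (auto simp: invariant_measures_def finite_measures_def)
  interpret finite_measure \<theta> by fact
  have "finite_measure (scale_measure r \<theta>)"
    using r emeasure_finite by (intro finite_measureI) (auto simp: space_scale_measure ennreal_mult_eq_top_iff)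
  moreover have "emeasure (marginal M (scale_measure r \<theta>)) B =
      (\<integral>\<^sup>+z. emeasure (transition M z) (B - target M) \<partial>scale_measure r \<theta>)" if B: "B \<in> sets (states M)" for B
  proof -
    have m: "(\<lambda>z. emeasure (transition M z) (B - target M)) \<in> borel_measurable \<theta>"
      unfolding measurable_cong_sets[OF s refl]
      by (rule measurable_compose[OF measurable_prob_algebraD[OF transition_m] measurable_emeasure_subprob_algebra]) (use B in measurable)
    show ?thesis
      using \<theta> B s by (simp add: nn_integral_scale_measure[OF m] emeasure_marginal invariant_measures_def)
  qed
  ultimately show ?thesis
    using \<theta> s by (auto simp: invariant_measures_def finite_measures_def)
qed

lemma null_invariant: "null_measure (state_action M) \<in> invariant_measures M"
  by (auto simp: invariant_measures_def finite_measures_def marginal_def emeasure_distr intro!: finite_measureI)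

text \<open>
  Were the masses unbounded, a suitable mixture of policies would have infinite expected absorption
  time. The mixture is formed at the level of the laws at each fixed time, so that a disintegration over
  the state space realises it by a policy, which is Markov.
\<close>

lemma occupation_measures_bounded:
  assumes \<eta>: "\<eta> \<in> space (prob_algebra (states M))" and abs: "absorbing M \<eta>"
  shows "(SUP \<mu> \<in> occupation_measures M \<eta>. emeasure \<mu> (space (state_action M))) < \<infinity>"
proof (rule ccontr)
  let ?X = "states M" and ?A = "action_space M" and ?S = "state_action M"
  note ne = state_space_nonempty[OF \<eta>]
  assume "\<not> ?thesis"
  then have top: "(SUP \<mu> \<in> occupation_measures M \<eta>. emeasure \<mu> (space ?S)) = \<infinity>"
    by (metis infinity_ennreal_def less_top)
  have "\<exists>\<pi> \<in> policies M. 2 ^ k < emeasure (occupation_measure M \<eta> \<pi>) (space ?S)" for k :: nat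
  proof -
    have "(2 ^ k :: ennreal) < (SUP \<mu> \<in> occupation_measures M \<eta>. emeasure \<mu> (space ?S))"
      unfolding top by (simp add: power_less_top_ennreal)
    then show ?thesis by (auto simp: less_SUP_iff occupation_measures_def)
  qed
  then obtain \<pi> where \<pi>: "\<And>k. \<pi> k \<in> policies M"
    and large: "\<And>k. 2 ^ k < emeasure (occupation_measure M \<eta> (\<pi> k)) (space ?S)"
    by metis
  have cp: "controlled_process M \<eta> (\<pi> k)" for k
    by unfold_locales (use \<eta> \<pi> in auto)
  \<comment> \<open>The geometric distribution with parameter \<open>1/2\<close> gives \<open>k\<close> the weight \<open>2\<^sup>-\<^sup>k\<^sup>-\<^sup>1\<close>.\<close>
  define p where "p = measure_pmf (geometric_pmf (1/2))"
  define m where "m t = p \<bind> (\<lambda>k. surviving_law M \<eta> (\<pi> k) t)" for t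
  have p_m: "(\<lambda>k. surviving_law M \<eta> (\<pi> k) t) \<in> p \<rightarrow>\<^sub>M subprob_algebra ?S" for t
    unfolding p_def using controlled_process.law_subprob[OF cp] by (simp add: measurable_def)
  have p_ne: "space p \<noteq> {}" by (simp add: p_def)
  have s_m: "sets (m t) = sets ?S" for t
    unfolding m_def by (rule sets_bind_measurable[OF p_m p_ne])
  have e_m: "emeasure (m t) \<Gamma> = (\<integral>\<^sup>+k. emeasure (surviving_law M \<eta> (\<pi> k) t) \<Gamma> \<partial>p)" if "\<Gamma> \<in> sets ?S" for t \<Gamma>
    unfolding m_def by (rule emeasure_bind[OF p_ne p_m that])
  have "finite_measure (m t)" for t
  proof (rule finite_measureI)
    have "emeasure (m t) (space ?S) \<le> (\<integral>\<^sup>+k. 1 \<partial>p)"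
      unfolding e_m[OF sets.top]
    proof (rule nn_integral_mono)
      fix k
      have "subprob_space (surviving_law M \<eta> (\<pi> k) t)" "space (surviving_law M \<eta> (\<pi> k) t) = space ?S"
        using controlled_process.law_subprob[OF cp] by (auto simp: space_subprob_algebra dest: sets_eq_imp_space_eq)
      then show "emeasure (surviving_law M \<eta> (\<pi> k) t) (space ?S) \<le> 1"
        using subprob_space.emeasure_space_le_1 by metis
    qed
    also have "\<dots> = 1" by (simp add: p_def)
    finally show "emeasure (m t) (space (m t)) \<noteq> \<infinity>"
      using sets_eq_imp_space_eq[OF s_m] by (auto simp: top_unique)
  qed
  then have m_fin: "m t \<in> finite_measures ?S" for t using s_m by (simp add: finite_measures_def)
  have m_K: "emeasure (m t) (space ?S - constraint_set M) = 0" for t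
    by (simp add: e_m[OF off_constraint_m] controlled_process.law_constraint[OF cp])
  obtain \<sigma> where \<sigma>: "\<And>t. \<sigma> t \<in> admissible_kernels M"
    and m_eq: "\<And>t. m t = kernel_product ?X ?A (marginal M (m t)) (\<sigma> t)"
    using admissible_disintegration[OF m_fin ne(1) m_K] by metis
  have rect: "B \<times> space ?A \<in> sets ?S" if "B \<in> sets ?X" for B using that unfolding state_action_def by auto
  have marg_e: "emeasure (marginal M (m t)) B = (\<integral>\<^sup>+k. emeasure (marginal M (surviving_law M \<eta> (\<pi> k) t)) B \<partial>p)"
    if "B \<in> sets ?X" for t B
    by (simp add: emeasure_marginal[OF s_m that] e_m[OF rect[OF that]]
        emeasure_marginal[OF controlled_process.sets_law[OF cp] that])
  have s\<eta>: "sets \<eta> = sets ?X" using \<eta> by (simp add: space_prob_algebra)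
  have m_0: "marginal M (m 0) = off_target M \<eta>"
    by (rule measure_eqI) (auto simp: s\<eta> marg_e controlled_process.marginal_law_0[OF cp] p_def measure_pmf.emeasure_space_1)
  have m_Suc: "marginal M (m (Suc t)) = killed_step M (m t)" for t
  proof (rule measure_eqI)
    show "sets (marginal M (m (Suc t))) = sets (killed_step M (m t))" by (simp add: sets_killed_step[OF s_m ne(2)])
    fix B assume "B \<in> sets (marginal M (m (Suc t)))"
    then have B: "B \<in> sets ?X" by simp
    have Q: "(\<lambda>z. emeasure (transition M z) (B - target M)) \<in> borel_measurable ?S"
      by (rule measurable_compose[OF measurable_prob_algebraD[OF transition_m] measurable_emeasure_subprob_algebra]) (use B in measurable)
    have "emeasure (marginal M (m (Suc t))) B
        = (\<integral>\<^sup>+k. \<integral>\<^sup>+z. emeasure (transition M z) (B - target M) \<partial>surviving_law M \<eta> (\<pi> k) t \<partial>p)"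
      by (simp add: marg_e[OF B] controlled_process.marginal_law_Suc[OF cp]
          emeasure_killed_step[OF controlled_process.sets_law[OF cp] ne(2) B])
    also have "\<dots> = (\<integral>\<^sup>+z. emeasure (transition M z) (B - target M) \<partial>m t)"
      unfolding m_def by (rule nn_integral_bind[OF Q p_m, symmetric])
    also have "\<dots> = emeasure (killed_step M (m t)) B" by (rule emeasure_killed_step[OF s_m ne(2) B, symmetric])
    finally show "emeasure (marginal M (m (Suc t))) B = emeasure (killed_step M (m t)) B" .
  qed
  define \<pi>' where "\<pi>' = (\<lambda>n (h :: (nat \<Rightarrow> 'x \<times> 'a) \<times> 'x). \<sigma> n (snd h))"
  have \<pi>': "\<pi>' \<in> policies M" unfolding \<pi>'_def by (rule Markov_policy[OF \<sigma>])
  interpret controlled_process M \<eta> \<pi>' by unfold_locales (use \<eta> \<pi>' in auto)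
  have markov: "law t = kernel_product ?X ?A (marginal M (law t)) (\<sigma> t)" for t
    by (rule law_Markov[OF _ admissible_kernelD(1)[OF \<sigma>]]) (simp add: \<pi>'_def)
  have marg: "marginal M (law t) = marginal M (m t)" for t
  proof (induction t)
    case (Suc t)
    then have "law t = m t" using markov[of t] m_eq[of t] by simp
    then show ?case by (simp add: marginal_law_Suc m_Suc)
  qed (simp add: marginal_law_0 m_0)
  have law: "law t = m t" for t using markov[of t] m_eq[of t] marg[of t] by simp
  have "emeasure occ (space ?S) = (\<Sum>t. \<integral>\<^sup>+k. emeasure (surviving_law M \<eta> (\<pi> k) t) (space ?S) \<partial>p)"
    by (simp add: emeasure_occupation_law law e_m)
  also have "\<dots> = (\<integral>\<^sup>+k. (\<Sum>t. emeasure (surviving_law M \<eta> (\<pi> k) t) (space ?S)) \<partial>p)"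
    by (rule nn_integral_suminf[symmetric]) (simp add: p_def)
  also have "\<dots> = (\<integral>\<^sup>+k. emeasure (occupation_measure M \<eta> (\<pi> k)) (space ?S) \<partial>p)"
    by (simp add: controlled_process.emeasure_occupation_law[OF cp])
  also have "\<dots> = (\<Sum>k. ennreal ((1/2) ^ Suc k) * emeasure (occupation_measure M \<eta> (\<pi> k)) (space ?S))"
    unfolding p_def nn_integral_measure_pmf nn_integral_count_space_nat by (simp add: ac_simps)
  finally have occ_sum: "emeasure occ (space ?S)
      = (\<Sum>k. ennreal ((1/2) ^ Suc k) * emeasure (occupation_measure M \<eta> (\<pi> k)) (space ?S))" .
  have "(\<Sum>k::nat. c) = \<infinity>" if "c \<noteq> 0" for c :: ennreal
  proof -
    have "(\<Sum>k::nat. c) = (\<integral>\<^sup>+k. c \<partial>count_space (UNIV :: nat set))"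
      by (rule nn_integral_count_space_nat[symmetric])
    also have "\<dots> = \<infinity>" using that by (simp add: ennreal_mult_top)
    finally show ?thesis .
  qed
  from this[of "ennreal (1/2)"] have "\<infinity> = (\<Sum>k::nat. ennreal (1/2))" by simp
  also have "\<dots> \<le> emeasure occ (space ?S)"
    unfolding occ_sum
  proof (intro suminf_le allI)
    fix k
    have "ennreal (1/2) = ennreal ((1/2) ^ Suc k) * 2 ^ k"
      by (subst ennreal_numeral[symmetric], subst ennreal_power, simp, subst ennreal_mult[symmetric])
        (auto simp: power_one_over)
    also have "\<dots> \<le> ennreal ((1/2) ^ Suc k) * emeasure (occupation_measure M \<eta> (\<pi> k)) (space ?S)"
      using large[of k] by (intro mult_left_mono) auto
    finally show "ennreal (1/2) \<le> ennreal ((1/2) ^ Suc k) * emeasure (occupation_measure M \<eta> (\<pi> k)) (space ?S)" .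
  qed auto
  finally have "emeasure occ (space ?S) = \<infinity>" by (simp add: top_unique)
  moreover have "emeasure occ (space ?S) < \<infinity>"
    unfolding emeasure_occupation_space using abs \<pi>' by (simp add: absorbing_def)
  ultimately show False by simp
qed

text \<open>
  Adding \<open>n\<close> times an invariant measure to a solution gives a solution again.
\<close>

lemma invariant_null_if_bounded:
  assumes \<eta>: "\<eta> \<in> space (prob_algebra (states M))"
    and \<mu>: "\<mu> \<in> characteristic_solutions M \<eta>"
    and bdd: "(SUP \<mu> \<in> characteristic_solutions M \<eta>. emeasure \<mu> (space (state_action M))) < \<infinity>"
    and \<theta>: "\<theta> \<in> invariant_measures M"
  shows "\<theta> = null_measure (state_action M)"
proof -
  let ?S = "state_action M"
  have s: "sets \<mu> = sets ?S" "sets \<theta> = sets ?S"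
    using \<mu> \<theta> by (auto simp: characteristic_solutions_def invariant_measures_def finite_measures_def)
  obtain c where c: "(SUP \<mu> \<in> characteristic_solutions M \<eta>. emeasure \<mu> (space ?S)) = ennreal c" "0 \<le> c"
    using bdd by (auto simp: less_top_ennreal)
  have le: "of_nat n * emeasure \<theta> (space ?S) \<le> ennreal c" for n
  proof -
    have "measure_add \<mu> (scale_measure (of_nat n) \<theta>) \<in> characteristic_solutions M \<eta>"
      by (rule characteristic_add_invariant[OF \<eta> \<mu> invariant_scale[OF \<theta>]]) (simp add: of_nat_less_top)
    then have le: "emeasure (measure_add \<mu> (scale_measure (of_nat n) \<theta>)) (space ?S) \<le> ennreal c"
      unfolding c(1)[symmetric] by (rule SUP_upper)
    have "of_nat n * emeasure \<theta> (space ?S) \<le> emeasure \<mu> (space ?S) + of_nat n * emeasure \<theta> (space ?S)"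
      by simp
    also have "\<dots> = emeasure (measure_add \<mu> (scale_measure (of_nat n) \<theta>)) (space ?S)"
      by (subst emeasure_measure_add) (simp_all add: s)
    also note le
    finally show ?thesis .
  qed
  have "emeasure \<theta> (space ?S) = 0"
  proof (rule ccontr)
    assume "emeasure \<theta> (space ?S) \<noteq> 0"
    then have "\<infinity> = (SUP n. of_nat n * emeasure \<theta> (space ?S))"
      by (simp add: SUP_mult_right_ennreal[symmetric] ennreal_SUP_of_nat_eq_top ennreal_top_mult)
    also have "\<dots> \<le> ennreal c" using le by (intro SUP_least)
    finally show False by (simp add: top_unique)
  qed
  then have null: "emeasure \<theta> \<Gamma> = 0" for \<Gamma>
    using emeasure_space[of \<theta> \<Gamma>] unfolding sets_eq_imp_space_eq[OF s(2)] by simp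
  show ?thesis
    by (rule measure_eqI) (simp_all add: s null)
qed

end

theorem theorem3p7:
  fixes M :: "('x, 'a::polish_space) mdp" and \<eta> :: "'x measure"
  assumes "control_model M"
    and "\<eta> \<in> space (prob_algebra (states M))"
    and "absorbing M \<eta>"
  shows "(\<forall>\<mu> \<in> finite_measures (state_action M).
            \<mu> \<in> characteristic_solutions M \<eta> \<longleftrightarrow>
            (\<exists>\<sigma> \<in> admissible_kernels M. \<exists>\<nu> \<in> finite_measures (states M).
               kernel_product (states M) (action_space M) \<nu> \<sigma> \<in> invariant_measures M \<and>
               \<mu> = measure_add (occupation_measure M \<eta> (stationary \<sigma>)) (kernel_product (states M) (action_space M) \<nu> \<sigma>)))
       \<and> ((invariant_measures M = {null_measure (state_action M)})
            \<longleftrightarrow> (characteristic_solutions M \<eta> = occupation_measures M \<eta>))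
       \<and> ((characteristic_solutions M \<eta> = occupation_measures M \<eta>)
            \<longleftrightarrow> ((SUP \<mu> \<in> characteristic_solutions M \<eta>. emeasure \<mu> (space (state_action M))) < \<infinity>))"
    (is "?decomposition \<and> (?null \<longleftrightarrow> ?no_phantom) \<and> (?no_phantom \<longleftrightarrow> ?bounded)")
proof -
  interpret control_model M by fact
  note \<eta> = assms(2) and abs = assms(3)
  have occ: "occupation_measure M \<eta> \<pi> \<in> characteristic_solutions M \<eta>" if "\<pi> \<in> policies M" for \<pi>
  proof -
    interpret controlled_process M \<eta> \<pi> by unfold_locales (use \<eta> that in auto)
    show ?thesis by (rule occupation_characteristic[OF abs])
  qed
  have ?decomposition
    using characteristic_decomposition[OF \<eta> abs]
      characteristic_add_invariant[OF \<eta> occ[OF stationary_policy]] by blast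
  moreover have "?no_phantom" if ?null
  proof
    show "occupation_measures M \<eta> \<subseteq> characteristic_solutions M \<eta>"
      using occ by (auto simp: occupation_measures_def)
    show "characteristic_solutions M \<eta> \<subseteq> occupation_measures M \<eta>"
    proof
      fix \<mu> assume "\<mu> \<in> characteristic_solutions M \<eta>"
      then obtain \<sigma> where \<sigma>: "\<sigma> \<in> admissible_kernels M"
        and \<mu>: "\<mu> = measure_add (occupation_measure M \<eta> (stationary \<sigma>)) (null_measure (state_action M))"
        using characteristic_decomposition[OF \<eta> abs] \<open>?null\<close> by force
      have "sets (occupation_measure M \<eta> (stationary \<sigma>)) = sets (state_action M)"
        by (simp add: occupation_measure_def)
      then have "\<mu> = occupation_measure M \<eta> (stationary \<sigma>)"
        unfolding \<mu> by (intro measure_eqI) (simp_all add: emeasure_measure_add)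
      then show "\<mu> \<in> occupation_measures M \<eta>"
        using stationary_policy[OF \<sigma>] by (simp add: occupation_measures_def)
    qed
  qed
  moreover have ?bounded if ?no_phantom
    unfolding that by (rule occupation_measures_bounded[OF \<eta> abs])
  moreover have ?null if ?bounded
  proof -
    obtain \<sigma> where "\<sigma> \<in> admissible_kernels M" using admissible_kernels_nonempty by blast
    note \<mu> = occ[OF stationary_policy[OF this]]
    show ?thesis using invariant_null_if_bounded[OF \<eta> \<mu> that] null_invariant by blast
  qed
  ultimately show ?thesis by blast
qed

end
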